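(* For every $\varphi\in H^1(\mathbb{R}^3,\mathbb{C}^2)$, $$\int_{\mathbb{R}^3}\left(\frac{|\boldsymbol{\sigma}\cdot\boldsymbol{\nabla}\varphi|^2}{1+\frac{1}{|x|}}+|\varphi|^2\right)dx\ \geq\ \int_{\mathbb{R}^3}\frac{|\varphi|^2}{|x|}\,dx .$$
   Context: $\boldsymbol{\sigma}=(\sigma_1,\sigma_2,\sigma_3)$ are the Pauli matrices $\sigma_1=\begin{pmatrix}0&1\\1&0\end{pmatrix}$, $\sigma_2=\begin{pmatrix}0&-i\\i&0\end{pmatrix}$, $\sigma_3=\begin{pmatrix}1&0\\0&-1\end{pmatrix}$, and $\boldsymbol{\sigma}\cdot\boldsymbol{\nabla}=\sum_{k=1}^3\sigma_k\partial_k$ acts on $\mathbb{C}^2$-valued functions. For $\varphi=(\varphi_1,\varphi_2)$, $|\varphi|^2=|\varphi_1|^2+|\varphi_2|^2$ and $|\boldsymbol{\sigma}\cdot\boldsymbol{\nabla}\varphi|^2=|\partial_3\varphi_1+\partial_1\varphi_2-i\,\partial_2\varphi_2|^2+|\partial_1\varphi_1+i\,\partial_2\varphi_1-\partial_3\varphi_2|^2$. *)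

theory Defs
  imports "HOL-Analysis.Analysis"
begin

definition partial_deriv :: "'n::finite \<Rightarrow> (real^'n \<Rightarrow> real) \<Rightarrow> real^'n \<Rightarrow> real" where
  "partial_deriv k f x = frechet_derivative f (at x) (axis k 1)"

primrec C_diff :: "nat \<Rightarrow> (real^'n::finite \<Rightarrow> real) \<Rightarrow> bool" where
  "C_diff 0 f \<longleftrightarrow> continuous_on UNIV f"
| "C_diff (Suc m) f \<longleftrightarrow>
     (\<forall>x. f differentiable (at x)) \<and> (\<forall>k. C_diff m (partial_deriv k f))"

definition test_functions :: "(real^'n::finite \<Rightarrow> real) set" where
  "test_functions = {\<eta>. (\<forall>m. C_diff m \<eta>) \<and> compact (closure {x. \<eta> x \<noteq> 0})}"

definition L2 :: "(real^'n::finite \<Rightarrow> complex^'d::finite) set" where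
  "L2 = {f. f \<in> borel_measurable lebesgue \<and> integrable lebesgue (\<lambda>x. (norm (f x))\<^sup>2)}"

text \<open>Real-valued test functions suffice: the complex-valued ones are their complex
  linear combinations. For \<open>f\<close> and \<open>g\<close> in \<^term>\<open>L2\<close> both integrands are
  integrable, since test functions are bounded with compact support.\<close>

definition has_weak_partial ::
  "'n::finite \<Rightarrow> (real^'n \<Rightarrow> complex^'d::finite) \<Rightarrow> (real^'n \<Rightarrow> complex^'d) \<Rightarrow> bool" where
  "has_weak_partial k f g \<longleftrightarrow>
     (\<forall>\<eta>\<in>test_functions.
        (LINT x|lebesgue. partial_deriv k \<eta> x *\<^sub>R f x) = - (LINT x|lebesgue. \<eta> x *\<^sub>R g x))"

definition H1 :: "(real^'n::finite \<Rightarrow> complex^'d::finite) set" where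
  "H1 = {f \<in> L2. \<forall>k. \<exists>g\<in>L2. has_weak_partial k f g}"

text \<open>Weak derivatives are unique up to null sets, so the choice is immaterial under an
  integral; it is meaningful for \<open>f\<close> in \<^term>\<open>H1\<close>.\<close>

definition weak_partial ::
  "'n::finite \<Rightarrow> (real^'n \<Rightarrow> complex^'d::finite) \<Rightarrow> real^'n \<Rightarrow> complex^'d" where
  "weak_partial k f = (SOME g. g \<in> L2 \<and> has_weak_partial k f g)"

definition pauli :: "3 \<Rightarrow> complex^2^2" where
  "pauli k =
     (if k = 1 then vector [vector [0, 1], vector [1, 0]]
      else if k = 2 then vector [vector [0, - \<i>], vector [\<i>, 0]]
      else vector [vector [1, 0], vector [0, - 1]])"

definition sigma_grad :: "(real^3 \<Rightarrow> complex^2) \<Rightarrow> real^3 \<Rightarrow> complex^2" where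
  "sigma_grad \<phi> x = (\<Sum>k\<in>UNIV. pauli k *v weak_partial k \<phi> x)"

lemma norm_sigma_grad_sq:
  "(norm (sigma_grad \<phi> x))\<^sup>2 =
     (cmod (weak_partial 3 \<phi> x $ 1 + weak_partial 1 \<phi> x $ 2 - \<i> * weak_partial 2 \<phi> x $ 2))\<^sup>2 +
     (cmod (weak_partial 1 \<phi> x $ 1 + \<i> * weak_partial 2 \<phi> x $ 1 - weak_partial 3 \<phi> x $ 2))\<^sup>2"
proof -
  have "sigma_grad \<phi> x $ 1 =
      weak_partial 3 \<phi> x $ 1 + weak_partial 1 \<phi> x $ 2 - \<i> * weak_partial 2 \<phi> x $ 2"
    and "sigma_grad \<phi> x $ 2 =
      weak_partial 1 \<phi> x $ 1 + \<i> * weak_partial 2 \<phi> x $ 1 - weak_partial 3 \<phi> x $ 2"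
    by (simp_all add: sigma_grad_def pauli_def sum_3 sum_2 matrix_vector_mult_def)
  then show ?thesis
    by (simp add: norm_vec_def L2_set_def sum_2)
qed

end

theory Submission
  imports Defs
begin

text \<open>
  Let \<open>D = \<sigma>\<cdot>\<nabla>\<close>, \<open>w = r / (1 + r)\<close> with \<open>r = |x|\<close>, and let \<open>K = 1 + \<sigma>\<cdot>L\<close> be the spin-orbit
  operator, so that \<open>(\<sigma>\<cdot>x) D = 1 + x\<cdot>\<nabla> - K\<close>. It is symmetric with respect to every radial weight,
  commutes with \<open>x\<cdot>\<nabla>\<close> and anticommutes with \<open>\<sigma>\<cdot>x\<close>. For \<open>\<phi> = K u\<close> expand
  \<open>0 \<le> w |D \<phi> + (1 / w) (\<sigma>\<cdot>x / r) u|\<^sup>2\<close> and integrate. The cross term is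
  \<open>(2 / r) (\<phi> + x\<cdot>\<nabla>\<phi> - K \<phi>)\<cdot>u\<close>; its part without \<open>K \<phi>\<close> integrates to zero, since
  \<open>(1 / r) (1 + x\<cdot>\<nabla>)\<close> is antisymmetric and commutes with \<open>K\<close>. Hence
  \<open>2 \<integral> |\<phi>|\<^sup>2 / r \<le> \<integral> w |D \<phi>|\<^sup>2 + \<integral> (1 + 1 / r) |u|\<^sup>2\<close>, and the claim follows from
  \<open>\<integral> \<rho> |u|\<^sup>2 \<le> \<integral> \<rho> |K u|\<^sup>2\<close> for radial \<open>\<rho>\<close>. This is the spectral gap of the Dirac operator of the
  sphere; it comes from a twistor decomposition of the tangential gradient.

  To have \<open>u\<close> at hand, \<open>\<phi>\<close> is taken to be a radial cutoff times a polynomial: \<open>K\<close> maps homogeneous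
  polynomials onto homogeneous polynomials, because \<open>D p = K q\<close> gives
  \<open>(d + 1) p = K (p - (\<sigma>\<cdot>x) q)\<close> for \<open>p\<close> of degree \<open>d\<close>. The singular multiplier \<open>1 / r\<close> is replaced
  by \<open>s = (r\<^sup>2 + \<epsilon>\<^sup>2)\<^sup>-\<^sup>1\<^sup>/\<^sup>2\<close>, which makes all weights bounded. Convolving a cutoff of \<open>\<phi>\<close> with Landau
  kernels approximates it by polynomials together with its weak derivatives, and \<open>\<epsilon> \<rightarrow> 0\<close> is Fatou's
  lemma.
\<close>

text \<open>Why the square is completed with \<open>u\<close>, where \<open>\<phi> = K u\<close>,
  and not with \<open>\<phi>\<close> itself: \<open>K\<close> is symmetric but indefinite, its
  spectrum being the nonzero integers. With \<open>\<phi>\<close> in place of \<open>u\<close> the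
  cross term would contain \<open>K \<phi>\<close> paired with \<open>\<phi>\<close>, whose sign
  depends on the part of the spectrum. With \<open>u\<close> it contains \<open>K \<phi>\<close>
  paired with \<open>u\<close>, which integrates to the weighted norm of \<open>K u = \<phi>\<close>
  on every eigenspace. The price is the norm of \<open>u\<close>, and the gap
  \<open>|K| >= 1\<close> pays it exactly: after subtracting the integral of
  \<open>(1 + 1/r) |\<phi>|^2\<close> the claim is left with constant 1. Two errors come with the
  approximation. Replacing \<open>1/r\<close> by \<open>s\<close> leaves a cross term with weight
  \<open>\<epsilon>^2 s^3\<close>; it is not dropped but split by Young's inequality, one half going
  into the weight of \<open>u\<close> before the gap is applied. The cutoff enters squared, once to
  localise \<open>\<phi>\<close> and once to localise the polynomial, and its limit is a constant
  below 1, which cancels because the inequality is quadratic. The limits are taken in the order: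
  degree of the kernel, radius of the cutoff, \<open>\<epsilon>\<close>.\<close>

section \<open>Classical partial derivatives of vector-valued maps\<close>

definition pd :: "'n::finite \<Rightarrow> (real^'n \<Rightarrow> 'b::real_normed_vector) \<Rightarrow> real^'n \<Rightarrow> 'b" where
  "pd k f x = frechet_derivative f (at x) (axis k 1)"

lemma pd_eqI: "(f has_derivative f') (at x) \<Longrightarrow> pd k f x = f' (axis k 1)"
  by (simp add: pd_def frechet_derivative_at[symmetric])

lemma partial_deriv_eq_pd: "partial_deriv k f = pd k f"
  by (simp add: fun_eq_iff partial_deriv_def pd_def)

lemma pd_const [simp]: "pd k (\<lambda>x. c) x = 0"
  by (rule pd_eqI[where f'="\<lambda>_. 0"]) auto

lemma pd_const_fun: "pd k (\<lambda>x. c) = (\<lambda>x. 0)"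
  by (simp add: fun_eq_iff)

lemma pd_nth: "pd k (\<lambda>x. x $ j) x = (if j = k then 1 else 0)"
  by (subst pd_eqI[OF bounded_linear_imp_has_derivative[OF bounded_linear_vec_nth]]) (auto simp: axis_def)

lemma differentiable_has_frechet:
  "f differentiable (at x) \<Longrightarrow> (f has_derivative frechet_derivative f (at x)) (at x)"
  by (simp add: frechet_derivative_works)

lemma pd_add:
  assumes "f differentiable (at x)" "g differentiable (at x)"
  shows "pd k (\<lambda>x. f x + g x) x = pd k f x + pd k g x"
  by (subst pd_eqI[OF has_derivative_add[OF assms[THEN differentiable_has_frechet]]])
     (simp add: pd_def)

lemma pd_bounded_linear:
  assumes "bounded_linear L" "f differentiable (at x)"
  shows "pd k (\<lambda>x. L (f x)) x = L (pd k f x)"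
  by (subst pd_eqI[OF bounded_linear.has_derivative[OF assms(1) differentiable_has_frechet[OF assms(2)]]])
     (simp add: pd_def)

lemma pd_bounded_bilinear:
  assumes "bounded_bilinear B" "f differentiable (at x)" "g differentiable (at x)"
  shows "pd k (\<lambda>x. B (f x) (g x)) x = B (f x) (pd k g x) + B (pd k f x) (g x)"
  by (subst pd_eqI[OF bounded_bilinear.FDERIV[OF assms(1) assms(2,3)[THEN differentiable_has_frechet]]])
     (simp add: pd_def)

lemmas pd_scaleR = pd_bounded_bilinear[OF bounded_bilinear_scaleR]
lemmas pd_inner = pd_bounded_bilinear[OF bounded_bilinear_inner]
lemmas pd_mult = pd_bounded_bilinear[OF bounded_bilinear_mult]

lemma pd_sum:
  assumes "finite I" "\<And>i. i \<in> I \<Longrightarrow> f i differentiable (at x)"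
  shows "pd k (\<lambda>x. \<Sum>i\<in>I. f i x) x = (\<Sum>i\<in>I. pd k (f i) x)"
  using assms
  by (induction I rule: finite_induct) (simp_all add: pd_add)

subsection \<open>Polynomial maps\<close>

text \<open>Generated by rules instead of coefficients: facts about polynomials become rule
  inductions, and the coefficients may lie in any normed space. Zero is homogeneous of every degree
  (\<open>hpoly_zero\<close>).\<close>

inductive hpoly :: "nat \<Rightarrow> (real^'n::finite \<Rightarrow> 'b::real_normed_vector) \<Rightarrow> bool" where
  hpoly_const: "hpoly 0 (\<lambda>x. v)"
| hpoly_times: "hpoly d f \<Longrightarrow> hpoly (Suc d) (\<lambda>x. x $ j *\<^sub>R f x)"
| hpoly_add: "hpoly d f \<Longrightarrow> hpoly d g \<Longrightarrow> hpoly d (\<lambda>x. f x + g x)"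

lemma hpoly_zero: "hpoly d (\<lambda>x. 0)"
proof (induction d)
  case 0 show ?case by (rule hpoly_const)
next
  case (Suc d) from hpoly_times[OF Suc] show ?case by simp
qed

lemma hpoly_bounded_linear:
  assumes "bounded_linear L" "hpoly d f"
  shows "hpoly d (\<lambda>x. L (f x))"
  using assms(2)
proof (induction rule: hpoly.induct)
  case (hpoly_add d f g)
  from hpoly.hpoly_add[OF hpoly_add.IH] show ?case
    by (simp add: bounded_linear.linear[OF assms(1)] linear_add)
qed (auto simp: bounded_linear.linear[OF assms(1)] linear_cmul intro: hpoly.intros)

lemma hpoly_sum: "(\<And>i. i \<in> I \<Longrightarrow> hpoly d (f i)) \<Longrightarrow> hpoly d (\<lambda>x. \<Sum>i\<in>I. f i x)"
  by (induction I rule: infinite_finite_induct) (auto intro: hpoly_zero hpoly_add)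

lemma hpoly_differentiable: "hpoly d f \<Longrightarrow> f differentiable (at x)"
proof (induction rule: hpoly.induct)
  case (hpoly_times d f j)
  have "(\<lambda>x::real^'a. x $ j) differentiable (at x)"
    by (rule differentiableI[OF bounded_linear_imp_has_derivative[OF bounded_linear_vec_nth]])
  with hpoly_times show ?case by (intro differentiable_scaleR)
qed auto

lemma pd_nth_scaleR:
  assumes "f differentiable (at x)"
  shows "pd k (\<lambda>x. x $ j *\<^sub>R f x) x = x $ j *\<^sub>R pd k f x + (if j = k then f x else 0)"
proof -
  have "(\<lambda>x::real^'a. x $ j) differentiable (at x)"
    by (rule differentiableI[OF bounded_linear_imp_has_derivative[OF bounded_linear_vec_nth]])
  from pd_scaleR[OF this assms] show ?thesis by (simp add: pd_nth)
qed

text \<open>The separate premise \<open>d = 0\<close> keeps the degree a variable, as the rule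
  induction requires.\<close>

lemma hpoly_0_pd: "hpoly d f \<Longrightarrow> d = 0 \<Longrightarrow> pd k f x = 0"
  by (induction rule: hpoly.induct) (auto simp: pd_add hpoly_differentiable)

lemma hpoly_pd: "hpoly d f \<Longrightarrow> hpoly (d - 1) (pd k f)"
proof (induction rule: hpoly.induct)
  case (hpoly_const v)
  show ?case by (simp add: pd_const_fun hpoly_zero)
next
  case (hpoly_times d f j)
  have "pd k (\<lambda>x. x $ j *\<^sub>R f x) = (\<lambda>x. x $ j *\<^sub>R pd k f x + (if j = k then f x else 0))"
    using hpoly_times.hyps by (auto simp: pd_nth_scaleR hpoly_differentiable)
  moreover have "hpoly d (\<lambda>x. x $ j *\<^sub>R pd k f x)"
  \<comment> \<open>For \<open>d = 0\<close> the degree \<open>d - 1\<close> is truncated to 0, and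
    multiplying by a coordinate would give degree 1. The term is saved by being zero.\<close>
  proof (cases d)
    case 0
    with hpoly_times.hyps have "\<And>x. pd k f x = 0" 
by (simp add: hpoly_0_pd)
    then show ?thesis by (simp add: hpoly_zero)
  next
    case (Suc e)
    then show ?thesis using hpoly.hpoly_times[OF hpoly_times.IH] by simp
  qed
  moreover have "hpoly d (\<lambda>x. if j = k then f x else 0)"
    using hpoly_times.hyps by (cases "j = k") (auto intro: hpoly_zero)
  ultimately show ?case by (auto intro: hpoly_add)
next
  case (hpoly_add d f g)
  have "pd k (\<lambda>x. f x + g x) = (\<lambda>x. pd k f x + pd k g x)"
    using hpoly_add.hyps by (auto simp: pd_add hpoly_differentiable)
  with hpoly_add show ?case by (simp add: hpoly.hpoly_add)
qed

lemma pd_commute: "hpoly d f \<Longrightarrow> pd j (pd k f) = pd k (pd j f)"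
proof (induction rule: hpoly.induct)
  case (hpoly_const v)
  show ?case by (simp add: pd_const_fun)
next
  case (hpoly_times d f i)
  have diff: "f differentiable (at x)" "pd k f differentiable (at x)" for k x
    using hpoly_times.hyps hpoly_differentiable hpoly_pd by blast+
  have eq: "pd k (\<lambda>x. x $ i *\<^sub>R f x) = (\<lambda>x. x $ i *\<^sub>R pd k f x + (if i = k then f x else 0))" for i k
    by (auto simp: pd_nth_scaleR diff)
  have "(\<lambda>x. x $ i *\<^sub>R pd k f x) differentiable (at x)" for i k x
    by (intro differentiable_scaleR diff
      differentiableI[OF bounded_linear_imp_has_derivative[OF bounded_linear_vec_nth]])
  then have "pd j (pd k (\<lambda>x. x $ i *\<^sub>R f x)) x = x $ i *\<^sub>R pd j (pd k f) x
      + (if i = j then pd k f x else 0) + (if i = k then pd j f x else 0)" for j k x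
    by (cases "i = k") (auto simp: eq pd_add pd_nth_scaleR diff)
  then show ?case by (auto simp: hpoly_times.IH)
next
  case (hpoly_add d f g)
  have "pd k (\<lambda>x. f x + g x) = (\<lambda>x. pd k f x + pd k g x)" for k
    using hpoly_add.hyps by (auto simp: pd_add hpoly_differentiable)
  moreover have "pd j (\<lambda>x. pd k f x + pd k g x) x = pd j (pd k f) x + pd j (pd k g) x" for j k x
    using hpoly_add.hyps by (intro pd_add) (blast intro: hpoly_differentiable hpoly_pd)+
  ultimately show ?case using hpoly_add.IH by auto
qed

text \<open>Euler's identity. It turns \<open>1 + x.grad\<close> into the factor
  \<open>1 + d\<close>, by which \<open>spin_orbit_surj_hpoly\<close> divides.\<close>

lemma hpoly_euler: "hpoly d f \<Longrightarrow> (\<Sum>k\<in>UNIV. x $ k *\<^sub>R pd k f x) = real d *\<^sub>R f x"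
proof (induction rule: hpoly.induct)
  case (hpoly_times d f j)
  then have "(\<Sum>k\<in>UNIV. x $ k *\<^sub>R pd k (\<lambda>x. x $ j *\<^sub>R f x) x)
      = x $ j *\<^sub>R (\<Sum>k\<in>UNIV. x $ k *\<^sub>R pd k f x) + (\<Sum>k\<in>UNIV. if j = k then x $ k *\<^sub>R f x else 0)"
    unfolding scaleR_sum_right sum.distrib[symmetric]
    by (intro sum.cong refl) (simp add: pd_nth_scaleR hpoly_differentiable algebra_simps)
  with hpoly_times.IH show ?case by (simp add: algebra_simps)
next
  case (hpoly_add d f g)
  then show ?case
    by (simp add: pd_add hpoly_differentiable algebra_simps sum.distrib)
qed simp

text \<open>Built as sums of homogeneous pieces, because the preimage under
  \<open>spin_orbit\<close> is found degree by degree.\<close>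

inductive vpoly :: "(real^'n::finite \<Rightarrow> 'b::real_normed_vector) \<Rightarrow> bool" where
  vpoly_hpoly: "hpoly d f \<Longrightarrow> vpoly f"
| vpoly_add: "vpoly f \<Longrightarrow> vpoly g \<Longrightarrow> vpoly (\<lambda>x. f x + g x)"

lemma vpoly_const: "vpoly (\<lambda>x. c)"
  by (rule vpoly_hpoly[OF hpoly_const])

lemma vpoly_times: "vpoly f \<Longrightarrow> vpoly (\<lambda>x. x $ j *\<^sub>R f x)"
proof (induction rule: vpoly.induct)
  case (vpoly_add f g)
  from vpoly.vpoly_add[OF vpoly_add.IH] show ?case by (simp add: algebra_simps)
qed (rule vpoly_hpoly, rule hpoly_times)

lemma vpoly_bounded_linear:
  assumes "bounded_linear L" "vpoly f"
  shows "vpoly (\<lambda>x. L (f x))"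
  using assms(2)
proof (induction rule: vpoly.induct)
  case (vpoly_add f g)
  from vpoly.vpoly_add[OF vpoly_add.IH] show ?case
    by (simp add: bounded_linear.linear[OF assms(1)] linear_add)
qed (rule vpoly_hpoly, rule hpoly_bounded_linear[OF assms(1)])

lemma vpoly_sum: "(\<And>i. i \<in> I \<Longrightarrow> vpoly (f i)) \<Longrightarrow> vpoly (\<lambda>x. \<Sum>i\<in>I. f i x)"
  by (induction I rule: infinite_finite_induct) (auto intro: vpoly_const vpoly_add)

lemma vpoly_scaleR:
  assumes "vpoly a" "vpoly f"
  shows "vpoly (\<lambda>x. a x *\<^sub>R f x)"
  using assms(1)
proof (induction rule: vpoly.induct)
  case (vpoly_hpoly d a)
  then show ?case
  proof (induction rule: hpoly.induct)
    case (hpoly_const v)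
    show ?case by (rule vpoly_bounded_linear[OF bounded_linear_scaleR_right assms(2)])
  next
    case (hpoly_times d a j)
    from vpoly_times[OF hpoly_times.IH, of j] show ?case by simp
  next
    case (hpoly_add d a b)
    from vpoly_add[OF hpoly_add.IH] show ?case by (simp add: algebra_simps)
  qed
next
  case (vpoly_add a b)
  from vpoly.vpoly_add[OF vpoly_add.IH] show ?case by (simp add: algebra_simps)
qed

lemma vpoly_differentiable: "vpoly f \<Longrightarrow> f differentiable (at x)"
  by (induction rule: vpoly.induct) (auto intro: hpoly_differentiable)

lemma vpoly_continuous: "vpoly f \<Longrightarrow> continuous_on UNIV f"
  by (simp add: continuous_at_imp_continuous_on differentiable_imp_continuous_within vpoly_differentiable)

lemma vpoly_pd: "vpoly f \<Longrightarrow> vpoly (pd k f)"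
proof (induction rule: vpoly.induct)
  case (vpoly_add f g)
  have "pd k (\<lambda>x. f x + g x) = (\<lambda>x. pd k f x + pd k g x)"
    using vpoly_add.hyps by (auto simp: pd_add vpoly_differentiable)
  with vpoly_add.IH show ?case by (simp add: vpoly.vpoly_add)
qed (rule vpoly_hpoly, rule hpoly_pd)

lemma vpoly_pd_commute: "vpoly f \<Longrightarrow> pd j (pd k f) = pd k (pd j f)"
proof (induction rule: vpoly.induct)
  case (vpoly_add f g)
  have "pd k (\<lambda>x. f x + g x) = (\<lambda>x. pd k f x + pd k g x)" for k
    using vpoly_add.hyps by (auto simp: pd_add vpoly_differentiable)
  moreover have "pd j (\<lambda>x. pd k f x + pd k g x) x = pd j (pd k f) x + pd j (pd k g) x" for j k x
    using vpoly_add.hyps by (intro pd_add) (blast intro: vpoly_differentiable vpoly_pd)+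
  ultimately show ?case using vpoly_add.IH by auto
qed (rule pd_commute)

subsection \<open>Pauli matrices and the spin-orbit operator\<close>

abbreviation sg :: "3 \<Rightarrow> complex^2 \<Rightarrow> complex^2" where
  "sg k u \<equiv> pauli k *v u"

lemma sg_components:
  "sg 1 u $ 1 = u $ 2" "sg 1 u $ 2 = u $ 1"
  "sg 2 u $ 1 = - \<i> * u $ 2" "sg 2 u $ 2 = \<i> * u $ 1"
  "sg 3 u $ 1 = u $ 1" "sg 3 u $ 2 = - u $ 2"
  by (simp_all add: pauli_def matrix_vector_mult_def sum_2)


lemma linear_sg: "linear (sg k)"
  by (rule linearI) (simp_all add: matrix_vector_mult_add_rdistrib matrix_vector_mult_def 
     vec_eq_iff sum.distrib scaleR_sum_right algebra_simps)

lemma bounded_linear_sg: "bounded_linear (sg k)"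
  using linear_sg linear_conv_bounded_linear by blast

lemmas sg_simps = linear_add[OF linear_sg] linear_diff[OF linear_sg] linear_neg[OF linear_sg]
  linear_0[OF linear_sg] linear_cmul[OF linear_sg] linear_sum[OF linear_sg]

lemma sg_sg [simp]: "sg k (sg k u) = u"
  using exhaust_3[of k]
  by (auto simp: vec_eq_iff forall_2 sg_components)

lemma sg_swap:
  "sg 2 (sg 1 u) = - sg 1 (sg 2 u)" "sg 3 (sg 1 u) = - sg 1 (sg 3 u)" "sg 3 (sg 2 u) = - sg 2 (sg 3 u)"
  by (simp_all add: vec_eq_iff forall_2 sg_components)

lemma sg_inner: "sg k u \<bullet> v = u \<bullet> sg k v"
  using exhaust_3[of k]
  by (auto simp: inner_vec_def sum_2 sg_components inner_complex_def)

text \<open>\<open>complex^2\<close> is also a ring under the componentwise product, so collecting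
  equal summands can produce products with numerals. These rules turn them back into scalar
  multiples.\<close>

lemma numeral_mult_vec:
  fixes v :: "complex^2"
  shows "numeral n * v = numeral n *\<^sub>R v" "v * numeral n = numeral n *\<^sub>R v"
    "v + 2 *\<^sub>R v = 3 *\<^sub>R v"
  by (simp_all add: vec_eq_iff scaleR_conv_of_real)

text \<open>Clifford multiplication by the vector \<open>x\<close>, usually written sigma.x;
  \<open>slash_slash\<close> is the Clifford relation.\<close>

definition slash :: "real^3 \<Rightarrow> complex^2 \<Rightarrow> complex^2" where
  "slash x u = (\<Sum>k\<in>UNIV. x $ k *\<^sub>R sg k u)"

lemma linear_slash: "linear (slash x)"
  unfolding slash_def by (rule linearI) (simp_all add: sg_simps sum.distrib scaleR_sum_right algebra_simps)

lemma slash_inner: "slash x u \<bullet> v = u \<bullet> slash x v"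
  by (simp add: slash_def inner_sum_left inner_sum_right sg_inner)

lemmas slash_simps = linear_add[OF linear_slash] linear_diff[OF linear_slash] linear_neg[OF linear_slash]
  linear_0[OF linear_slash] linear_cmul[OF linear_slash] linear_sum[OF linear_slash]

lemma norm_sq_3: "(norm (x::real^3))\<^sup>2 = (x $ 1)\<^sup>2 + (x $ 2)\<^sup>2 + (x $ 3)\<^sup>2"
  by (simp add: norm_vec_def L2_set_def sum_3)

lemma slash_slash: "slash x (slash x u) = (norm x)\<^sup>2 *\<^sub>R u"
  unfolding norm_sq_3
  by (simp add: slash_def sum_3 sg_simps sg_swap algebra_simps power2_eq_square)

lemma norm_slash: "norm (slash x u) = norm x * norm u"
proof -
  have "(norm (slash x u))\<^sup>2 = (norm x * norm u)\<^sup>2"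
    by (simp add: power2_norm_eq_inner slash_inner slash_slash power_mult_distrib)
  then show ?thesis by (simp add: power2_eq_iff_nonneg)
qed

text \<open>The sum over \<open>k\<close> of \<open>|r\<^sup>2 v\<^sub>k - x\<^sub>k e + (\<sigma>\<^sub>k (\<sigma>\<cdot>x) m - x\<^sub>k m) / 2|\<^sup>2\<close>, the squared twistor part of
  the tangential gradient, is \<open>r\<^sup>2 / 2\<close> times the difference of the two sides.\<close>

lemma twistor_ineq:
  fixes v :: "3 \<Rightarrow> complex^2" and x :: "real^3"
  defines "e \<equiv> \<Sum>k\<in>UNIV. x $ k *\<^sub>R v k"
  defines "m \<equiv> e - slash x (\<Sum>k\<in>UNIV. sg k (v k))"
  shows "(norm m)\<^sup>2 \<le> 2 * ((norm x)\<^sup>2 * (\<Sum>k\<in>UNIV. (norm (v k))\<^sup>2) - (norm e)\<^sup>2)"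
proof (cases "x = 0")
  case True
  then show ?thesis by (simp add: m_def e_def slash_def)
next
  case False
  \<comment> \<open>\<open>t\<close> is \<open>|x|^2\<close> times the part of \<open>v\<close>
    tangential to the sphere through \<open>x\<close>: \<open>xt\<close> below says that its radial
    component vanishes.\<close>
  define t where "t k = (norm x)\<^sup>2 *\<^sub>R v k - x $ k *\<^sub>R e" for k
  define z where "z k = sg k (slash x m) - x $ k *\<^sub>R m" for k
  have rr: "(\<Sum>k\<in>UNIV. x $ k * x $ k) = (norm x)\<^sup>2"
    by (simp add: power2_norm_eq_inner inner_vec_def)
  have tt: "(\<Sum>k\<in>UNIV. t k \<bullet> t k) = (norm x)\<^sup>2 * ((norm x)\<^sup>2 * (\<Sum>k\<in>UNIV. (norm (v k))\<^sup>2) - (norm e)\<^sup>2)"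
  proof -
    have "(\<Sum>k\<in>UNIV. t k \<bullet> t k) = (norm x)\<^sup>2 * (norm x)\<^sup>2 * (\<Sum>k\<in>UNIV. v k \<bullet> v k)
       - 2 * (norm x)\<^sup>2 * ((\<Sum>k\<in>UNIV. x $ k *\<^sub>R v k) \<bullet> e) + (\<Sum>k\<in>UNIV. x $ k * x $ k) * (e \<bullet> e)"
      by (simp add: t_def sum_3 algebra_simps inner_simps inner_commute)
    then show ?thesis
      by (simp add: rr e_def[symmetric] power2_norm_eq_inner algebra_simps)
  qed
  have xt: "(\<Sum>k\<in>UNIV. x $ k *\<^sub>R t k) = 0"
  proof -
    have "(\<Sum>k\<in>UNIV. x $ k *\<^sub>R t k) = (norm x)\<^sup>2 *\<^sub>R (\<Sum>k\<in>UNIV. x $ k *\<^sub>R v k) - (\<Sum>k\<in>UNIV. x $ k * x $ k) *\<^sub>R e"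
      by (simp add: t_def sum_3 algebra_simps)
    then show ?thesis by (simp add: rr e_def[symmetric])
  qed
  have st: "(\<Sum>k\<in>UNIV. sg k (t k)) = - slash x m"
  proof -
    have "(\<Sum>k\<in>UNIV. sg k (t k)) = (norm x)\<^sup>2 *\<^sub>R (\<Sum>k\<in>UNIV. sg k (v k)) - slash x e"
      by (simp add: t_def slash_def sg_simps sum_3 algebra_simps)
    then show ?thesis
      by (simp add: m_def slash_simps(1-5) slash_slash)
  qed
  have tz: "(\<Sum>k\<in>UNIV. t k \<bullet> z k) = - (norm x)\<^sup>2 * (norm m)\<^sup>2"
  proof -
    have "(\<Sum>k\<in>UNIV. t k \<bullet> z k) = (\<Sum>k\<in>UNIV. sg k (t k)) \<bullet> slash x m - (\<Sum>k\<in>UNIV. x $ k *\<^sub>R t k) \<bullet> m"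
      by (simp add: z_def sum_3 inner_simps sg_inner algebra_simps)
    also have "\<dots> = - (norm x)\<^sup>2 * (norm m)\<^sup>2"
      by (simp add: st xt slash_inner slash_slash power2_norm_eq_inner)
    finally show ?thesis .
  qed
  have sm: "sg k (slash x m) \<bullet> m = slash x m \<bullet> sg k m" "m \<bullet> sg k (slash x m) = slash x m \<bullet> sg k m"
    "sg k (slash x m) \<bullet> sg k (slash x m) = slash x m \<bullet> slash x m" for k
    by (simp_all add: sg_inner) (metis sg_inner inner_commute)
  have zz: "(\<Sum>k\<in>UNIV. z k \<bullet> z k) = 2 * (norm x)\<^sup>2 * (norm m)\<^sup>2"
  proof -
    have "(\<Sum>k\<in>UNIV. z k \<bullet> z k) = (\<Sum>k\<in>(UNIV::3 set). slash x m \<bullet> slash x m)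
       - 2 * (slash x m \<bullet> (\<Sum>k\<in>UNIV. x $ k *\<^sub>R sg k m)) + (\<Sum>k\<in>UNIV. x $ k * x $ k) * (m \<bullet> m)"
      by (simp add: z_def sum_3 inner_simps sm algebra_simps)
    also have "\<dots> = 2 * (norm x)\<^sup>2 * (norm m)\<^sup>2"
      by (simp add: rr slash_def[symmetric] slash_inner slash_slash power2_norm_eq_inner)
    finally show ?thesis .
  qed
  \<comment> \<open>The factor 1/2 is one over the dimension of the sphere: it makes the Clifford
    trace, the sum of \<open>sg k (t k + z k / 2)\<close>, vanish. It is also optimal, since
    \<open>tz\<close> and \<open>zz\<close> contribute the multiple \<open>-2 c + 2 c^2\<close> for
    a factor \<open>c\<close>.\<close>
  have "0 \<le> (\<Sum>k\<in>UNIV. (t k + (1/2) *\<^sub>R z k) \<bullet> (t k + (1/2) *\<^sub>R z k))"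
    by (simp add: sum_nonneg)
  also have "\<dots> = (\<Sum>k\<in>UNIV. t k \<bullet> t k) + (\<Sum>k\<in>UNIV. t k \<bullet> z k) + (\<Sum>k\<in>UNIV. z k \<bullet> z k) / 4"
    by (simp add: sum_3 inner_simps inner_commute algebra_simps)
  also have "\<dots> = (norm x)\<^sup>2 * ((norm x)\<^sup>2 * (\<Sum>k\<in>UNIV. (norm (v k))\<^sup>2) - (norm e)\<^sup>2 - (norm m)\<^sup>2 / 2)"
    by (simp add: tt tz zz algebra_simps)
  finally have "0 \<le> (norm x)\<^sup>2 * (\<Sum>k\<in>UNIV. (norm (v k))\<^sup>2) - (norm e)\<^sup>2 - (norm m)\<^sup>2 / 2"
    using False by (simp add: zero_le_mult_iff)
  then show ?thesis by simp
qed

section \<open>Commutation rules of the Dirac, Euler and spin-orbit operators\<close>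

definition dirac :: "(real^3 \<Rightarrow> complex^2) \<Rightarrow> real^3 \<Rightarrow> complex^2" where
  "dirac f x = (\<Sum>k\<in>UNIV. sg k (pd k f x))"

definition euler :: "(real^3 \<Rightarrow> 'b::real_normed_vector) \<Rightarrow> real^3 \<Rightarrow> 'b" where
  "euler f x = (\<Sum>k\<in>UNIV. x $ k *\<^sub>R pd k f x)"

definition slashf :: "(real^3 \<Rightarrow> complex^2) \<Rightarrow> real^3 \<Rightarrow> complex^2" where
  "slashf f x = slash x (f x)"

text \<open>\<open>spin_orbit\<close> is \<open>1 + \<sigma>\<cdot>L\<close>, where \<open>L = - i x \<times> \<nabla>\<close>.\<close>
definition spin_orbit :: "(real^3 \<Rightarrow> complex^2) \<Rightarrow> real^3 \<Rightarrow> complex^2" where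
  "spin_orbit f x = f x + euler f x - slash x (dirac f x)"

lemma slashf_sum: "slashf f = (\<lambda>x. \<Sum>k\<in>UNIV. x $ k *\<^sub>R sg k (f x))"
  by (simp add: fun_eq_iff slashf_def slash_def)

lemma euler_sum: "euler f = (\<lambda>x. \<Sum>k\<in>UNIV. x $ k *\<^sub>R pd k f x)"
  by (simp add: fun_eq_iff euler_def)

lemma dirac_sum: "dirac f = (\<lambda>x. \<Sum>k\<in>UNIV. sg k (pd k f x))"
  by (simp add: fun_eq_iff dirac_def)

lemma hpoly_dirac: "hpoly d f \<Longrightarrow> hpoly (d - 1) (dirac f)"
  unfolding dirac_sum by (intro hpoly_sum hpoly_bounded_linear[OF bounded_linear_sg] hpoly_pd)

lemma vpoly_dirac: "vpoly f \<Longrightarrow> vpoly (dirac f)"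
  unfolding dirac_sum by (intro vpoly_sum vpoly_bounded_linear[OF bounded_linear_sg] vpoly_pd)

lemma vpoly_slashf: "vpoly f \<Longrightarrow> vpoly (slashf f)"
  unfolding slashf_sum by (intro vpoly_sum vpoly_times vpoly_bounded_linear[OF bounded_linear_sg])

lemma vpoly_euler: "vpoly f \<Longrightarrow> vpoly (euler f)"
  unfolding euler_sum by (intro vpoly_sum vpoly_times vpoly_pd)

lemma vpoly_minus: "vpoly f \<Longrightarrow> vpoly (\<lambda>x. - f x)"
  by (rule vpoly_bounded_linear[OF bounded_linear_minus[OF bounded_linear_ident]])

lemma vpoly_diff: "vpoly f \<Longrightarrow> vpoly g \<Longrightarrow> vpoly (\<lambda>x. f x - g x)"
  using vpoly_add[OF _ vpoly_minus] by fastforce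

lemma spin_orbit_eq: "spin_orbit f = (\<lambda>x. f x + euler f x - slashf (dirac f) x)"
  by (simp add: fun_eq_iff spin_orbit_def slashf_def)

lemma vpoly_spin_orbit: "vpoly f \<Longrightarrow> vpoly (spin_orbit f)"
  unfolding spin_orbit_eq by (intro vpoly_diff vpoly_add vpoly_euler vpoly_slashf vpoly_dirac)

lemma pd_slashf:
  assumes "vpoly f"
  shows "pd k (slashf f) x = sg k (f x) + slash x (pd k f x)"
proof -
  have v: "vpoly (\<lambda>x. sg j (f x))" for j
    by (intro vpoly_bounded_linear[OF bounded_linear_sg] assms)
  show ?thesis
    unfolding slashf_sum
    by (simp add: pd_sum vpoly_differentiable[OF vpoly_times[OF v]] pd_nth_scaleR vpoly_differentiable[OF v]
       sum.distrib pd_bounded_linear[OF bounded_linear_sg vpoly_differentiable[OF assms]] slash_def)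
qed

lemma pd_euler:
  assumes "vpoly f"
  shows "pd k (euler f) x = pd k f x + euler (pd k f) x"
proof -
  have v: "vpoly (pd j f)" for j by (intro vpoly_pd assms)
  show ?thesis
    unfolding euler_sum
    by (simp add: pd_sum vpoly_differentiable[OF vpoly_times[OF v]] pd_nth_scaleR vpoly_differentiable[OF v]
       sum.distrib vpoly_pd_commute[OF assms, of k])
qed

text \<open>The 3 is the sum of the squares of the Pauli matrices; the anticommutators
  \<open>2 delta_jk\<close> produce twice the Euler field when D is moved past sigma.x.\<close>

lemma dirac_slashf:
  assumes "vpoly f"
  shows "dirac (slashf f) x = 3 *\<^sub>R f x + 2 *\<^sub>R euler f x - slash x (dirac f x)"
  by (simp add: dirac_def pd_slashf[OF assms] sg_simps slash_def euler_def sum_3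
    sg_swap algebra_simps numeral_mult_vec)

lemma euler_slashf:
  assumes "vpoly f"
  shows "euler (slashf f) x = slash x (f x) + slash x (euler f x)"
  by (simp add: euler_def pd_slashf[OF assms] slash_simps sum.distrib algebra_simps)
     (simp add: slash_def)

text \<open>D lowers the degree of homogeneity by one, so its commutator with \<open>x.grad\<close>
  is -D.\<close>

lemma euler_dirac:
  assumes "vpoly f"
  shows "euler (dirac f) x = dirac (euler f) x - dirac f x"
proof -
  have "pd j (dirac f) x = (\<Sum>k\<in>UNIV. sg k (pd j (pd k f) x))" for j
    unfolding dirac_sum
    using vpoly_differentiable[OF vpoly_bounded_linear[OF bounded_linear_sg vpoly_pd[OF assms]]]
    by (simp add: pd_sum pd_bounded_linear[OF bounded_linear_sg vpoly_differentiable[OF vpoly_pd[OF assms]]])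
  then show ?thesis
    by (simp add: dirac_def pd_euler[OF assms]) 
       (simp add: euler_def sg_simps sum_3 vpoly_pd_commute[OF assms] algebra_simps)
qed

text \<open>Distinct Pauli matrices anticommute while partial derivatives commute, so the mixed
  terms cancel and the Laplacian remains.\<close>

lemma dirac_dirac:
  assumes "vpoly f"
  shows "dirac (dirac f) x = (\<Sum>k\<in>UNIV. pd k (pd k f) x)"
proof -
  have "pd j (dirac f) x = (\<Sum>k\<in>UNIV. sg k (pd j (pd k f) x))" for j
    unfolding dirac_sum
    using vpoly_differentiable[OF vpoly_bounded_linear[OF bounded_linear_sg vpoly_pd[OF assms]]]
    by (simp add: pd_sum pd_bounded_linear[OF bounded_linear_sg vpoly_differentiable[OF vpoly_pd[OF assms]]])
  then show ?thesis
    using vpoly_pd_commute[OF assms, of 2 1] vpoly_pd_commute[OF assms, of 3 1] vpoly_pd_commute[OF assms, of 3 2]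
    by (simp add: dirac_def[of "dirac f"]) 
       (simp add: sg_simps sum_3 sg_swap algebra_simps)
qed

lemma euler_add: "vpoly f \<Longrightarrow> vpoly g \<Longrightarrow> euler (\<lambda>x. f x + g x) x = euler f x + euler g x"
  by (simp add: euler_def pd_add vpoly_differentiable algebra_simps sum.distrib)

lemma dirac_add: "vpoly f \<Longrightarrow> vpoly g \<Longrightarrow> dirac (\<lambda>x. f x + g x) x = dirac f x + dirac g x"
  by (simp add: dirac_def pd_add vpoly_differentiable sg_simps sum.distrib)

lemma euler_cmul: "vpoly f \<Longrightarrow> euler (\<lambda>x. c *\<^sub>R f x) x = c *\<^sub>R euler f x"
  by (simp add: euler_def pd_bounded_linear[OF bounded_linear_scaleR_right] vpoly_differentiable scaleR_sum_right mult.commute)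

lemma dirac_cmul: "vpoly f \<Longrightarrow> dirac (\<lambda>x. c *\<^sub>R f x) x = c *\<^sub>R dirac f x"
  by (simp add: dirac_def pd_bounded_linear[OF bounded_linear_scaleR_right] vpoly_differentiable scaleR_sum_right sg_simps)

lemma vpoly_cmul: "vpoly f \<Longrightarrow> vpoly (\<lambda>x. c *\<^sub>R f x)"
  by (rule vpoly_bounded_linear[OF bounded_linear_scaleR_right])

lemma euler_diff: "vpoly f \<Longrightarrow> vpoly g \<Longrightarrow> euler (\<lambda>x. f x - g x) x = euler f x - euler g x"
  using euler_add[of f "\<lambda>x. (-1) *\<^sub>R g x"] euler_cmul[of g "-1"] vpoly_minus[of g] by simp

lemma dirac_diff: "vpoly f \<Longrightarrow> vpoly g \<Longrightarrow> dirac (\<lambda>x. f x - g x) x = dirac f x - dirac g x"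
  using dirac_add[of f "\<lambda>x. (-1) *\<^sub>R g x"] dirac_cmul[of g "-1"] vpoly_minus[of g] by simp

text \<open>sigma.x raises the degree by one and D lowers it by one, hence K preserves the
  degree.\<close>

lemma spin_orbit_euler:
  assumes "vpoly f"
  shows "spin_orbit (euler f) x = euler (spin_orbit f) x"
proof -
  have "euler (spin_orbit f) x = euler f x + euler (euler f) x - euler (slashf (dirac f)) x"
    unfolding spin_orbit_eq using assms
    by (simp add: euler_diff euler_add vpoly_add vpoly_euler vpoly_slashf vpoly_dirac)
  also have "\<dots> = spin_orbit (euler f) x"
    using assms by (simp add: euler_slashf vpoly_dirac euler_dirac spin_orbit_def slash_simps)
  finally show ?thesis ..
qed

lemma spin_orbit_slashf:
  assumes "vpoly f"
  shows "spin_orbit (slashf f) x = - slash x (spin_orbit f x)"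
  using assms
  by (simp add: spin_orbit_def euler_slashf dirac_slashf slash_simps)
     (simp add: slashf_def algebra_simps numeral_mult_vec)

lemma spin_orbit_diff: "vpoly f \<Longrightarrow> vpoly g \<Longrightarrow> spin_orbit (\<lambda>x. f x - g x) x = spin_orbit f x - spin_orbit g x"
  by (simp add: spin_orbit_def euler_diff dirac_diff slash_simps)

lemma spin_orbit_cmul: "vpoly f \<Longrightarrow> spin_orbit (\<lambda>x. c *\<^sub>R f x) x = c *\<^sub>R spin_orbit f x"
  by (simp add: spin_orbit_def euler_cmul dirac_cmul slash_simps algebra_simps)

lemma spin_orbit_add: "vpoly f \<Longrightarrow> vpoly g \<Longrightarrow> spin_orbit (\<lambda>x. f x + g x) x = spin_orbit f x + spin_orbit g x"
  by (simp add: spin_orbit_def euler_add dirac_add slash_simps)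

text \<open>This induction takes the place of a diagonalisation of K by spinor spherical harmonics.
  On constants K is the identity, which starts it.\<close>

lemma spin_orbit_surj_hpoly: "hpoly d p \<Longrightarrow> \<exists>q. vpoly q \<and> spin_orbit q = p"
proof (induction d arbitrary: p)
  case 0
  then have "spin_orbit p = p"
    by (simp add: fun_eq_iff spin_orbit_def euler_def dirac_def hpoly_0_pd sg_simps slash_simps)
  with 0 show ?case using vpoly_hpoly by blast
next
  case (Suc d)
  from Suc.prems have "hpoly d (dirac p)" using hpoly_dirac by fastforce
  from Suc.IH[OF this] obtain q where q: "vpoly q" "spin_orbit q = dirac p" by blast
  have p: "vpoly p" by (rule vpoly_hpoly[OF Suc.prems])
  \<comment> \<open>Anticommutation turns \<open>- K (slashf q)\<close> into sigma.x applied to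
    \<open>dirac p\<close>, which cancels the last term of \<open>K p\<close> and leaves
    \<open>p + euler p\<close>.\<close>
  define u where "u x = p x - slashf q x" for x
  have u: "vpoly u" unfolding u_def by (intro vpoly_diff p vpoly_slashf q)
  have "spin_orbit u x = p x + euler p x" for x
    unfolding u_def using p q by (simp add: spin_orbit_diff vpoly_slashf spin_orbit_slashf) (simp add: spin_orbit_def)
  \<comment> \<open>One plus the degree, which here is \<open>Suc d\<close>.\<close>
  then have "spin_orbit u x = (2 + real d) *\<^sub>R p x" for x
    using hpoly_euler[OF Suc.prems] by (simp add: euler_def algebra_simps numeral_mult_vec)
  then have "spin_orbit (\<lambda>x. (1 / (2 + real d)) *\<^sub>R u x) = p"
    by (simp add: fun_eq_iff spin_orbit_cmul[OF u])
  then show ?case using vpoly_cmul[OF u] by blast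
qed

lemma spin_orbit_surj: "vpoly p \<Longrightarrow> \<exists>q. vpoly q \<and> spin_orbit q = p"
proof (induction rule: vpoly.induct)
  case (vpoly_add f g)
  then obtain a b where ab: "vpoly a" "spin_orbit a = f" "vpoly b" "spin_orbit b = g" by blast
  then have "spin_orbit (\<lambda>x. a x + b x) = (\<lambda>x. f x + g x)"
    by (auto simp: spin_orbit_add)
  with ab show ?case using vpoly.vpoly_add by blast
qed (rule spin_orbit_surj_hpoly)

lemma pd_diff:
  assumes "f differentiable (at x)" "g differentiable (at x)"
  shows "pd k (\<lambda>x. f x - g x) x = pd k f x - pd k g x"
  by (subst pd_eqI[OF has_derivative_diff[OF assms[THEN differentiable_has_frechet]]])
     (simp add: pd_def)

lemma vpoly_nth: "vpoly (\<lambda>x. x $ j)"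
  using vpoly_times[OF vpoly_const, of j "1::real"] by simp

subsection \<open>Integration by parts against radial weights\<close>

lemma integrable_continuous_cball:
  fixes g :: "'a::euclidean_space \<Rightarrow> real"
  assumes "continuous_on UNIV g" "\<And>x. norm x > R \<Longrightarrow> g x = 0"
  shows "integrable lborel g"
proof -
  have "integrable lborel (\<lambda>x. indicator (cball 0 R) x *\<^sub>R g x)"
    by (intro borel_integrable_compact compact_cball continuous_on_subset[OF assms(1)]) auto
  moreover have "(\<lambda>x. indicator (cball 0 R) x *\<^sub>R g x) = g"
    using assms(2) by (auto simp: fun_eq_iff indicator_def)
  ultimately show ?thesis by simp
qed

lemma integral_translate:
  fixes f :: "'a::euclidean_space \<Rightarrow> 'b::{banach, second_countable_topology}"
  assumes "f \<in> borel_measurable borel"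
  shows "(LINT x|lborel. f (x + c)) = (LINT x|lborel. f x)"
  using integral_distr[of "(+) c" lborel borel f] assms by (simp add: lborel_distr_plus add.commute)

lemma integrable_translate:
  fixes f :: "'a::euclidean_space \<Rightarrow> 'b::{banach, second_countable_topology}"
  assumes "integrable lborel f"
  shows "integrable lborel (\<lambda>x. f (x + c))"
  using integrable_distr[of "(+) c" lborel borel f] assms by (simp add: lborel_distr_plus add.commute)

lemma has_real_derivative_line:
  fixes F :: "real^'n::finite \<Rightarrow> real"
  assumes "\<And>x. F differentiable (at x)"
  shows "((\<lambda>t. F (x + t *\<^sub>R axis k 1)) has_real_derivative pd k F (x + t *\<^sub>R axis k 1)) (at t)"
proof -
  let ?y = "x + t *\<^sub>R axis k 1 :: real^'n"
  have "((\<lambda>t. x + t *\<^sub>R axis k 1) has_derivative (\<lambda>h. h *\<^sub>R (axis k 1 :: real^'n))) (at t)"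
    by (auto intro!: derivative_eq_intros)
  from has_derivative_compose[OF this, of F "frechet_derivative F (at ?y)"]
  have "((\<lambda>t. F (x + t *\<^sub>R axis k 1)) has_derivative (\<lambda>h. frechet_derivative F (at ?y) (h *\<^sub>R axis k 1))) (at t)"
    using assms differentiable_has_frechet by blast
  moreover have "frechet_derivative F (at ?y) (h *\<^sub>R axis k 1) = pd k F ?y * h" for h
    using linear_cmul[OF linear_frechet_derivative[OF assms]] by (simp add: pd_def)
  ultimately show ?thesis by (simp add: has_field_derivative_def)
qed

text \<open>Each difference quotient of \<open>F\<close> integrates to zero by translation
  invariance of the measure. The mean value theorem bounds the quotients, and dominated convergence
  passes to the derivative.\<close>

lemma integral_pd_zero:
  fixes F :: "real^'n::finite \<Rightarrow> real"
  assumes diff: "\<And>x. F differentiable (at x)" and cont: "continuous_on UNIV (pd k F)"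
    and supp: "\<And>x. norm x \<ge> R \<Longrightarrow> F x = 0" "\<And>x. norm x \<ge> R \<Longrightarrow> pd k F x = 0"
  shows "(LINT x|lborel. pd k F x) = 0"
proof -
  define e where "e = (axis k 1 :: real^'n)"
  have ne: "norm e = 1" by (simp add: e_def)
  \<comment> \<open>Steps of length at most 1 keep the supports of all difference quotients inside
    the ball of radius \<open>R + 1\<close>.\<close>
  define h where "h n = inverse (real (Suc n))" for n
  have h: "0 < h n" "h n \<le> 1" for n by (simp_all add: h_def inverse_le_1_iff)
  have h0: "h \<longlonglongrightarrow> 0" unfolding h_def by (rule LIMSEQ_inverse_real_of_nat)
  obtain C where C: "\<And>x. \<bar>pd k F x\<bar> \<le> C" "0 \<le> C"
  proof -
    have "compact (pd k F ` cball 0 R)"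
      by (intro compact_continuous_image continuous_on_subset[OF cont]) auto
    then obtain b where b: "\<forall>y\<in>pd k F ` cball 0 R. norm y \<le> b"
      using bounded_iff compact_imp_bounded by blast
    have "\<bar>pd k F x\<bar> \<le> max b 0" for x
    proof (cases "norm x < R")
      case True
      then have "norm (pd k F x) \<le> b" using b by auto
      then show ?thesis by simp
    qed (simp add: supp)
    then show ?thesis using that by (meson max.cobounded2)
  qed
  have Fc: "continuous_on UNIV F"
    by (simp add: continuous_at_imp_continuous_on diff differentiable_imp_continuous_within)
  have int: "integrable lborel F"
    by (rule integrable_continuous_cball[OF Fc, of R]) (simp add: supp)
  have int_t: "integrable lborel (\<lambda>x. F (x + h n *\<^sub>R e))" for n
    using int integrable_translate by blast
  have shift: "(LINT x|lborel. F (x + h n *\<^sub>R e)) = (LINT x|lborel. F x)" for n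
    using integral_translate borel_measurable_continuous_onI[OF Fc] by blast
  let ?s = "\<lambda>n x. (F (x + h n *\<^sub>R e) - F x) / h n"
  have "(\<lambda>n. LINT x|lborel. ?s n x) \<longlonglongrightarrow> (LINT x|lborel. pd k F x)"
  proof (rule integral_dominated_convergence[where w="\<lambda>x. indicator (cball 0 (R + 1)) x *\<^sub>R C"])
    show "pd k F \<in> borel_measurable lborel"
      using borel_measurable_continuous_onI[OF cont] by simp
    show "?s n \<in> borel_measurable lborel" for n
      using int int_t by (intro borel_measurable_divide borel_measurable_diff) auto
    show "integrable lborel (\<lambda>x. indicator (cball 0 (R + 1)) x *\<^sub>R C)"
      by (intro borel_integrable_compact) auto
    show "AE x in lborel. (\<lambda>n. ?s n x) \<longlonglongrightarrow> pd k F x"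
    proof (rule AE_I2)
      fix x
      have "((\<lambda>t. (F (x + t *\<^sub>R e) - F x) / t) \<longlongrightarrow> pd k F x) (at 0)"
        using has_real_derivative_line[OF diff, of x k 0] by (simp add: DERIV_def e_def)
      moreover have "filterlim h (at 0) sequentially"
        using h0 h by (auto simp: filterlim_at less_imp_neq[symmetric])
      ultimately show "(\<lambda>n. ?s n x) \<longlonglongrightarrow> pd k F x"
        by (rule filterlim_compose)
    qed
    show "AE x in lborel. norm (?s n x) \<le> indicator (cball 0 (R + 1)) x *\<^sub>R C" for n
    proof (rule AE_I2)
      fix x
      show "norm (?s n x) \<le> indicator (cball 0 (R + 1)) x *\<^sub>R C"
      proof (cases "norm x \<le> R + 1")
        case True
        obtain t where "0 < t" "t < h n"
          "F (x + h n *\<^sub>R e) - F (x + 0 *\<^sub>R e) = (h n - 0) * pd k F (x + t *\<^sub>R e)"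
          using MVT2[OF h(1)[of n], of "\<lambda>t. F (x + t *\<^sub>R e)" "\<lambda>t. pd k F (x + t *\<^sub>R e)"]
            has_real_derivative_line[OF diff, of x k] unfolding e_def by blast
        then have "?s n x = pd k F (x + t *\<^sub>R e)"
          using h(1)[of n] by (simp add: field_simps)
        with C True show ?thesis by simp
      next
        case False
        have "norm x \<le> norm (x + h n *\<^sub>R e) + norm (h n *\<^sub>R e)"
          using norm_triangle_ineq4[of "x + h n *\<^sub>R e" "h n *\<^sub>R e"] by simp
        then have "norm (x + h n *\<^sub>R e) \<ge> R" "norm x \<ge> R" using False h[of n] ne by auto
        then show ?thesis using C by (simp add: supp)
      qed
    qed
  qed
  moreover have "(LINT x|lborel. ?s n x) = 0" for n
    using int int_t[of n] shift[of n] by simp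
  ultimately have "(\<lambda>n. 0) \<longlonglongrightarrow> (LINT x|lborel. pd k F x)"
    by (simp only:)
  then show ?thesis using LIMSEQ_unique tendsto_const by blast
qed

text \<open>A function \<open>\<rho>\<close> of \<open>|x|\<close> alone, with \<open>\<nabla>\<rho>(x) = \<tau>(x) x\<close>.\<close>

definition radial :: "('a::real_inner \<Rightarrow> real) \<Rightarrow> ('a \<Rightarrow> real) \<Rightarrow> bool" where
  "radial \<rho> \<tau> \<longleftrightarrow> (\<forall>x. (\<rho> has_derivative (\<lambda>h. \<tau> x * (x \<bullet> h))) (at x)) \<and> continuous_on UNIV \<tau>"

definition radial_weight :: "real \<Rightarrow> ('a::real_inner \<Rightarrow> real) \<Rightarrow> ('a \<Rightarrow> real) \<Rightarrow> bool" where
  "radial_weight R \<rho> \<tau> \<longleftrightarrow> radial \<rho> \<tau> \<and> (\<forall>x. norm x \<ge> R \<longrightarrow> \<rho> x = 0 \<and> \<tau> x = 0)"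

lemma radial_const: "radial (\<lambda>x. c) (\<lambda>x. 0)"
  by (simp add: radial_def)

lemma radial_continuous: "radial \<rho> \<tau> \<Longrightarrow> continuous_on UNIV \<rho>" "radial \<rho> \<tau> \<Longrightarrow> continuous_on UNIV \<tau>"
  unfolding radial_def by (blast intro: continuous_at_imp_continuous_on has_derivative_continuous)+

lemma radial_add:
  "radial f f' \<Longrightarrow> radial g g' \<Longrightarrow> radial (\<lambda>x. f x + g x) (\<lambda>x. f' x + g' x)"
  unfolding radial_def by (auto intro!: continuous_intros derivative_eq_intros simp: algebra_simps)

lemma radial_mult:
  assumes "radial f f'" "radial g g'"
  shows "radial (\<lambda>x. f x * g x) (\<lambda>x. f' x * g x + f x * g' x)"
proof -
  have "((\<lambda>x. f x * g x) has_derivative (\<lambda>h. (f' x * g x + f x * g' x) * (x \<bullet> h))) (at x)" for x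
  proof -
    have "(f has_derivative (\<lambda>h. f' x * (x \<bullet> h))) (at x)" "(g has_derivative (\<lambda>h. g' x * (x \<bullet> h))) (at x)"
      using assms by (auto simp: radial_def)
    from has_derivative_mult[OF this] show ?thesis by (simp add: algebra_simps)
  qed
  then show ?thesis
    using assms by (auto simp: radial_def intro!: continuous_intros radial_continuous[OF assms(1)]
      radial_continuous[OF assms(2)])
qed

lemma radial_weight_mult:
  "radial f f' \<Longrightarrow> radial_weight R g g' \<Longrightarrow> radial_weight R (\<lambda>x. f x * g x) (\<lambda>x. f' x * g x + f x * g' x)"
  unfolding radial_weight_def using radial_mult[of f f' g g'] by auto

lemma pd_radial: "radial \<rho> \<tau> \<Longrightarrow> pd k \<rho> x = \<tau> x * x $ k"
  unfolding radial_def using pd_eqI[of \<rho> "\<lambda>h. \<tau> x * (x \<bullet> h)" x k] by (auto simp: inner_axis)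

lemma radial_differentiable: "radial \<rho> \<tau> \<Longrightarrow> \<rho> differentiable (at x)"
  by (auto simp: radial_def differentiable_def)

lemma radial_weight_integrable:
  fixes g :: "'a::euclidean_space \<Rightarrow> real"
  assumes "radial_weight R \<rho> \<tau>" "continuous_on UNIV g"
  shows "integrable lborel (\<lambda>x. \<rho> x * g x)" "integrable lborel (\<lambda>x. \<tau> x * g x)"
  using assms
  by (auto simp: radial_weight_def intro!: integrable_continuous_cball[where R=R] continuous_intros
     dest: radial_continuous)

text \<open>The divergence theorem for the field \<open>\<rho> f\<close>, whose divergence is
  \<open>\<rho> div f + \<tau> (x . f)\<close>. If \<open>f\<close> is tangential to spheres, the
  second term vanishes and the weight behaves like a constant. Callers supply simplified forms
  \<open>d\<close> and \<open>e\<close> of the divergence and of \<open>x . f\<close>.\<close>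

lemma radial_weight_div:
  fixes f :: "'n::finite \<Rightarrow> real^'n \<Rightarrow> real"
  assumes w: "radial_weight R \<rho> \<tau>"
    and f: "\<And>k x. f k differentiable (at x)" "\<And>k. continuous_on UNIV (pd k (f k))"
    and d: "\<And>x. d x = (\<Sum>k\<in>UNIV. pd k (f k) x)" and e: "\<And>x. e x = (\<Sum>k\<in>UNIV. x $ k * f k x)"
  shows "(LINT x|lborel. \<rho> x * d x) + (LINT x|lborel. \<tau> x * e x) = 0"
proof -
  have r: "radial \<rho> \<tau>" using w by (simp add: radial_weight_def)
  have fc: "continuous_on UNIV (f k)" for k
    by (simp add: continuous_at_imp_continuous_on f differentiable_imp_continuous_within)
  have eq: "pd k (\<lambda>x. \<rho> x * f k x) x = \<rho> x * pd k (f k) x + \<tau> x * (x $ k * f k x)" for k x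
    by (simp add: pd_mult[OF radial_differentiable[OF r] f(1)] pd_radial[OF r])
  have i1: "integrable lborel (\<lambda>x. \<rho> x * pd k (f k) x)" for k
    by (rule radial_weight_integrable[OF w f(2)])
  have i2: "integrable lborel (\<lambda>x. \<tau> x * (x $ k * f k x))" for k
    by (intro radial_weight_integrable(2)[OF w] continuous_intros fc)
  have z: "(LINT x|lborel. \<rho> x * pd k (f k) x) + (LINT x|lborel. \<tau> x * (x $ k * f k x)) = 0" for k
  proof -
    have "(LINT x|lborel. pd k (\<lambda>x. \<rho> x * f k x) x) = 0"
    proof (rule integral_pd_zero)
      show "(\<lambda>x. \<rho> x * f k x) differentiable (at x)" for x
        by (intro differentiable_mult radial_differentiable[OF r] f)
      show "continuous_on UNIV (pd k (\<lambda>x. \<rho> x * f k x))"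
        unfolding eq using radial_continuous[OF r] by (auto intro!: continuous_intros fc f)
      show "R \<le> norm x \<Longrightarrow> \<rho> x * f k x = 0" "R \<le> norm x \<Longrightarrow> pd k (\<lambda>x. \<rho> x * f k x) x = 0" for x
        using w by (auto simp: radial_weight_def eq)
    qed
    then show ?thesis using i1 i2 by (simp add: eq)
  qed
  have "(LINT x|lborel. \<rho> x * d x) + (LINT x|lborel. \<tau> x * e x)
     = (\<Sum>k\<in>UNIV. LINT x|lborel. \<rho> x * pd k (f k) x) + (\<Sum>k\<in>UNIV. LINT x|lborel. \<tau> x * (x $ k * f k x))"
    using i1 i2 by (simp add: d e sum_distrib_left Bochner_Integration.integral_sum)
  also have "\<dots> = 0" by (simp add: z sum.distrib[symmetric])
  finally show ?thesis .
qed

lemma vpoly_inner_C1: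
  fixes a b :: "real^'n::finite \<Rightarrow> 'b::real_inner"
  assumes "vpoly a" "vpoly b"
  shows "(\<lambda>x. a x \<bullet> b x) differentiable (at x)" "continuous_on UNIV (\<lambda>x. a x \<bullet> b x)"
    "pd k (\<lambda>x. a x \<bullet> b x) x = a x \<bullet> pd k b x + pd k a x \<bullet> b x"
    "continuous_on UNIV (pd k (\<lambda>x. a x \<bullet> b x))"
proof -
  show *: "pd k (\<lambda>x. a x \<bullet> b x) x = a x \<bullet> pd k b x + pd k a x \<bullet> b x" for x
    by (intro pd_inner vpoly_differentiable assms)
  show "(\<lambda>x. a x \<bullet> b x) differentiable (at x)"
    by (intro differentiable_inner vpoly_differentiable assms)
  show "continuous_on UNIV (\<lambda>x. a x \<bullet> b x)"
    by (intro continuous_intros vpoly_continuous assms)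
  show "continuous_on UNIV (pd k (\<lambda>x. a x \<bullet> b x))"
    unfolding * by (intro continuous_intros vpoly_continuous vpoly_pd assms)
qed

text \<open>K differentiates only along spheres. The difference of the two pairings is the
  divergence of a tangential field, to which a radial weight is transparent.\<close>

lemma spin_orbit_symmetric:
  assumes w: "radial_weight R \<rho> \<tau>" and u: "vpoly u" and v: "vpoly v"
  shows "(LINT x|lborel. \<rho> x * (spin_orbit u x \<bullet> v x)) = (LINT x|lborel. \<rho> x * (u x \<bullet> spin_orbit v x))"
proof -
  \<comment> \<open>Subtracting \<open>x $ k *\<^sub>R u x\<close> makes the field tangential: its
    radial component is \<open>slash x (slash x u) - |x|^2 u = 0\<close>.\<close>
  define f where "f k x = slashf (\<lambda>y. sg k (u y)) x - x $ k *\<^sub>R u x" for k x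
  have sgu: "vpoly (\<lambda>x. sg k (u x))" for k by (rule vpoly_bounded_linear[OF bounded_linear_sg u])
  have f: "vpoly (f k)" for k
    unfolding f_def by (intro vpoly_diff vpoly_slashf sgu vpoly_times u)
  have pf: "pd k (f k) x = slash x (sg k (pd k u x)) - x $ k *\<^sub>R pd k u x" for k x
  proof -
    have "pd k (f k) x = pd k (slashf (\<lambda>y. sg k (u y))) x - pd k (\<lambda>x. x $ k *\<^sub>R u x) x"
      unfolding f_def by (intro pd_diff vpoly_differentiable vpoly_slashf sgu vpoly_times u)
    then show ?thesis
      using u sgu by (simp add: pd_slashf pd_nth_scaleR vpoly_differentiable pd_bounded_linear[OF bounded_linear_sg])
  qed
  have "(LINT x|lborel. \<rho> x * (u x \<bullet> spin_orbit v x - spin_orbit u x \<bullet> v x)) + (LINT x|lborel. \<tau> x * 0) = 0"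
  proof (rule radial_weight_div[OF w, where f="\<lambda>k x. f k x \<bullet> v x"])
    show "(\<lambda>x. f k x \<bullet> v x) differentiable at x" "continuous_on UNIV (pd k (\<lambda>x. f k x \<bullet> v x))" for k x
      by (rule vpoly_inner_C1[OF f v])+
    have "(\<Sum>k\<in>UNIV. x $ k *\<^sub>R f k x) = 0" for x
      using slash_slash[of x "u x"] 
      by (simp add: f_def slashf_def sum_subtractf slash_def[of x "u x"] slash_simps power2_norm_eq_inner inner_vec_def scaleR_right_diff_distrib flip: scaleR_sum_left)
    then show "0 = (\<Sum>k\<in>UNIV. x $ k * (f k x \<bullet> v x))" for x
      by (simp flip: inner_sum_left inner_scaleR_left)
    show "u x \<bullet> spin_orbit v x - spin_orbit u x \<bullet> v x = (\<Sum>k\<in>UNIV. pd k (\<lambda>x. f k x \<bullet> v x) x)" for x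
    proof -
      have 1: "(\<Sum>k\<in>UNIV. pd k (f k) x \<bullet> v x) = (slash x (dirac u x) - euler u x) \<bullet> v x"
        by (simp add: pf sum_subtractf inner_diff_left dirac_def euler_def slash_simps inner_sum_left)
      have 2: "(\<Sum>k\<in>UNIV. f k x \<bullet> pd k v x) = u x \<bullet> (euler v x - slash x (dirac v x))"
      proof -
        have "f k x \<bullet> pd k v x = u x \<bullet> (x $ k *\<^sub>R pd k v x - slash x (sg k (pd k v x)))" for k
        proof -
          have "f k x \<bullet> pd k v x = u x \<bullet> (sg k (slash x (pd k v x)) - x $ k *\<^sub>R pd k v x)"
            by (simp add: f_def slashf_def inner_diff_left inner_diff_right slash_inner sg_inner)
          \<comment> \<open>The anticommutator of the \<open>k\<close>-th Pauli matrix with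
            sigma.x.\<close>
          moreover have "sg k (slash x w) + slash x (sg k w) = (2 * x $ k) *\<^sub>R w" for w
            using exhaust_3[of k] by (auto simp: slash_def sum_3 sg_simps sg_swap algebra_simps numeral_mult_vec)
          then have "sg k (slash x (pd k v x)) = (2 * x $ k) *\<^sub>R pd k v x - slash x (sg k (pd k v x))"
            by (metis add_diff_cancel)
          ultimately show ?thesis by (simp add: algebra_simps numeral_mult_vec inner_simps)
        qed
        then show ?thesis
          by (simp add: inner_sum_right[symmetric] sum_subtractf euler_def dirac_def slash_simps)
      qed
      have "(\<Sum>k\<in>UNIV. pd k (\<lambda>x. f k x \<bullet> v x) x) = (\<Sum>k\<in>UNIV. f k x \<bullet> pd k v x) + (\<Sum>k\<in>UNIV. pd k (f k) x \<bullet> v x)"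
        by (simp add: vpoly_inner_C1[OF f v] sum.distrib)
      also have "\<dots> = u x \<bullet> spin_orbit v x - spin_orbit u x \<bullet> v x"
        by (simp add: 1 2 spin_orbit_def inner_simps)
      finally show ?thesis ..
    qed
  qed
  moreover have "integrable lborel (\<lambda>x. \<rho> x * (spin_orbit u x \<bullet> v x))" "integrable lborel (\<lambda>x. \<rho> x * (u x \<bullet> spin_orbit v x))"
    by (intro radial_weight_integrable[OF w] vpoly_inner_C1 vpoly_spin_orbit u v)+
  ultimately show ?thesis by (simp add: algebra_simps)
qed

section \<open>The spectral gap of the spin-orbit operator\<close>

lemma vpoly_norm_sq: "vpoly (\<lambda>x. (norm x)\<^sup>2)"
proof -
  have "vpoly (\<lambda>x::real^'n. \<Sum>j\<in>UNIV. x $ j *\<^sub>R x $ j)"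
    by (intro vpoly_sum vpoly_times vpoly_nth)
  then show ?thesis by (simp add: power2_norm_eq_inner inner_vec_def)
qed

lemma vpoly_scaleR_norm_sq: "vpoly f \<Longrightarrow> vpoly (\<lambda>x. (norm x)\<^sup>2 *\<^sub>R f x)"
  by (rule vpoly_scaleR[OF vpoly_norm_sq])

lemma pd_norm_sq_scaleR:
  assumes "f differentiable (at x)"
  shows "pd k (\<lambda>x. (norm x)\<^sup>2 *\<^sub>R f x) x = (norm x)\<^sup>2 *\<^sub>R pd k f x + (2 * x $ k) *\<^sub>R f x"
proof -
  have r: "radial (\<lambda>x::real^'n. (norm x)\<^sup>2) (\<lambda>x. 2)"
    unfolding radial_def power2_norm_eq_inner
    by (auto intro!: derivative_eq_intros simp: inner_commute)
  show ?thesis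
    by (simp add: pd_scaleR[OF radial_differentiable[OF r] assms] pd_radial[OF r])
qed

text \<open>This is sigma.L, that is K minus the identity. It is also the vector \<open>m\<close> of
  \<open>twistor_ineq\<close> when \<open>v\<close> is the gradient of \<open>f\<close>.\<close>

definition sigma_L :: "(real^3 \<Rightarrow> complex^2) \<Rightarrow> real^3 \<Rightarrow> complex^2" where
  "sigma_L f x = euler f x - slash x (dirac f x)"

lemma sigma_L_eq: "sigma_L f = (\<lambda>x. euler f x - slashf (dirac f) x)"
  by (simp add: fun_eq_iff sigma_L_def slashf_def)

lemma spin_orbit_sigma_L: "spin_orbit f x = f x + sigma_L f x"
  by (simp add: spin_orbit_def sigma_L_def)

lemma vpoly_sigma_L: "vpoly f \<Longrightarrow> vpoly (sigma_L f)"
  unfolding sigma_L_eq by (intro vpoly_diff vpoly_euler vpoly_slashf vpoly_dirac)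

text \<open>The spin 1/2 identity \<open>(sigma.L)^2 + sigma.L = L^2\<close>: the right-hand side is
  the squared angular momentum, i.e. minus the Laplacian of the unit sphere in the angular
  variable.\<close>

lemma sigma_L_sigma_L:
  assumes "vpoly q"
  shows "sigma_L (sigma_L q) x + sigma_L q x
    = euler (euler q) x + euler q x - (norm x)\<^sup>2 *\<^sub>R (\<Sum>k\<in>UNIV. pd k (pd k q) x)"
proof -
  have v: "vpoly (euler q)" "vpoly (dirac q)" "vpoly (slashf (dirac q))"
    using assms by (simp_all add: vpoly_euler vpoly_dirac vpoly_slashf)
  have "euler (sigma_L q) x = euler (euler q) x - slash x (dirac (euler q) x)"
    unfolding sigma_L_eq by (simp add: euler_diff v euler_slashf euler_dirac assms slash_simps)
  moreover have "dirac (sigma_L q) x = - dirac q x - dirac (euler q) x + slash x (dirac (dirac q) x)"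
    unfolding sigma_L_eq
    by (simp add: dirac_diff v dirac_slashf euler_dirac assms numeral_mult_vec algebra_simps)
  ultimately have "sigma_L (sigma_L q) x = euler (euler q) x + slash x (dirac q x)
      - (norm x)\<^sup>2 *\<^sub>R dirac (dirac q) x"
    by (simp add: sigma_L_def slash_simps slash_slash)
  then show ?thesis by (simp add: sigma_L_def dirac_dirac assms)
qed

text \<open>Green's identity on the spheres: the energy of the tangential gradient equals the
  pairing of \<open>L^2 q\<close> with \<open>q\<close>, and \<open>sigma_L_sigma_L\<close>
  expresses \<open>L^2\<close> by sigma.L.\<close>

lemma twistor_energy:
  assumes w: "radial_weight R \<rho> \<tau>" and q: "vpoly q"
  shows "(LINT x|lborel. \<rho> x * ((norm x)\<^sup>2 * (\<Sum>k\<in>UNIV. (norm (pd k q x))\<^sup>2) - (norm (euler q x))\<^sup>2))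
    = (LINT x|lborel. \<rho> x * ((sigma_L (sigma_L q) x + sigma_L q x) \<bullet> q x))"
proof -
  \<comment> \<open>\<open>|x|^2\<close> times the tangential gradient of \<open>q\<close>. Being
    tangential, it contributes nothing through the derivative of the weight.\<close>
  define f where "f k x = (norm x)\<^sup>2 *\<^sub>R pd k q x - x $ k *\<^sub>R euler q x" for k x
  have f: "vpoly (f k)" for k
    unfolding f_def by (intro vpoly_diff vpoly_scaleR_norm_sq vpoly_times vpoly_pd vpoly_euler q)
  have pf: "pd k (f k) x = (2 * x $ k) *\<^sub>R pd k q x + (norm x)\<^sup>2 *\<^sub>R pd k (pd k q) x
      - euler q x - x $ k *\<^sub>R pd k (euler q) x" for k x
    unfolding f_def using q
    by (simp add: pd_diff vpoly_differentiable vpoly_scaleR_norm_sq vpoly_times vpoly_pd vpoly_euler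
      pd_norm_sq_scaleR pd_nth_scaleR)
  let ?g = "\<lambda>x. (norm x)\<^sup>2 * (\<Sum>k\<in>UNIV. (norm (pd k q x))\<^sup>2) - (norm (euler q x))\<^sup>2"
  have "(LINT x|lborel. \<rho> x * (?g x - (sigma_L (sigma_L q) x + sigma_L q x) \<bullet> q x)) + (LINT x|lborel. \<tau> x * 0) = 0"
  proof (rule radial_weight_div[OF w, where f="\<lambda>k x. f k x \<bullet> q x"])
    show "(\<lambda>x. f k x \<bullet> q x) differentiable at x" "continuous_on UNIV (pd k (\<lambda>x. f k x \<bullet> q x))" for k x
      by (rule vpoly_inner_C1[OF f q])+
    have "(\<Sum>k\<in>UNIV. x $ k *\<^sub>R f k x) = (norm x)\<^sup>2 *\<^sub>R (\<Sum>k\<in>UNIV. x $ k *\<^sub>R pd k q x) - (\<Sum>k\<in>UNIV. x $ k * x $ k) *\<^sub>R euler q x" for x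
      by (simp add: f_def sum_3 algebra_simps)
    then have "(\<Sum>k\<in>UNIV. x $ k *\<^sub>R f k x) = 0" for x
      by (simp add: euler_def power2_norm_eq_inner inner_vec_def)
    then show "0 = (\<Sum>k\<in>UNIV. x $ k * (f k x \<bullet> q x))" for x
      by (simp flip: inner_sum_left inner_scaleR_left)
    show "?g x - (sigma_L (sigma_L q) x + sigma_L q x) \<bullet> q x = (\<Sum>k\<in>UNIV. pd k (\<lambda>x. f k x \<bullet> q x) x)" for x
    proof -
      have "(\<Sum>k\<in>UNIV. pd k (f k) x) = 2 *\<^sub>R euler q x + (norm x)\<^sup>2 *\<^sub>R (\<Sum>k\<in>UNIV. pd k (pd k q) x)
          - 3 *\<^sub>R euler q x - euler (euler q) x"
      proof -
        have "(\<Sum>k\<in>UNIV. (2 * x $ k) *\<^sub>R pd k q x) = 2 *\<^sub>R euler q x"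
          by (simp add: euler_def scaleR_sum_right)
        then show ?thesis
          by (simp add: pf sum.distrib sum_subtractf scaleR_sum_right euler_def[of "euler q"] numeral_mult_vec)
      qed
      also have "\<dots> = - (sigma_L (sigma_L q) x + sigma_L q x)"
        unfolding sigma_L_sigma_L[OF q] numeral_mult_vec(3)[symmetric] by (simp add: algebra_simps)
      finally have 1: "(\<Sum>k\<in>UNIV. pd k (f k) x \<bullet> q x) = - (sigma_L (sigma_L q) x + sigma_L q x) \<bullet> q x"
        by (simp only: inner_sum_left[symmetric])
      have "(\<Sum>k\<in>UNIV. f k x \<bullet> pd k q x) = (norm x)\<^sup>2 * (\<Sum>k\<in>UNIV. (norm (pd k q x))\<^sup>2)
          - (\<Sum>k\<in>UNIV. x $ k *\<^sub>R pd k q x) \<bullet> euler q x"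
        by (simp add: f_def sum_3 inner_simps inner_commute power2_norm_eq_inner algebra_simps)
      then have 2: "(\<Sum>k\<in>UNIV. f k x \<bullet> pd k q x) = ?g x"
        by (simp add: euler_def[symmetric] power2_norm_eq_inner)
      show ?thesis
        by (simp add: vpoly_inner_C1[OF f q] sum.distrib 1 2 inner_simps)
    qed
  qed
  moreover have "integrable lborel (\<lambda>x. \<rho> x * ?g x)"
    by (intro radial_weight_integrable[OF w] continuous_intros vpoly_continuous vpoly_pd vpoly_euler q)
  moreover have "integrable lborel (\<lambda>x. \<rho> x * ((sigma_L (sigma_L q) x + sigma_L q x) \<bullet> q x))"
    by (intro radial_weight_integrable[OF w] vpoly_inner_C1 vpoly_add vpoly_sigma_L q)
  ultimately show ?thesis by (simp add: right_diff_distrib)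
qed

text \<open>Let \<open>a\<close> be the weighted integral of \<open>|sigma.L q|^2\<close> and
  \<open>b\<close> that of \<open>sigma.L q\<close> paired with \<open>q\<close>. The tangential
  energy is \<open>a + b\<close>, so \<open>twistor_ineq\<close> integrates to
  \<open>a <= 2 (a + b)\<close>, that is \<open>a + 2 b >= 0\<close>. But \<open>a + 2 b\<close> is
  exactly the excess of the norm of \<open>K q = q + sigma.L q\<close> over that of
  \<open>q\<close>.\<close>

lemma spin_orbit_lower_bound:
  assumes w: "radial_weight R \<rho> \<tau>" and pos: "\<And>x. 0 \<le> \<rho> x" and q: "vpoly q"
  shows "(LINT x|lborel. \<rho> x * (norm (q x))\<^sup>2) \<le> (LINT x|lborel. \<rho> x * (norm (spin_orbit q x))\<^sup>2)"
proof -
  define a where "a = (LINT x|lborel. \<rho> x * (norm (sigma_L q x))\<^sup>2)"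
  define b where "b = (LINT x|lborel. \<rho> x * (sigma_L q x \<bullet> q x))"
  have m: "vpoly (sigma_L q)" "vpoly (sigma_L (sigma_L q))" using q by (simp_all add: vpoly_sigma_L)
  have int: "integrable lborel (\<lambda>x. \<rho> x * (f x \<bullet> g x))" if "vpoly f" "vpoly g" for f g :: "real^3 \<Rightarrow> complex^2"
    by (intro radial_weight_integrable[OF w] vpoly_inner_C1 that)
  have intn: "integrable lborel (\<lambda>x. \<rho> x * (norm (f x))\<^sup>2)" if "vpoly f" for f :: "real^3 \<Rightarrow> complex^2"
    using int[OF that that] by (simp add: power2_norm_eq_inner)
  \<comment> \<open>sigma.L inherits the symmetry of K, since the identity part contributes equally
    to both sides.\<close>
  have "(LINT x|lborel. \<rho> x * (sigma_L (sigma_L q) x \<bullet> q x)) = a"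
    using spin_orbit_symmetric[OF w m(1) q] int m q
    by (simp add: spin_orbit_sigma_L inner_simps distrib_left a_def power2_norm_eq_inner inner_commute)
  then have eq: "(LINT x|lborel. \<rho> x * ((norm x)\<^sup>2 * (\<Sum>k\<in>UNIV. (norm (pd k q x))\<^sup>2) - (norm (euler q x))\<^sup>2)) = a + b"
    unfolding twistor_energy[OF w q] using int m q
    by (simp add: inner_simps distrib_left b_def)
  have "a \<le> (LINT x|lborel. 2 * (\<rho> x * ((norm x)\<^sup>2 * (\<Sum>k\<in>UNIV. (norm (pd k q x))\<^sup>2) - (norm (euler q x))\<^sup>2)))"
    unfolding a_def
  proof (rule integral_mono)
    show "integrable lborel (\<lambda>x. 2 * (\<rho> x * ((norm x)\<^sup>2 * (\<Sum>k\<in>UNIV. (norm (pd k q x))\<^sup>2) - (norm (euler q x))\<^sup>2)))"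
      by (intro integrable_mult_right radial_weight_integrable[OF w] continuous_intros vpoly_continuous vpoly_pd vpoly_euler q)
    show "\<rho> x * (norm (sigma_L q x))\<^sup>2 \<le> 2 * (\<rho> x * ((norm x)\<^sup>2 * (\<Sum>k\<in>UNIV. (norm (pd k q x))\<^sup>2) - (norm (euler q x))\<^sup>2))" for x
      using mult_left_mono[OF twistor_ineq[of x "\<lambda>k. pd k q x"] pos[of x]]
      by (simp add: sigma_L_def euler_def dirac_def algebra_simps)
  qed (rule intn[OF m(1)])
  then have "a \<le> 2 * (a + b)" by (simp add: eq)
  moreover have "(LINT x|lborel. \<rho> x * (norm (spin_orbit q x))\<^sup>2) = (LINT x|lborel. \<rho> x * (norm (q x))\<^sup>2) + 2 * b + a"
  proof -
    have "\<rho> x * (norm (spin_orbit q x))\<^sup>2 = \<rho> x * (norm (q x))\<^sup>2 + 2 * (\<rho> x * (sigma_L q x \<bullet> q x)) + \<rho> x * (norm (sigma_L q x))\<^sup>2" for x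
      by (simp add: spin_orbit_sigma_L power2_norm_eq_inner inner_simps inner_commute algebra_simps)
    then show ?thesis using intn[OF q] intn[OF m(1)] int[OF m(1) q] by (simp add: a_def b_def)
  qed
  ultimately show ?thesis by simp
qed


section \<open>The regularised inequality for a radial cutoff times a polynomial\<close>

lemma radial_inv_sqrt:
  assumes "\<epsilon> > 0"
  shows "radial (\<lambda>x::'a::real_inner. 1 / sqrt ((norm x)\<^sup>2 + \<epsilon>\<^sup>2)) (\<lambda>x. - ((1 / sqrt ((norm x)\<^sup>2 + \<epsilon>\<^sup>2)) ^ 3))"
  unfolding radial_def
proof (intro conjI allI)
  fix x :: 'a
  have pos: "x \<bullet> x + \<epsilon>\<^sup>2 > 0" using assms by (intro add_nonneg_pos) auto
  define w where "w = sqrt (x \<bullet> x + \<epsilon>\<^sup>2)"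
  have w: "w > 0" using pos by (simp add: w_def)
  have "((\<lambda>x. 1 / sqrt (x \<bullet> x + \<epsilon>\<^sup>2)) has_derivative (\<lambda>h. - (2 * (x \<bullet> h)) * (inverse w / 2) / (w * w))) (at x)"
    using pos w by (auto intro!: derivative_eq_intros simp: inner_commute w_def[symmetric] fun_eq_iff field_simps)
  moreover have "- (2 * (x \<bullet> h)) * (inverse w / 2) / (w * w) = - ((1 / w) ^ 3) * (x \<bullet> h)" for h
    using w by (simp add: field_simps power3_eq_cube)
  ultimately show "((\<lambda>x. 1 / sqrt ((norm x)\<^sup>2 + \<epsilon>\<^sup>2)) has_derivative
      (\<lambda>h. - ((1 / sqrt ((norm x)\<^sup>2 + \<epsilon>\<^sup>2)) ^ 3) * (x \<bullet> h))) (at x)"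
    by (simp add: power2_norm_eq_inner w_def)
next
  have "(norm x)\<^sup>2 + \<epsilon>\<^sup>2 \<noteq> 0" for x :: 'a
    using assms by (metis add_nonneg_pos less_irrefl zero_le_power2 zero_less_power)
  then show "continuous_on UNIV (\<lambda>x::'a. - ((1 / sqrt ((norm x)\<^sup>2 + \<epsilon>\<^sup>2)) ^ 3))"
    by (intro continuous_intros) auto
qed

text \<open>The computation of the overview for \<open>\<xi> p\<close>, with \<open>\<xi> q\<close>
  in the role of \<open>u\<close>: K commutes with radial factors, and the product rule gives D
  applied to \<open>\<xi> p\<close> as the vector called \<open>\<Phi>\<close> below. As
  \<open>\<epsilon>\<close> tends to 0, the weights \<open>|x|^2 s^3\<close> and
  \<open>|x|^2 s^2\<close> tend to \<open>1/|x|\<close> and 1 away from the origin.\<close>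

lemma poly_ineq:
  fixes p :: "real^3 \<Rightarrow> complex^2" and \<xi> :: "real^3 \<Rightarrow> real"
  assumes p: "vpoly p" and w: "radial_weight R \<xi> \<tau>" and eps: "\<epsilon> > 0"
  defines "s \<equiv> \<lambda>x::real^3. 1 / sqrt ((norm x)\<^sup>2 + \<epsilon>\<^sup>2)"
  shows "(LINT x|lborel. (norm x)\<^sup>2 * (s x) ^ 3 * (norm (\<xi> x *\<^sub>R p x))\<^sup>2)
    \<le> (LINT x|lborel. norm x / (1 + norm x) * (norm (\<xi> x *\<^sub>R dirac p x + \<tau> x *\<^sub>R slash x (p x)))\<^sup>2)
      + (LINT x|lborel. (norm x)\<^sup>2 * (s x)\<^sup>2 * (norm (\<xi> x *\<^sub>R p x))\<^sup>2)"
proof -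
  obtain q where q: "vpoly q" "spin_orbit q = p" using spin_orbit_surj[OF p] by blast
  have sr: "radial s (\<lambda>x. - ((s x) ^ 3))"
    unfolding s_def by (rule radial_inv_sqrt[OF eps])
  have sc: "continuous_on UNIV s" by (rule radial_continuous[OF sr])
  have s_pos: "s x > 0" for x
    using eps by (simp add: s_def add_nonneg_pos)
  have s_sq: "((norm x)\<^sup>2 + \<epsilon>\<^sup>2) * (s x)\<^sup>2 = 1" for x
    using eps by (simp add: s_def power_divide)
  have s_norm: "norm x * s x \<le> 1" for x
  proof -
    have "0 \<le> \<epsilon>\<^sup>2 * (s x)\<^sup>2" by simp
    then have "(norm x * s x)\<^sup>2 \<le> 1\<^sup>2"
      using s_sq[of x] unfolding power_mult_distrib distrib_right power_one by linarith
    then show ?thesis by (rule power2_le_imp_le) simp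
  qed
  have cr: "radial \<xi> \<tau>" using w by (simp add: radial_weight_def)
  note cc = radial_continuous[OF cr]
  have W: "\<exists>\<tau>'. radial_weight R (\<lambda>x. f x * (\<xi> x)\<^sup>2) \<tau>'" if "radial f f'" for f f'
    using radial_weight_mult[OF radial_mult[OF that cr] w] by (auto simp: power2_eq_square mult.assoc)
  define \<rho> where "\<rho> x = s x * (\<xi> x)\<^sup>2" for x
  define \<rho>' where "\<rho>' x = - ((s x) ^ 3) * (\<xi> x)\<^sup>2 + 2 * s x * \<xi> x * \<tau> x" for x
  have rw: "radial_weight R \<rho> \<rho>'"
    using radial_weight_mult[OF radial_mult[OF sr cr] w]
    by (simp add: \<rho>_def[abs_def] \<rho>'_def[abs_def] power2_eq_square algebra_simps)
  \<comment> \<open>The first two summands are the weight of \<open>|q|^2\<close> in the pointwise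
    bound \<open>pw\<close>. The third is the share of \<open>q\<close> in the error term of weight
    \<open>\<epsilon>^2 s^3\<close>. The spectral gap is applied to the sum of the three.\<close>
  define V where "V x = (norm x)\<^sup>2 * (s x)\<^sup>2 + s x + \<epsilon>\<^sup>2 / 2 * (s x) ^ 3" for x
  have V_pos: "V x \<ge> 0" for x
    using s_pos[of x] by (simp add: V_def)
  \<comment> \<open>Since \<open>|x|^2 s^2 = 1 - \<epsilon>^2 s^2\<close>, the weight is a
    polynomial in \<open>s\<close>, and closure of \<open>radial\<close> under sums and products
    applies.\<close>
  have V_eq: "V = (\<lambda>x. (1 + (- \<epsilon>\<^sup>2) * (s x * s x)) + (s x + \<epsilon>\<^sup>2 / 2 * (s x * (s x * s x))))"
    using s_sq by (simp add: fun_eq_iff V_def power2_eq_square power3_eq_cube algebra_simps)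
  have "\<exists>V'. radial V V'"
    unfolding V_eq
    by (rule exI, rule radial_add[OF radial_add[OF radial_const radial_mult[OF radial_const radial_mult[OF sr sr]]]
      radial_add[OF sr radial_mult[OF radial_const radial_mult[OF sr radial_mult[OF sr sr]]]]])
  then obtain V' where V': "radial V V'" by blast
  from W[OF V'] obtain V2 where V2: "radial_weight R (\<lambda>x. V x * (\<xi> x)\<^sup>2) V2" by blast
  have KV: "(LINT x|lborel. V x * (\<xi> x)\<^sup>2 * (norm (q x))\<^sup>2) \<le> (LINT x|lborel. V x * (\<xi> x)\<^sup>2 * (norm (p x))\<^sup>2)"
    using spin_orbit_lower_bound[OF V2 _ q(1)] V_pos by (simp add: q(2))
  define \<Phi> where "\<Phi> x = \<xi> x *\<^sub>R dirac p x + \<tau> x *\<^sub>R slash x (p x)" for x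
  have c: "continuous_on UNIV p" "continuous_on UNIV q" "continuous_on UNIV (dirac p)" "continuous_on UNIV (euler p)"
    "continuous_on UNIV (euler q)" 
    by (intro vpoly_continuous p q vpoly_dirac vpoly_euler)+
  have cV: "continuous_on UNIV V" by (rule radial_continuous[OF V'])
  have c_slash: "continuous_on UNIV (\<lambda>x. slash x (f x))" if "continuous_on UNIV f" for f
    unfolding slash_def by (intro continuous_intros bounded_linear.continuous_on[OF bounded_linear_sg] that
      bounded_linear.continuous_on[OF bounded_linear_vec_nth])
  have cP: "continuous_on UNIV \<Phi>"
    unfolding \<Phi>_def by (intro continuous_intros c cc c_slash)
  have zero: "\<xi> x = 0" "\<tau> x = 0" "\<Phi> x = 0" if "norm x > R" for x
    using w that by (auto simp: radial_weight_def \<Phi>_def)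
  have int1: "integrable lborel (\<lambda>x. norm x / (1 + norm x) * (norm (\<Phi> x))\<^sup>2)"
  proof (rule integrable_continuous_cball[of _ R])
    have "1 + norm x \<noteq> 0" for x :: "real^3" using norm_ge_zero[of x] by linarith
    then show "continuous_on UNIV (\<lambda>x. norm x / (1 + norm x) * (norm (\<Phi> x))\<^sup>2)"
      by (intro continuous_intros cP) auto
  qed (simp add: zero)
  have int2: "integrable lborel (\<lambda>x. s x * \<xi> x * (slash x (\<Phi> x) \<bullet> q x))"
    by (rule integrable_continuous_cball[of _ R], intro continuous_intros cP c cc sc c_slash) (simp add: zero)
  have int3: "integrable lborel (\<lambda>x. f x * (\<xi> x)\<^sup>2 * g x)" if "continuous_on UNIV f" "continuous_on UNIV g" for f g
    by (rule integrable_continuous_cball[of _ R], intro continuous_intros that cc) (simp add: zero)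
  have int4: "integrable lborel (\<lambda>x. f x * \<xi> x * \<tau> x * g x)" if "continuous_on UNIV f" "continuous_on UNIV g" for f g
    by (rule integrable_continuous_cball[of _ R], intro continuous_intros that cc) (simp add: zero)
  have vi: "integrable lborel (\<lambda>x. \<rho> x * (f x \<bullet> g x))" if "vpoly f" "vpoly g" for f g :: "real^3 \<Rightarrow> complex^2"
    by (intro radial_weight_integrable[OF rw] vpoly_inner_C1 that)
  define X where "X = (LINT x|lborel. s x * \<xi> x * (slash x (\<Phi> x) \<bullet> q x))"
  \<comment> \<open>The cross term. The part with \<open>K p\<close> yields the full norm of
    \<open>p\<close>, because \<open>p = K q\<close>; everything else cancels except for a remainder
    due to \<open>s\<close> not being homogeneous of degree -1.\<close>
  have X: "2 * X = - (LINT x|lborel. \<epsilon>\<^sup>2 * (s x) ^ 3 * (\<xi> x)\<^sup>2 * (p x \<bullet> q x)) - 2 * (LINT x|lborel. \<rho> x * (p x \<bullet> p x))"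
  proof -
    have J1: "(LINT x|lborel. \<rho> x * (spin_orbit p x \<bullet> q x)) = (LINT x|lborel. \<rho> x * (p x \<bullet> p x))"
      using spin_orbit_symmetric[OF rw p q(1)] by (simp add: q(2))
    have "spin_orbit (euler q) x = euler p x" for x
      using spin_orbit_euler[OF q(1)] by (simp add: q(2))
    \<comment> \<open>From \<open>p = K q\<close> and the commutation of K with the Euler operator,
      that operator may be shifted between \<open>p\<close> and \<open>q\<close> under the
      weight.\<close>
    with spin_orbit_symmetric[OF rw vpoly_euler[OF q(1)] q(1)]
    have J2: "(LINT x|lborel. \<rho> x * (euler p x \<bullet> q x)) = (LINT x|lborel. \<rho> x * (p x \<bullet> euler q x))"
      by (simp add: q(2) inner_commute)
    have "(LINT x|lborel. \<rho> x * (3 * (p x \<bullet> q x) + euler p x \<bullet> q x + p x \<bullet> euler q x))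
       + (LINT x|lborel. \<rho>' x * ((norm x)\<^sup>2 * (p x \<bullet> q x))) = 0"
    \<comment> \<open>The divergence theorem for the radial field \<open>x (p . q)\<close>; its
      divergence has the term 3 from the dimension.\<close>
    proof (rule radial_weight_div[OF rw, where f="\<lambda>k x. (x $ k *\<^sub>R p x) \<bullet> q x"])
      show "(\<lambda>x. (x $ k *\<^sub>R p x) \<bullet> q x) differentiable at x" "continuous_on UNIV (pd k (\<lambda>x. (x $ k *\<^sub>R p x) \<bullet> q x))" for k x
        by (rule vpoly_inner_C1[OF vpoly_times[OF p] q(1)])+
      show "(norm x)\<^sup>2 * (p x \<bullet> q x) = (\<Sum>k\<in>UNIV. x $ k * ((x $ k *\<^sub>R p x) \<bullet> q x))" for x
        by (simp add: power2_norm_eq_inner inner_vec_def[of x] sum_distrib_right mult.assoc)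
      show "3 * (p x \<bullet> q x) + euler p x \<bullet> q x + p x \<bullet> euler q x = (\<Sum>k\<in>UNIV. pd k (\<lambda>x. (x $ k *\<^sub>R p x) \<bullet> q x) x)" for x
        unfolding vpoly_inner_C1(3)[OF vpoly_times[OF p] q(1)]
        by (simp add: pd_nth_scaleR vpoly_differentiable[OF p]
          euler_def inner_sum_left inner_sum_right inner_add_left sum.distrib)
    qed
    then have "(LINT x|lborel. 3 * (\<rho> x * (p x \<bullet> q x)) + \<rho> x * (euler p x \<bullet> q x) + \<rho> x * (p x \<bullet> euler q x))
       + (LINT x|lborel. \<rho>' x * ((norm x)\<^sup>2 * (p x \<bullet> q x))) = 0"
      by (simp add: algebra_simps)
    then have 3: "3 * (LINT x|lborel. \<rho> x * (p x \<bullet> q x)) + 2 * (LINT x|lborel. \<rho> x * (euler p x \<bullet> q x))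
       + (LINT x|lborel. \<rho>' x * ((norm x)\<^sup>2 * (p x \<bullet> q x))) = 0"
      using vi[OF p q(1)] vi[OF vpoly_euler[OF p] q(1)] vi[OF p vpoly_euler[OF q(1)]] J2 by simp
    define Y where "Y = (LINT x|lborel. s x * \<xi> x * \<tau> x * ((norm x)\<^sup>2 * (p x \<bullet> q x)))"
    define Z where "Z = (LINT x|lborel. (s x) ^ 3 * (\<xi> x)\<^sup>2 * ((norm x)\<^sup>2 * (p x \<bullet> q x)))"
    have iY: "integrable lborel (\<lambda>x. s x * \<xi> x * \<tau> x * ((norm x)\<^sup>2 * (p x \<bullet> q x)))"
      by (intro int4 continuous_intros sc c)
    have iZ: "integrable lborel (\<lambda>x. (s x) ^ 3 * (\<xi> x)\<^sup>2 * ((norm x)\<^sup>2 * (p x \<bullet> q x)))"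
      by (intro int3 continuous_intros sc c)
    have "(LINT x|lborel. \<rho>' x * ((norm x)\<^sup>2 * (p x \<bullet> q x)))
      = (LINT x|lborel. 2 * (s x * \<xi> x * \<tau> x * ((norm x)\<^sup>2 * (p x \<bullet> q x))) - ((s x) ^ 3) * (\<xi> x)\<^sup>2 * ((norm x)\<^sup>2 * (p x \<bullet> q x)))"
      by (simp add: \<rho>'_def algebra_simps)
    also have "\<dots> = 2 * Y - Z"
      using iY iZ by (simp add: Y_def Z_def)
    finally have 4: "(LINT x|lborel. \<rho>' x * ((norm x)\<^sup>2 * (p x \<bullet> q x))) = 2 * Y - Z" .
    have "s x * \<xi> x * (slash x (\<Phi> x) \<bullet> q x) = \<rho> x * (p x \<bullet> q x) + \<rho> x * (euler p x \<bullet> q x) - \<rho> x * (spin_orbit p x \<bullet> q x)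
        + s x * \<xi> x * \<tau> x * ((norm x)\<^sup>2 * (p x \<bullet> q x))" for x
      by (simp add: \<Phi>_def slash_simps slash_slash \<rho>_def spin_orbit_def inner_simps power2_eq_square algebra_simps)
    then have 5: "X = (LINT x|lborel. \<rho> x * (p x \<bullet> q x)) + (LINT x|lborel. \<rho> x * (euler p x \<bullet> q x)) - (LINT x|lborel. \<rho> x * (p x \<bullet> p x)) + Y"
      using vi[OF p q(1)] vi[OF vpoly_euler[OF p] q(1)] vi[OF vpoly_spin_orbit[OF p] q(1)] iY
      by (simp add: X_def Y_def J1[symmetric])
    \<comment> \<open>Writing \<open>s = \<epsilon>^2 s^3 + |x|^2 s^3\<close> isolates the summand
      that the derivative of \<open>s\<close> cancels.\<close>
    have "\<rho> x * (p x \<bullet> q x) = \<epsilon>\<^sup>2 * (s x) ^ 3 * (\<xi> x)\<^sup>2 * (p x \<bullet> q x) + (s x) ^ 3 * (\<xi> x)\<^sup>2 * ((norm x)\<^sup>2 * (p x \<bullet> q x))" for x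
    proof -
      have "s x = s x * (((norm x)\<^sup>2 + \<epsilon>\<^sup>2) * (s x)\<^sup>2)" by (simp add: s_sq)
      also have "\<dots> = \<epsilon>\<^sup>2 * (s x) ^ 3 + (norm x)\<^sup>2 * (s x) ^ 3"
        by (simp add: power2_eq_square power3_eq_cube algebra_simps)
      finally have "\<rho> x = (\<epsilon>\<^sup>2 * (s x) ^ 3 + (norm x)\<^sup>2 * (s x) ^ 3) * (\<xi> x)\<^sup>2"
        unfolding \<rho>_def by (rule arg_cong)
      then show ?thesis by (simp add: algebra_simps)
    qed
    moreover have "integrable lborel (\<lambda>x. \<epsilon>\<^sup>2 * (s x) ^ 3 * (\<xi> x)\<^sup>2 * (p x \<bullet> q x))"
      by (intro int3 continuous_intros sc c)
    ultimately have "(LINT x|lborel. \<rho> x * (p x \<bullet> q x)) = (LINT x|lborel. \<epsilon>\<^sup>2 * (s x) ^ 3 * (\<xi> x)\<^sup>2 * (p x \<bullet> q x)) + Z"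
      using iZ by (simp add: Z_def)
    with 3 4 5 show ?thesis by simp
  qed
  \<comment> \<open>The completed square, with Cauchy-Schwarz for the cross term. Regularisation
    turns the weight of \<open>|u|^2\<close> into \<open>(1 + r) r s^2 = r^2 s^2 + r s^2\<close>,
    and \<open>r s <= 1\<close> reduces the last summand to \<open>s\<close>.\<close>
  have pw: "0 \<le> norm x / (1 + norm x) * (norm (\<Phi> x))\<^sup>2 + 2 * (s x * \<xi> x * (slash x (\<Phi> x) \<bullet> q x))
     + ((norm x)\<^sup>2 * (s x)\<^sup>2 + s x) * (\<xi> x)\<^sup>2 * (norm (q x))\<^sup>2" for x
  proof (cases "x = 0")
    case True
    then show ?thesis using s_pos[of x] by (simp add: slash_def)
  next
    case False
    define r where "r = norm x"
    have r: "r > 0" using False by (simp add: r_def)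
    define Q where "Q = \<bar>\<xi> x\<bar> * norm (q x)"
    have "\<bar>\<Phi> x \<bullet> slash x (q x)\<bar> \<le> norm (\<Phi> x) * (r * norm (q x))"
      using Cauchy_Schwarz_ineq2[of "\<Phi> x" "slash x (q x)"] by (simp add: norm_slash r_def)
    then have "\<bar>s x * \<xi> x * (slash x (\<Phi> x) \<bullet> q x)\<bar> \<le> s x * norm (\<Phi> x) * r * Q"
      using mult_left_mono[of _ _ "s x * \<bar>\<xi> x\<bar>"] s_pos[of x]
      by (fastforce simp: abs_mult Q_def slash_inner mult_ac)
    moreover have "2 * (s x * norm (\<Phi> x) * r * Q) \<le> r / (1 + r) * (norm (\<Phi> x))\<^sup>2 + (1 + r) * r * (s x)\<^sup>2 * Q\<^sup>2"
    proof -
      have "0 \<le> r / (1 + r) * (norm (\<Phi> x) - (1 + r) * s x * Q)\<^sup>2"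
        using r by simp
      also have "\<dots> = r / (1 + r) * (norm (\<Phi> x))\<^sup>2 + (1 + r) * r * (s x)\<^sup>2 * Q\<^sup>2 - 2 * (s x * norm (\<Phi> x) * r * Q)"
        using r by (simp add: field_simps power2_eq_square)
      finally show ?thesis by simp
    qed
    moreover have "(1 + r) * r * (s x)\<^sup>2 * Q\<^sup>2 \<le> (r\<^sup>2 * (s x)\<^sup>2 + s x) * Q\<^sup>2"
    proof (rule mult_right_mono)
      have "r * s x * s x \<le> 1 * s x"
        using s_norm[of x] s_pos[of x] by (intro mult_right_mono) (auto simp: r_def)
      then show "(1 + r) * r * (s x)\<^sup>2 \<le> r\<^sup>2 * (s x)\<^sup>2 + s x"
        by (simp add: power2_eq_square algebra_simps)
    qed simp
    moreover have "Q\<^sup>2 = (\<xi> x)\<^sup>2 * (norm (q x))\<^sup>2" by (simp add: Q_def power_mult_distrib)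
    ultimately show ?thesis by (simp add: r_def mult.assoc)
  qed
  have "0 \<le> (LINT x|lborel. norm x / (1 + norm x) * (norm (\<Phi> x))\<^sup>2 + 2 * (s x * \<xi> x * (slash x (\<Phi> x) \<bullet> q x))
     + ((norm x)\<^sup>2 * (s x)\<^sup>2 + s x) * (\<xi> x)\<^sup>2 * (norm (q x))\<^sup>2)"
    by (intro integral_nonneg_AE AE_I2 pw)
  also have "\<dots> = (LINT x|lborel. norm x / (1 + norm x) * (norm (\<Phi> x))\<^sup>2) + 2 * X
     + (LINT x|lborel. ((norm x)\<^sup>2 * (s x)\<^sup>2 + s x) * (\<xi> x)\<^sup>2 * (norm (q x))\<^sup>2)"
    using int1 int2 int3[of "\<lambda>x. (norm x)\<^sup>2 * (s x)\<^sup>2 + s x" "\<lambda>x. (norm (q x))\<^sup>2"]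
    by (simp add: X_def continuous_intros sc c)
  finally have A: "2 * (LINT x|lborel. \<rho> x * (p x \<bullet> p x)) \<le> (LINT x|lborel. norm x / (1 + norm x) * (norm (\<Phi> x))\<^sup>2)
      - (LINT x|lborel. \<epsilon>\<^sup>2 * (s x) ^ 3 * (\<xi> x)\<^sup>2 * (p x \<bullet> q x))
      + (LINT x|lborel. ((norm x)\<^sup>2 * (s x)\<^sup>2 + s x) * (\<xi> x)\<^sup>2 * (norm (q x))\<^sup>2)"
    by (simp add: X)
  have i5: "integrable lborel (\<lambda>x. \<epsilon>\<^sup>2 * (s x) ^ 3 * (\<xi> x)\<^sup>2 * (p x \<bullet> q x))"
    "integrable lborel (\<lambda>x. ((norm x)\<^sup>2 * (s x)\<^sup>2 + s x) * (\<xi> x)\<^sup>2 * (norm (q x))\<^sup>2)"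
    "integrable lborel (\<lambda>x. V x * (\<xi> x)\<^sup>2 * (norm (q x))\<^sup>2)"
    "integrable lborel (\<lambda>x. V x * (\<xi> x)\<^sup>2 * (norm (p x))\<^sup>2)"
    "integrable lborel (\<lambda>x. \<epsilon>\<^sup>2 / 2 * (s x) ^ 3 * (\<xi> x)\<^sup>2 * (norm (p x))\<^sup>2)"
    "integrable lborel (\<lambda>x. (norm x)\<^sup>2 * (s x)\<^sup>2 * (\<xi> x)\<^sup>2 * (norm (p x))\<^sup>2)"
    "integrable lborel (\<lambda>x. (norm x)\<^sup>2 * (s x) ^ 3 * (\<xi> x)\<^sup>2 * (norm (p x))\<^sup>2)"
    "integrable lborel (\<lambda>x. s x * (\<xi> x)\<^sup>2 * (norm (p x))\<^sup>2)"
    by (intro int3 continuous_intros sc c cV)+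
  have "- (LINT x|lborel. \<epsilon>\<^sup>2 * (s x) ^ 3 * (\<xi> x)\<^sup>2 * (p x \<bullet> q x))
      + (LINT x|lborel. ((norm x)\<^sup>2 * (s x)\<^sup>2 + s x) * (\<xi> x)\<^sup>2 * (norm (q x))\<^sup>2)
    = (LINT x|lborel. ((norm x)\<^sup>2 * (s x)\<^sup>2 + s x) * (\<xi> x)\<^sup>2 * (norm (q x))\<^sup>2 - \<epsilon>\<^sup>2 * (s x) ^ 3 * (\<xi> x)\<^sup>2 * (p x \<bullet> q x))"
    using i5 by simp
  also have "\<dots> \<le> (LINT x|lborel. V x * (\<xi> x)\<^sup>2 * (norm (q x))\<^sup>2 + \<epsilon>\<^sup>2 / 2 * (s x) ^ 3 * (\<xi> x)\<^sup>2 * (norm (p x))\<^sup>2)"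
  proof (rule integral_mono)
    fix x
    \<comment> \<open>The error term has no sign. Young's inequality gives half of its weight to
      \<open>q\<close>, where it completes \<open>V\<close>, and half to \<open>p\<close>.\<close>
    have "0 \<le> (p x + q x) \<bullet> (p x + q x)" by simp
    then have "- (p x \<bullet> q x) \<le> ((norm (p x))\<^sup>2 + (norm (q x))\<^sup>2) / 2"
      by (simp add: power2_norm_eq_inner inner_simps inner_commute)
    then have "\<epsilon>\<^sup>2 * (s x) ^ 3 * (\<xi> x)\<^sup>2 * (- (p x \<bullet> q x)) \<le> \<epsilon>\<^sup>2 * (s x) ^ 3 * (\<xi> x)\<^sup>2 * (((norm (p x))\<^sup>2 + (norm (q x))\<^sup>2) / 2)"
      using s_pos[of x] by (intro mult_left_mono) auto
    then show "((norm x)\<^sup>2 * (s x)\<^sup>2 + s x) * (\<xi> x)\<^sup>2 * (norm (q x))\<^sup>2 - \<epsilon>\<^sup>2 * (s x) ^ 3 * (\<xi> x)\<^sup>2 * (p x \<bullet> q x)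
       \<le> V x * (\<xi> x)\<^sup>2 * (norm (q x))\<^sup>2 + \<epsilon>\<^sup>2 / 2 * (s x) ^ 3 * (\<xi> x)\<^sup>2 * (norm (p x))\<^sup>2"
      by (simp add: V_def algebra_simps)
  qed (use i5 in simp_all)
  also have "\<dots> = (LINT x|lborel. V x * (\<xi> x)\<^sup>2 * (norm (q x))\<^sup>2) + (LINT x|lborel. \<epsilon>\<^sup>2 / 2 * (s x) ^ 3 * (\<xi> x)\<^sup>2 * (norm (p x))\<^sup>2)"
    using i5 by simp
  also have "\<dots> \<le> (LINT x|lborel. V x * (\<xi> x)\<^sup>2 * (norm (p x))\<^sup>2) + (LINT x|lborel. \<epsilon>\<^sup>2 / 2 * (s x) ^ 3 * (\<xi> x)\<^sup>2 * (norm (p x))\<^sup>2)"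
    using KV by simp
  also have "\<dots> = (LINT x|lborel. V x * (\<xi> x)\<^sup>2 * (norm (p x))\<^sup>2 + \<epsilon>\<^sup>2 / 2 * (s x) ^ 3 * (\<xi> x)\<^sup>2 * (norm (p x))\<^sup>2)"
    using i5 by simp
  also have "\<dots> = (LINT x|lborel. 2 * (s x * (\<xi> x)\<^sup>2 * (norm (p x))\<^sup>2) + (norm x)\<^sup>2 * (s x)\<^sup>2 * (\<xi> x)\<^sup>2 * (norm (p x))\<^sup>2
      - (norm x)\<^sup>2 * (s x) ^ 3 * (\<xi> x)\<^sup>2 * (norm (p x))\<^sup>2)"
  proof (rule Bochner_Integration.integral_cong[OF refl])
    fix x
    have "s x = s x * (((norm x)\<^sup>2 + \<epsilon>\<^sup>2) * (s x)\<^sup>2)" by (simp add: s_sq)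
    also have "\<dots> = \<epsilon>\<^sup>2 * (s x) ^ 3 + (norm x)\<^sup>2 * (s x) ^ 3"
      by (simp add: power2_eq_square power3_eq_cube algebra_simps)
    \<comment> \<open>After the gap both halves multiply \<open>|p|^2\<close> and add up to
      \<open>\<epsilon>^2 s^3 = s - |x|^2 s^3\<close>. The resulting \<open>2 s\<close> cancels the
      left-hand side of \<open>A\<close>, and the two weights of the claim remain.\<close>
    finally have "V x + \<epsilon>\<^sup>2 / 2 * (s x) ^ 3 = 2 * s x + (norm x)\<^sup>2 * (s x)\<^sup>2 - (norm x)\<^sup>2 * (s x) ^ 3"
      by (simp add: V_def)
    from arg_cong[OF this, of "\<lambda>z. z * ((\<xi> x)\<^sup>2 * (norm (p x))\<^sup>2)"]
    show "V x * (\<xi> x)\<^sup>2 * (norm (p x))\<^sup>2 + \<epsilon>\<^sup>2 / 2 * (s x) ^ 3 * (\<xi> x)\<^sup>2 * (norm (p x))\<^sup>2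
      = 2 * (s x * (\<xi> x)\<^sup>2 * (norm (p x))\<^sup>2) + (norm x)\<^sup>2 * (s x)\<^sup>2 * (\<xi> x)\<^sup>2 * (norm (p x))\<^sup>2
      - (norm x)\<^sup>2 * (s x) ^ 3 * (\<xi> x)\<^sup>2 * (norm (p x))\<^sup>2"
      by (simp add: algebra_simps)
  qed
  also have "\<dots> = 2 * (LINT x|lborel. \<rho> x * (p x \<bullet> p x)) + (LINT x|lborel. (norm x)\<^sup>2 * (s x)\<^sup>2 * (\<xi> x)\<^sup>2 * (norm (p x))\<^sup>2)
      - (LINT x|lborel. (norm x)\<^sup>2 * (s x) ^ 3 * (\<xi> x)\<^sup>2 * (norm (p x))\<^sup>2)"
    using i5 by (simp add: \<rho>_def power2_norm_eq_inner)
  finally show ?thesis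
    using A by (simp add: \<Phi>_def power_mult_distrib mult.assoc)
qed

subsection \<open>Test functions\<close>

text \<open>The powers in the denominator make the family closed under differentiation up to linear
  combinations, so one derivative formula gives smoothness of every order.\<close>

definition flat :: "nat \<Rightarrow> real \<Rightarrow> real" where
  "flat m t = (if t > 0 then exp (- 1 / t) / t ^ m else 0)"

lemma flat_nonneg: "0 \<le> flat m t"
  by (simp add: flat_def)

text \<open>The series of \<open>exp (1 / t)\<close> dominates its single term of order
  \<open>m + 2\<close>. The two orders beyond \<open>m\<close> leave a factor \<open>t^2\<close>,
  which makes the difference quotient at 0 tend to 0 in \<open>flat_deriv\<close>.\<close>

lemma flat_le: "flat m t \<le> fact (m + 2) * t\<^sup>2"
proof (cases "t > 0")
  case True
  have "(\<Sum>n\<in>{m + 2}. (1 / t) ^ n /\<^sub>R fact n) \<le> (\<Sum>n. (1 / t) ^ n /\<^sub>R fact n)"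
    using True by (intro sum_le_suminf sums_summable[OF exp_converges]) auto
  moreover define F :: real where "F = fact (m + 2)"
  ultimately have "(1 / t) ^ (m + 2) / F \<le> exp (1 / t)"
    using sums_unique[OF exp_converges[of "1 / t"]] by (simp add: divide_inverse mult.commute)
  moreover have F: "F > 0" by (simp add: F_def)
  ultimately have "exp (- 1 / t) \<le> F * t ^ (m + 2)"
    using True by (simp add: exp_minus power_one_over field_simps)
  then show ?thesis
    unfolding F_def[symmetric] using True
    by (simp add: flat_def divide_le_eq power_add power2_eq_square mult_ac)
qed (simp add: flat_def)

lemma flat_deriv: "(flat m has_real_derivative flat (m + 2) t - real m * flat (m + 1) t) (at t)"
proof -
  consider "t > 0" | "t < 0" | "t = 0" by linarith
  then show ?thesis
  proof cases
    case 1
    have "((\<lambda>t. exp (- 1 / t) / t ^ m) has_real_derivative flat (m + 2) t - real m * flat (m + 1) t) (at t)"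
      using 1 by (cases m) (auto intro!: derivative_eq_intros simp: flat_def field_simps power2_eq_square,
        metis One_nat_def power_eq_if)
    then show ?thesis
      by (rule has_field_derivative_transform_within_open[of _ _ _ "{0<..}"]) (use 1 in \<open>auto simp: flat_def\<close>)
  next
    case 2
    have "((\<lambda>t. 0) has_real_derivative flat (m + 2) t - real m * flat (m + 1) t) (at t)"
      using 2 by (simp add: flat_def)
    then show ?thesis
      by (rule has_field_derivative_transform_within_open[of _ _ _ "{..<0}"]) (use 2 in \<open>auto simp: flat_def\<close>)
  next
    case 3
    have "((\<lambda>t. flat m t / t) \<longlongrightarrow> 0) (at 0)"
    proof (rule Lim_null_comparison)
      show "\<forall>\<^sub>F t in at 0. norm (flat m t / t) \<le> fact (m + 2) * \<bar>t\<bar>"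
      proof (rule always_eventually, rule allI)
        fix t :: real
        show "norm (flat m t / t) \<le> fact (m + 2) * \<bar>t\<bar>"
          using flat_le[of m t] flat_nonneg[of m t]
          by (cases "t = 0") (simp_all add: divide_le_eq power2_eq_square mult.assoc abs_mult_self_eq)
      qed
      show "((\<lambda>t::real. fact (m + 2) * \<bar>t\<bar>) \<longlongrightarrow> 0) (at 0)"
        by (auto intro!: tendsto_eq_intros)
    qed
    then show ?thesis using 3 by (simp add: DERIV_def flat_def)
  qed
qed

lemma flat_continuous: "continuous_on UNIV (flat m)"
  using flat_deriv by (meson DERIV_isCont continuous_at_imp_continuous_on)

lemma flat_le_1: "flat 0 t \<le> 1"
  by (simp add: flat_def)

lemma radial_flat:
  "radial (\<lambda>x::'a::real_inner. flat m (1 - c * (norm x)\<^sup>2))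
    (\<lambda>x. (-2 * c) * flat (m + 2) (1 - c * (norm x)\<^sup>2) + 2 * c * real m * flat (m + 1) (1 - c * (norm x)\<^sup>2))"
  unfolding radial_def
proof (intro conjI allI)
  fix x :: 'a
  have "((\<lambda>x. 1 - c * (norm x)\<^sup>2) has_derivative (\<lambda>h. - c * (2 * (x \<bullet> h)))) (at x)"
    unfolding power2_norm_eq_inner by (auto intro!: derivative_eq_intros simp: inner_commute)
  from has_derivative_compose[OF this flat_deriv[unfolded has_field_derivative_def]]
  show "((\<lambda>x. flat m (1 - c * (norm x)\<^sup>2)) has_derivative (\<lambda>h. ((-2 * c) * flat (m + 2) (1 - c * (norm x)\<^sup>2)
      + 2 * c * real m * flat (m + 1) (1 - c * (norm x)\<^sup>2)) * (x \<bullet> h))) (at x)"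
    by (simp add: algebra_simps)
qed (intro continuous_intros continuous_on_compose2[OF flat_continuous]; simp)

text \<open>A class closed under \<open>pd\<close>, so that all its members are smooth. Products of
  Landau kernels with the cutoff belong to it; these are the test functions used with weak
  derivatives.\<close>

inductive bump_poly :: "real \<Rightarrow> (real^'n::finite \<Rightarrow> real) \<Rightarrow> bool" for c where
  bump_poly_flat: "vpoly \<pi> \<Longrightarrow> bump_poly c (\<lambda>x. \<pi> x * flat m (1 - c * (norm x)\<^sup>2))"
| bump_poly_add: "bump_poly c f \<Longrightarrow> bump_poly c g \<Longrightarrow> bump_poly c (\<lambda>x. f x + g x)"

lemma bump_poly_differentiable: "bump_poly c f \<Longrightarrow> f differentiable (at x)"
proof (induction rule: bump_poly.induct)
  case (bump_poly_flat \<pi> m)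
  show ?case
    by (rule differentiable_mult[OF vpoly_differentiable[OF bump_poly_flat] radial_differentiable[OF radial_flat]])
qed simp

lemma bump_poly_pd: "bump_poly c f \<Longrightarrow> bump_poly c (pd k f)"
proof (induction rule: bump_poly.induct)
  case (bump_poly_flat \<pi> m)
  let ?f = "\<lambda>m x. flat m (1 - c * (norm x)\<^sup>2)"
  have "pd k (\<lambda>x. \<pi> x * ?f m x) = (\<lambda>x. pd k \<pi> x * ?f m x + ((x $ k *\<^sub>R ((-2 * c) *\<^sub>R \<pi> x)) * ?f (m + 2) x
     + (x $ k *\<^sub>R ((2 * c * real m) *\<^sub>R \<pi> x)) * ?f (m + 1) x))"
    by (auto simp: pd_mult[OF vpoly_differentiable[OF bump_poly_flat] radial_differentiable[OF radial_flat]]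
      pd_radial[OF radial_flat] algebra_simps)
  moreover have "bump_poly c \<dots>"
    by (intro bump_poly.intros vpoly_times vpoly_cmul vpoly_pd bump_poly_flat)
  ultimately show ?case by simp
next
  case (bump_poly_add f g)
  then have "pd k (\<lambda>x. f x + g x) = (\<lambda>x. pd k f x + pd k g x)"
    by (auto simp: pd_add bump_poly_differentiable)
  with bump_poly_add.IH show ?case by (simp add: bump_poly.bump_poly_add)
qed

lemma bump_poly_C_diff: "bump_poly c f \<Longrightarrow> C_diff m f"
proof (induction m arbitrary: f)
  case 0
  then show ?case
    by (simp add: continuous_at_imp_continuous_on differentiable_imp_continuous_within bump_poly_differentiable)
qed (simp add: bump_poly_differentiable partial_deriv_eq_pd bump_poly_pd)

lemma bump_poly_support:
  assumes "bump_poly c f" "c > 0" "norm x \<ge> 1 / sqrt c"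
  shows "f x = 0"
  using assms(1)
proof (induction rule: bump_poly.induct)
  case (bump_poly_flat \<pi> m)
  have "1 \<le> c * (norm x)\<^sup>2"
  proof -
    have "(1 / sqrt c)\<^sup>2 \<le> (norm x)\<^sup>2" using assms by (intro power_mono) auto
    then show ?thesis using assms(2) by (simp add: power_divide field_simps)
  qed
  then show ?case by (simp add: flat_def)
qed simp

lemma bump_poly_test_function:
  assumes "bump_poly c f" "c > 0"
  shows "f \<in> test_functions"
proof -
  have "{x. f x \<noteq> 0} \<subseteq> cball 0 (1 / sqrt c)"
    using bump_poly_support[OF assms] by (auto simp: not_le) (meson less_eq_real_def not_le)
  then have "bounded {x. f x \<noteq> 0}"
    by (rule bounded_subset[OF bounded_cball])
  then show ?thesis
    using bump_poly_C_diff[OF assms(1)] by (simp add: test_functions_def compact_closure)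
qed

subsection \<open>Square integrable functions\<close>

text \<open>Square integrable Borel functions on \<open>lborel\<close>: translations and Tonelli's
  theorem are used for this measure, and \<open>L2_borel_version\<close> provides a representative
  for each element of \<open>L2\<close>.\<close>

definition l2 :: "('a::euclidean_space \<Rightarrow> 'b::euclidean_space) \<Rightarrow> bool" where
  "l2 f \<longleftrightarrow> f \<in> borel_measurable borel \<and> integrable lborel (\<lambda>x. (norm (f x))\<^sup>2)"

lemma l2_measurable: "l2 f \<Longrightarrow> f \<in> borel_measurable borel"
  by (simp add: l2_def)

lemma l2_integrable: "l2 f \<Longrightarrow> integrable lborel (\<lambda>x. (norm (f x))\<^sup>2)"
  by (simp add: l2_def)

lemma l2_bound:
  assumes "integrable lborel g" "f \<in> borel_measurable borel" "\<And>x. (norm (f x))\<^sup>2 \<le> g x"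
  shows "l2 f"
  unfolding l2_def
proof
  show "integrable lborel (\<lambda>x. (norm (f x))\<^sup>2)"
  proof (rule Bochner_Integration.integrable_bound[OF assms(1)])
    show "(\<lambda>x. (norm (f x))\<^sup>2) \<in> borel_measurable lborel" using assms(2) by simp
    show "AE x in lborel. norm ((norm (f x))\<^sup>2) \<le> norm (g x)"
      by (rule AE_I2) (metis abs_ge_self abs_of_nonneg assms(3) order_trans real_norm_def zero_le_power2)
  qed
qed (rule assms(2))

lemma norm_add_sq_le: "(norm (a + b))\<^sup>2 \<le> 2 * (norm a)\<^sup>2 + 2 * (norm (b :: 'b::real_inner))\<^sup>2"
proof -
  have "0 \<le> (a - b) \<bullet> (a - b)" by simp
  then show ?thesis by (simp add: power2_norm_eq_inner inner_simps inner_commute)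
qed

lemma norm_diff_sq_le: "(norm (a - b))\<^sup>2 \<le> 2 * (norm a)\<^sup>2 + 2 * (norm (b :: 'b::real_inner))\<^sup>2"
  using norm_add_sq_le[of a "- b"] by simp

lemma l2_add: "l2 f \<Longrightarrow> l2 g \<Longrightarrow> l2 (\<lambda>x. f x + g x)"
  by (rule l2_bound[of "\<lambda>x. 2 * (norm (f x))\<^sup>2 + 2 * (norm (g x))\<^sup>2"])
     (auto simp: l2_def norm_add_sq_le)

lemma l2_sum: "(\<And>i. i \<in> I \<Longrightarrow> l2 (f i)) \<Longrightarrow> l2 (\<lambda>x. \<Sum>i\<in>I. f i x)"
proof (induction I rule: infinite_finite_induct)
  case (insert i I)
  then have "l2 (\<lambda>x. f i x + (\<Sum>j\<in>I. f j x))" by (intro l2_add) auto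
  with insert.hyps show ?case by simp
qed (auto simp: l2_def)

lemma l2_bounded_linear:
  assumes "bounded_linear L" "l2 f"
  shows "l2 (\<lambda>x. L (f x))"
proof -
  obtain K where K: "\<And>u. norm (L u) \<le> norm u * K" using bounded_linear.bounded[OF assms(1)] by blast
  show ?thesis
  proof (rule l2_bound[of "\<lambda>x. K\<^sup>2 * (norm (f x))\<^sup>2"])
    show "integrable lborel (\<lambda>x. K\<^sup>2 * (norm (f x))\<^sup>2)" using l2_integrable[OF assms(2)] by simp
    show "(\<lambda>x. L (f x)) \<in> borel_measurable borel"
      using borel_measurable_continuous_onI[OF linear_continuous_on[OF assms(1)]] l2_measurable[OF assms(2)]
      by (rule measurable_compose_rev)
    show "(norm (L (f x)))\<^sup>2 \<le> K\<^sup>2 * (norm (f x))\<^sup>2" for x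
      using power_mono[OF K[of "f x"], of 2] by (simp add: power_mult_distrib mult.commute)
  qed
qed

lemma l2_scaleR:
  assumes "a \<in> borel_measurable borel" "\<And>x. \<bar>a x\<bar> \<le> C" "l2 f"
  shows "l2 (\<lambda>x. a x *\<^sub>R f x)"
proof (rule l2_bound[of "\<lambda>x. C\<^sup>2 * (norm (f x))\<^sup>2"])
  show "integrable lborel (\<lambda>x. C\<^sup>2 * (norm (f x))\<^sup>2)" using l2_integrable[OF assms(3)] by simp
  show "(\<lambda>x. a x *\<^sub>R f x) \<in> borel_measurable borel"
    using assms(1) l2_measurable[OF assms(3)] by simp
  show "(norm (a x *\<^sub>R f x))\<^sup>2 \<le> C\<^sup>2 * (norm (f x))\<^sup>2" for x
    using power_mono[OF assms(2)[of x], of 2] by (simp add: power_mult_distrib mult_right_mono)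
qed

lemma l2_diff: "l2 f \<Longrightarrow> l2 g \<Longrightarrow> l2 (\<lambda>x. f x - g x)"
  using l2_add[of f "\<lambda>x. - g x"] by (simp add: l2_def)

lemma l2_continuous_indicator:
  assumes "continuous_on UNIV f"
  shows "l2 (\<lambda>x. indicator (cball 0 R) x *\<^sub>R f x)"
proof (rule l2_bound[of "\<lambda>x. indicator (cball 0 R) x *\<^sub>R (norm (f x))\<^sup>2"])
  show "integrable lborel (\<lambda>x. indicator (cball 0 R) x *\<^sub>R (norm (f x))\<^sup>2)"
    by (intro borel_integrable_compact continuous_intros continuous_on_subset[OF assms]) auto
  show "(\<lambda>x. indicator (cball 0 R) x *\<^sub>R f x) \<in> borel_measurable borel"
    using borel_measurable_continuous_onI[OF assms] by (intro borel_measurable_scaleR borel_measurable_indicator) auto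
qed (auto simp: indicator_def)

lemma l2_integrable_scaleR:
  assumes f: "l2 f" and supp: "\<And>x. norm x \<ge> R \<Longrightarrow> f x = 0" and g: "continuous_on UNIV g"
  shows "integrable lborel (\<lambda>x. g x *\<^sub>R f x)"
proof (rule Bochner_Integration.integrable_bound)
  show "integrable lborel (\<lambda>x. indicator (cball 0 R) x *\<^sub>R (g x)\<^sup>2 + (norm (f x))\<^sup>2)"
    by (intro Bochner_Integration.integrable_add borel_integrable_compact l2_integrable[OF f] continuous_intros continuous_on_subset[OF g]) auto
  show "(\<lambda>x. g x *\<^sub>R f x) \<in> borel_measurable lborel"
    using l2_measurable[OF f] borel_measurable_continuous_onI[OF g] by simp
  show "AE x in lborel. norm (g x *\<^sub>R f x) \<le> norm (indicator (cball 0 R) x *\<^sub>R (g x)\<^sup>2 + (norm (f x))\<^sup>2)"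
  proof (rule AE_I2)
    fix x
    show "norm (g x *\<^sub>R f x) \<le> norm (indicator (cball 0 R) x *\<^sub>R (g x)\<^sup>2 + (norm (f x))\<^sup>2)"
    proof (cases "norm x \<le> R")
      case True
      have "2 * (\<bar>g x\<bar> * norm (f x)) \<le> (g x)\<^sup>2 + (norm (f x))\<^sup>2"
        using zero_le_power2[of "\<bar>g x\<bar> - norm (f x)"] by (simp add: power2_diff)
      moreover have "0 \<le> \<bar>g x\<bar> * norm (f x)" by simp
      ultimately have "\<bar>g x\<bar> * norm (f x) \<le> (g x)\<^sup>2 + (norm (f x))\<^sup>2" by linarith
      then show ?thesis using True by simp
    qed (simp add: supp)
  qed
qed

text \<open>Young's inequality with a parameter \<open>t\<close> bounds the difference of the
  squares by \<open>(1 + 1/t) |F n - f|^2 + t |f|^2\<close>. For fixed \<open>t\<close> the first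
  part vanishes in the limit, and \<open>t\<close> makes the second small.\<close>

lemma l2_tendsto:
  fixes F :: "nat \<Rightarrow> 'a::euclidean_space \<Rightarrow> 'b::euclidean_space"
  assumes F: "\<And>n. l2 (F n)" and f: "l2 f" and lim: "(\<lambda>n. LINT x|lborel. (norm (F n x - f x))\<^sup>2) \<longlonglongrightarrow> 0"
    and \<rho>: "\<rho> \<in> borel_measurable borel" "\<And>x. \<bar>\<rho> x\<bar> \<le> C"
  shows "(\<lambda>n. LINT x|lborel. \<rho> x * (norm (F n x))\<^sup>2) \<longlonglongrightarrow> (LINT x|lborel. \<rho> x * (norm (f x))\<^sup>2)"
proof -
  define a where "a n = (LINT x|lborel. (norm (F n x - f x))\<^sup>2)" for n
  define b where "b = (LINT x|lborel. (norm (f x))\<^sup>2)"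
  have C: "C \<ge> 0" using \<rho>(2)[of 0] by linarith
  have b: "b \<ge> 0" by (simp add: b_def)
  have int: "integrable lborel (\<lambda>x. \<rho> x * (norm (g x))\<^sup>2)" if "l2 g" for g :: "'a \<Rightarrow> 'b"
  proof (rule Bochner_Integration.integrable_bound)
    show "integrable lborel (\<lambda>x. C * (norm (g x))\<^sup>2)" using l2_integrable[OF that] by simp
    show "(\<lambda>x. \<rho> x * (norm (g x))\<^sup>2) \<in> borel_measurable lborel" using \<rho>(1) l2_measurable[OF that] by simp
    show "AE x in lborel. norm (\<rho> x * (norm (g x))\<^sup>2) \<le> norm (C * (norm (g x))\<^sup>2)"
      using \<rho>(2) C by (intro AE_I2) (simp add: abs_mult mult_right_mono)
  qed
  have key: "\<bar>(LINT x|lborel. \<rho> x * (norm (F n x))\<^sup>2) - (LINT x|lborel. \<rho> x * (norm (f x))\<^sup>2)\<bar>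
      \<le> C * ((1 + 1 / t) * a n + t * b)" if t: "t > 0" for n t
  proof -
    have "\<bar>(LINT x|lborel. \<rho> x * (norm (F n x))\<^sup>2) - (LINT x|lborel. \<rho> x * (norm (f x))\<^sup>2)\<bar>
        = norm (LINT x|lborel. \<rho> x * (norm (F n x))\<^sup>2 - \<rho> x * (norm (f x))\<^sup>2)"
      using int[OF F[of n]] int[OF f] by simp
    also have "\<dots> \<le> (LINT x|lborel. norm (\<rho> x * (norm (F n x))\<^sup>2 - \<rho> x * (norm (f x))\<^sup>2))"
      by (rule integral_norm_bound)
    also have "\<dots> \<le> (LINT x|lborel. C * ((1 + 1 / t) * (norm (F n x - f x))\<^sup>2 + t * (norm (f x))\<^sup>2))"
    proof (rule integral_mono)
      show "integrable lborel (\<lambda>x. norm (\<rho> x * (norm (F n x))\<^sup>2 - \<rho> x * (norm (f x))\<^sup>2))"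
        using int[OF F[of n]] int[OF f] by simp
      show "integrable lborel (\<lambda>x. C * ((1 + 1 / t) * (norm (F n x - f x))\<^sup>2 + t * (norm (f x))\<^sup>2))"
        using l2_integrable[OF l2_diff[OF F[of n] f]] l2_integrable[OF f] by simp
      fix x
      define u where "u = F n x - f x"
      have Fu: "F n x = u + f x" by (simp add: u_def)
      have "2 * \<bar>u \<bullet> f x\<bar> \<le> 1 / t * (norm u)\<^sup>2 + t * (norm (f x))\<^sup>2"
      proof -
        have "0 \<le> 1 / t * (norm u - t * norm (f x))\<^sup>2" using t by simp
        also have "\<dots> = 1 / t * (norm u)\<^sup>2 + t * (norm (f x))\<^sup>2 - 2 * (norm u * norm (f x))"
          using t by (simp add: field_simps power2_eq_square)
        finally show ?thesis using Cauchy_Schwarz_ineq2[of u "f x"] by simp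
      qed
      then have "\<bar>(norm (F n x))\<^sup>2 - (norm (f x))\<^sup>2\<bar> \<le> (1 + 1 / t) * (norm u)\<^sup>2 + t * (norm (f x))\<^sup>2"
        unfolding Fu
        by (simp add: power2_norm_eq_inner inner_simps inner_commute algebra_simps)
           (use inner_ge_zero[of u] in linarith)
      then have "\<bar>\<rho> x\<bar> * \<bar>(norm (F n x))\<^sup>2 - (norm (f x))\<^sup>2\<bar> \<le> C * ((1 + 1 / t) * (norm u)\<^sup>2 + t * (norm (f x))\<^sup>2)"
        using \<rho>(2) C by (intro mult_mono) auto
      then show "norm (\<rho> x * (norm (F n x))\<^sup>2 - \<rho> x * (norm (f x))\<^sup>2) \<le> C * ((1 + 1 / t) * (norm (F n x - f x))\<^sup>2 + t * (norm (f x))\<^sup>2)"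
        by (simp add: u_def abs_mult[symmetric] right_diff_distrib)
    qed
    also have "\<dots> = C * ((1 + 1 / t) * a n + t * b)"
      using l2_integrable[OF l2_diff[OF F[of n] f]] l2_integrable[OF f] by (simp add: a_def b_def)
    finally show ?thesis .
  qed
  show ?thesis
  proof (rule LIMSEQ_I)
    fix r :: real assume r: "r > 0"
    \<comment> \<open>The summand 1 keeps the denominator positive when \<open>C * b = 0\<close>;
      the choice gives \<open>C * t * b < r / 2\<close>.\<close>
    define t where "t = r / (2 * (C * b + 1))"
    have Cb: "C * b \<ge> 0" using C b by simp
    have t: "t > 0" using r Cb by (simp add: t_def)
    have tb: "C * (t * b) < r / 2"
    proof -
      have "C * (t * b) = t * (C * b)" by simp
      also have "\<dots> < t * (C * b + 1)" using t by simp
      also have "\<dots> = r / 2" using Cb by (simp add: t_def field_simps)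
      finally show ?thesis by simp
    qed
    have "(\<lambda>n. C * ((1 + 1 / t) * a n)) \<longlonglongrightarrow> C * ((1 + 1 / t) * 0)"
      using lim by (intro tendsto_intros) (simp add: a_def)
    then have "\<forall>\<^sub>F n in sequentially. C * ((1 + 1 / t) * a n) < r / 2"
      by (rule order_tendstoD(2)) (use r in simp)
    then obtain N where N: "\<And>n. n \<ge> N \<Longrightarrow> C * ((1 + 1 / t) * a n) < r / 2"
      by (auto simp: eventually_sequentially)
    have "norm ((LINT x|lborel. \<rho> x * (norm (F n x))\<^sup>2) - (LINT x|lborel. \<rho> x * (norm (f x))\<^sup>2)) < r" if "n \<ge> N" for n
      using key[OF t, of n] N[OF that] tb distrib_left[of C "(1 + 1 / t) * a n" "t * b"]
      unfolding real_norm_def by linarith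
    then show "\<exists>no. \<forall>n\<ge>no. norm ((LINT x|lborel. \<rho> x * (norm (F n x))\<^sup>2) - (LINT x|lborel. \<rho> x * (norm (f x))\<^sup>2)) < r"
      by blast
  qed
qed

lemma l2_translate: "l2 f \<Longrightarrow> l2 (\<lambda>x. f (x + z))"
  unfolding l2_def using integrable_translate[of "\<lambda>x. (norm (f x))\<^sup>2" z] by auto

text \<open>Truncating the values of \<open>f\<close> makes it bounded. Measurability then supplies
  continuous functions converging almost everywhere; clipping their values and cutting them off in
  space provides an integrable bound, so they also converge in mean square.\<close>

lemma l2_approx_continuous:
  fixes f :: "'a::euclidean_space \<Rightarrow> 'b::euclidean_space"
  assumes f: "l2 f" and supp: "\<And>x. norm x \<ge> R \<Longrightarrow> f x = 0" and e: "e > 0"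
  obtains h C where "continuous_on UNIV h" "\<And>x. norm (h x) \<le> C" "\<And>x. norm x \<ge> R + 1 \<Longrightarrow> h x = 0"
    "l2 h" "(LINT x|lborel. (norm (f x - h x))\<^sup>2) < e"
proof -
  define T where "T N x = (if norm (f x) \<le> real N then f x else 0)" for N x
  have fm [measurable]: "f \<in> borel_measurable borel" by (rule l2_measurable[OF f])
  have Tm: "T N \<in> borel_measurable borel" for N
    unfolding T_def by measurable
  have TN: "norm (T N x) \<le> real N" for N x by (simp add: T_def)
  have "(\<lambda>N. LINT x|lborel. (norm (f x - T N x))\<^sup>2) \<longlonglongrightarrow> (LINT x::'a|lborel. 0)"
  proof (rule integral_dominated_convergence[OF _ _ l2_integrable[OF f]])
    show "(\<lambda>x. (norm (f x - T N x))\<^sup>2) \<in> borel_measurable lborel" for N using Tm[of N] by simp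
    show "AE x in lborel. (\<lambda>N. (norm (f x - T N x))\<^sup>2) \<longlonglongrightarrow> 0"
    proof (rule AE_I2)
      fix x
      have "\<forall>\<^sub>F N in sequentially. (norm (f x - T N x))\<^sup>2 = 0"
        using eventually_ge_at_top[of "nat \<lceil>norm (f x)\<rceil>"]
        by eventually_elim (auto simp: T_def)
      then show "(\<lambda>N. (norm (f x - T N x))\<^sup>2) \<longlonglongrightarrow> 0"
        by (rule tendsto_eventually)
    qed
    show "AE x in lborel. norm ((norm (f x - T N x))\<^sup>2) \<le> (norm (f x))\<^sup>2" for N
      by (rule AE_I2) (simp add: T_def)
  qed simp
  then have "\<forall>\<^sub>F N in sequentially. (LINT x|lborel. (norm (f x - T N x))\<^sup>2) < e / 4"
    by (rule order_tendstoD(2)) (use e in simp)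
  then obtain N where N: "(LINT x|lborel. (norm (f x - T N x))\<^sup>2) < e / 4"
    by (auto simp: eventually_sequentially)
  have "T N measurable_on UNIV"
    by (rule lebesgue_measurable_imp_measurable_on) (use Tm[of N] in \<open>auto intro: measurable_completion\<close>)
  then obtain Z g where Z: "negligible Z" and g: "\<And>n. continuous_on UNIV (g n)"
      "\<And>x. x \<notin> Z \<Longrightarrow> (\<lambda>n. g n x) \<longlonglongrightarrow> T N x"
    by (auto simp: measurable_on_def)
  define B :: "'b set" where "B = cball 0 (real N)"
  have B: "convex B" "closed B" "B \<noteq> {}" by (auto simp: B_def)
  \<comment> \<open>A continuous cutoff equal to 1 where \<open>f\<close> lives, so it does not
    alter the limit.\<close>
  define \<theta> where "\<theta> x = max 0 (min 1 (R + 1 - norm x))" for x :: 'a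
  define h where "h n x = \<theta> x *\<^sub>R closest_point B (g n x)" for n x
  have \<theta>: "0 \<le> \<theta> x" "\<theta> x \<le> 1" for x by (auto simp: \<theta>_def)
  have clip: "norm (closest_point B y) \<le> real N" for y
    using closest_point_in_set[OF B(2,3), of y] by (simp add: B_def)
  have h_le: "norm (h n x) \<le> real N" for n x
    using mult_mono[OF \<theta>(2)[of x] clip[of "g n x"]] \<theta>[of x] by (simp add: h_def)
  have h_cont: "continuous_on UNIV (h n)" for n
    unfolding h_def \<theta>_def
    by (intro continuous_intros continuous_on_compose2[OF continuous_on_closest_point[OF B, of UNIV]] g) auto
  have h0: "h n x = 0" if "norm x \<ge> R + 1" for n x using that by (simp add: h_def \<theta>_def)
  have h_m: "h n \<in> borel_measurable borel" for n
    by (rule borel_measurable_continuous_onI[OF h_cont])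
  have ball: "integrable lborel (\<lambda>x::'a. indicator (cball 0 (R + 1)) x *\<^sub>R ((2 * real N)\<^sup>2))"
    by (intro borel_integrable_compact) auto
  have T_h: "(norm (T N x - h n x))\<^sup>2 \<le> indicator (cball 0 (R + 1)) x *\<^sub>R ((2 * real N)\<^sup>2)" for n x
  proof (cases "norm x \<le> R + 1")
    case True
    have "norm (T N x - h n x) \<le> 2 * real N"
      using norm_triangle_ineq4[of "T N x" "h n x"] TN[of N x] h_le[of n x] by simp
    from power_mono[OF this, of 2] show ?thesis using True by simp
  next
    case False
    then show ?thesis using supp[of x] h0[of x n] by (simp add: T_def)
  qed
  have "(\<lambda>n. LINT x|lborel. (norm (T N x - h n x))\<^sup>2) \<longlonglongrightarrow> (LINT x::'a|lborel. 0)"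
  proof (rule integral_dominated_convergence[OF _ _ ball])
    show "(\<lambda>x. (norm (T N x - h n x))\<^sup>2) \<in> borel_measurable lborel" for n using Tm[of N] h_m[of n] by simp
    have "AE x in lebesgue. x \<notin> Z" using Z by (simp add: negligible_iff_null_sets AE_not_in)
    then have "AE x in lborel. x \<notin> Z" by (simp add: AE_completion_iff)
    then show "AE x in lborel. (\<lambda>n. (norm (T N x - h n x))\<^sup>2) \<longlonglongrightarrow> 0"
    proof eventually_elim
      case (elim x)
      have "(\<lambda>n. closest_point B (g n x)) \<longlonglongrightarrow> closest_point B (T N x)"
        by (rule continuous_on_tendsto_compose[OF continuous_on_closest_point[OF B, of UNIV] g(2)[OF elim]]) auto
      moreover have "closest_point B (T N x) = T N x"
        using TN[of N x] by (intro closest_point_self) (simp add: B_def)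
      ultimately have "(\<lambda>n. h n x) \<longlonglongrightarrow> \<theta> x *\<^sub>R T N x"
        unfolding h_def by (intro tendsto_intros) simp
      moreover have "\<theta> x *\<^sub>R T N x = T N x"
        using supp[of x] by (cases "norm x \<ge> R") (auto simp: \<theta>_def T_def)
      ultimately have "(\<lambda>n. (norm (T N x - h n x))\<^sup>2) \<longlonglongrightarrow> (norm (T N x - T N x))\<^sup>2"
        by (intro tendsto_intros) simp
      then show ?case by simp
    qed
    show "AE x in lborel. norm ((norm (T N x - h n x))\<^sup>2) \<le> indicator (cball 0 (R + 1)) x *\<^sub>R (2 * real N)\<^sup>2" for n
      using T_h by (intro AE_I2) simp
  qed simp
  then have "\<forall>\<^sub>F n in sequentially. (LINT x|lborel. (norm (T N x - h n x))\<^sup>2) < e / 4"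
    by (rule order_tendstoD(2)) (use e in simp)
  then obtain n where n: "(LINT x|lborel. (norm (T N x - h n x))\<^sup>2) < e / 4"
    by (auto simp: eventually_sequentially)
  have l2T: "l2 (T N)" by (rule l2_bound[OF l2_integrable[OF f] Tm]) (simp add: T_def)
  have l2Th: "l2 (\<lambda>x. T N x - h n x)"
    by (rule l2_bound[OF ball _ T_h]) (use Tm h_m in auto)
  have l2h: "l2 (h n)" using l2_diff[OF l2T l2Th] by simp
  have "(LINT x|lborel. (norm (f x - h n x))\<^sup>2) \<le> (LINT x|lborel. 2 * (norm (f x - T N x))\<^sup>2 + 2 * (norm (T N x - h n x))\<^sup>2)"
  proof (rule integral_mono)
    show "(norm (f x - h n x))\<^sup>2 \<le> 2 * (norm (f x - T N x))\<^sup>2 + 2 * (norm (T N x - h n x))\<^sup>2" for x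
      using norm_add_sq_le[of "f x - T N x" "T N x - h n x"] by simp
  qed (use l2_integrable[OF l2_diff[OF f l2h]] l2_integrable[OF l2_diff[OF f l2T]] l2_integrable[OF l2Th] in auto)
  also have "\<dots> < e"
    using l2_integrable[OF l2_diff[OF f l2T]] l2_integrable[OF l2Th] N n by simp
  finally show ?thesis using that[OF h_cont h_le h0 l2h] by blast
qed

lemma l2_translation_continuous:
  fixes f :: "'a::euclidean_space \<Rightarrow> 'b::euclidean_space"
  assumes f: "l2 f" and supp: "\<And>x. norm x \<ge> R \<Longrightarrow> f x = 0" and e: "e > 0"
  obtains \<delta> where "\<delta> > 0" "\<And>z. norm z < \<delta> \<Longrightarrow> (LINT x|lborel. (norm (f (x + z) - f x))\<^sup>2) < e"
proof -
  \<comment> \<open>The final estimate weights the errors by 2, 4 and 4, and ten twelfths are below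
    1.\<close>
  obtain h C where h: "continuous_on UNIV h" "\<And>x. norm (h x) \<le> C" "\<And>x. norm x \<ge> R + 1 \<Longrightarrow> h x = 0"
    "l2 h" "(LINT x|lborel. (norm (f x - h x))\<^sup>2) < e / 12"
    using l2_approx_continuous[OF f supp, of R "e / 12"] e by auto
  have hm: "h \<in> borel_measurable borel" by (rule l2_measurable[OF h(4)])
  have ball: "integrable lborel (\<lambda>x::'a. indicator (cball 0 (R + 2)) x *\<^sub>R ((2 * C)\<^sup>2))"
    by (intro borel_integrable_compact) auto
  have C0: "C \<ge> 0" using h(2)[of 0] norm_ge_zero[of "h 0"] by linarith
  have hb: "(norm (h (x + z) - h x))\<^sup>2 \<le> indicator (cball 0 (R + 2)) x *\<^sub>R ((2 * C)\<^sup>2)" if "norm z < 1" for x z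
  proof (cases "norm x \<le> R + 2")
    case True
    have "norm (h (x + z) - h x) \<le> 2 * C"
      using norm_triangle_ineq4[of "h (x + z)" "h x"] h(2)[of x] h(2)[of "x + z"] by simp
    from power_mono[OF this, of 2] show ?thesis using True by simp
  next
    case False
    moreover have "norm x \<le> norm (x + z) + norm z" using norm_triangle_ineq4[of "x + z" z] by simp
    ultimately show ?thesis using h(3)[of x] h(3)[of "x + z"] that by simp
  qed
  have "((\<lambda>z. LINT x|lborel. (norm (h (x + z) - h x))\<^sup>2) \<longlongrightarrow> 0) (at 0)"
    unfolding tendsto_at_iff_sequentially comp_def
  proof (intro allI impI)
    fix Z :: "nat \<Rightarrow> 'a" assume Z: "\<forall>i. Z i \<in> UNIV - {0}" "Z \<longlonglongrightarrow> 0"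
    from Z(2) have "\<forall>\<^sub>F n in sequentially. norm (Z n) < 1"
      using order_tendstoD(2)[OF tendsto_norm[OF Z(2)], of 1] by simp
    then obtain n0 where n0: "\<And>n. n \<ge> n0 \<Longrightarrow> norm (Z n) < 1" by (auto simp: eventually_sequentially)
    \<comment> \<open>The dominating function serves only shifts shorter than 1, so the sequence
      starts at \<open>n0\<close>.\<close>
    have "(\<lambda>n. LINT x|lborel. (norm (h (x + Z (n + n0)) - h x))\<^sup>2) \<longlonglongrightarrow> (LINT x::'a|lborel. 0)"
    proof (rule integral_dominated_convergence[OF _ _ ball])
      show "(\<lambda>x. (norm (h (x + Z (n + n0)) - h x))\<^sup>2) \<in> borel_measurable lborel" for n using hm by simp
      show "AE x in lborel. (\<lambda>n. (norm (h (x + Z (n + n0)) - h x))\<^sup>2) \<longlonglongrightarrow> 0"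
      proof (rule AE_I2)
        fix x
        have "(\<lambda>n. x + Z (n + n0)) \<longlonglongrightarrow> x + 0"
          by (intro tendsto_intros LIMSEQ_ignore_initial_segment Z)
        then have "(\<lambda>n. h (x + Z (n + n0))) \<longlonglongrightarrow> h x"
          using continuous_on_tendsto_compose[OF h(1), of _ x] by simp
        then have "(\<lambda>n. (norm (h (x + Z (n + n0)) - h x))\<^sup>2) \<longlonglongrightarrow> (norm (h x - h x))\<^sup>2"
          by (intro tendsto_intros)
        then show "(\<lambda>n. (norm (h (x + Z (n + n0)) - h x))\<^sup>2) \<longlonglongrightarrow> 0" by simp
      qed
      show "AE x in lborel. norm ((norm (h (x + Z (n + n0)) - h x))\<^sup>2) \<le> indicator (cball 0 (R + 2)) x *\<^sub>R (2 * C)\<^sup>2" for n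
        using hb n0[of "n + n0"] by (intro AE_I2) simp
    qed simp
    then show "(\<lambda>n. LINT x|lborel. (norm (h (x + Z n) - h x))\<^sup>2) \<longlonglongrightarrow> 0"
      using LIMSEQ_offset[of "\<lambda>n. LINT x|lborel. (norm (h (x + Z n) - h x))\<^sup>2" n0] by simp
  qed
  then have "\<forall>\<^sub>F z in at 0. (LINT x|lborel. (norm (h (x + z) - h x))\<^sup>2) < e / 12"
    by (rule order_tendstoD(2)) (use e in simp)
  then obtain \<delta> where \<delta>: "\<delta> > 0" "\<And>z. z \<noteq> 0 \<Longrightarrow> norm z < \<delta> \<Longrightarrow> (LINT x|lborel. (norm (h (x + z) - h x))\<^sup>2) < e / 12"
    by (auto simp: eventually_at)
  have "(LINT x|lborel. (norm (f (x + z) - f x))\<^sup>2) < e" if z: "norm z < \<delta>" for z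
  proof -
    have hz: "(LINT x|lborel. (norm (h (x + z) - h x))\<^sup>2) < e / 12"
      using \<delta>(2)[OF _ z] e by (cases "z = 0") auto
    note i1 = l2_integrable[OF l2_translate[OF l2_diff[OF f h(4)]], of z]
    note i2 = l2_integrable[OF l2_diff[OF l2_translate[OF h(4)] h(4)], of z]
    note i3 = l2_integrable[OF l2_diff[OF f h(4)]]
    have "(LINT x|lborel. (norm (f (x + z) - f x))\<^sup>2) \<le> (LINT x|lborel. 2 * (norm (f (x + z) - h (x + z)))\<^sup>2
        + 4 * (norm (h (x + z) - h x))\<^sup>2 + 4 * (norm (f x - h x))\<^sup>2)"
    proof (rule integral_mono)
      show "integrable lborel (\<lambda>x. (norm (f (x + z) - f x))\<^sup>2)"
        by (rule l2_integrable[OF l2_diff[OF l2_translate[OF f] f]])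
      show "(norm (f (x + z) - f x))\<^sup>2 \<le> 2 * (norm (f (x + z) - h (x + z)))\<^sup>2
        + 4 * (norm (h (x + z) - h x))\<^sup>2 + 4 * (norm (f x - h x))\<^sup>2" for x
        using norm_add_sq_le[of "f (x + z) - h (x + z)" "h (x + z) - f x"]
          norm_diff_sq_le[of "h (x + z) - h x" "f x - h x"] by simp
    qed (use i1 i2 i3 in auto)
    also have "\<dots> = 2 * (LINT x|lborel. (norm (f (x + z) - h (x + z)))\<^sup>2)
        + 4 * (LINT x|lborel. (norm (h (x + z) - h x))\<^sup>2) + 4 * (LINT x|lborel. (norm (f x - h x))\<^sup>2)"
      using i1 i2 i3 by simp
    also have "(LINT x|lborel. (norm (f (x + z) - h (x + z)))\<^sup>2) = (LINT x|lborel. (norm (f x - h x))\<^sup>2)"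
      using integral_translate[of "\<lambda>x. (norm (f x - h x))\<^sup>2" z] l2_measurable[OF f] hm by simp
    finally show ?thesis using hz h(5) e by linarith
  qed
  with \<delta>(1) show ?thesis using that by blast
qed

subsection \<open>Approximation by polynomials with Landau kernels\<close>

lemma two_inner_le: "2 * (a \<bullet> b) \<le> (norm a)\<^sup>2 + (norm (b :: 'b::real_inner))\<^sup>2"
proof -
  have "0 \<le> (a - b) \<bullet> (a - b)" by simp
  then show ?thesis by (simp add: power2_norm_eq_inner inner_simps inner_commute)
qed

definition landau_kernel :: "real \<Rightarrow> nat \<Rightarrow> 'a::real_inner \<Rightarrow> real" where
  "landau_kernel d n z = (1 - d * (norm z)\<^sup>2) ^ n"

text \<open>The factor \<open>b\<close> makes the induction on the degree \<open>n\<close> of the kernel go through.\<close>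

definition landau :: "real \<Rightarrow> nat \<Rightarrow> ('a::euclidean_space \<Rightarrow> real) \<Rightarrow> ('a \<Rightarrow> 'b::euclidean_space) \<Rightarrow> 'a \<Rightarrow> 'b" where
  "landau d n b f x = (LINT y|lborel. (landau_kernel d n (x - y) * b y) *\<^sub>R f y)"

text \<open>The convolution with the derivative of the kernel in \<open>x\<close>. For
  \<open>n = 0\<close> the factor \<open>real n\<close> makes the truncated exponent
  harmless.\<close>

definition landau_pd :: "real \<Rightarrow> nat \<Rightarrow> 'n \<Rightarrow> (real^'n::finite \<Rightarrow> real) \<Rightarrow> (real^'n \<Rightarrow> 'b::euclidean_space) \<Rightarrow> real^'n \<Rightarrow> 'b" where
  "landau_pd d n k b f x
    = (LINT y|lborel. (real n * landau_kernel d (n - 1) (x - y) * (- 2 * d * (x - y) $ k) * b y) *\<^sub>R f y)"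

lemma landau_kernel_continuous: "continuous_on UNIV (landau_kernel d n)"
  unfolding landau_kernel_def by (intro continuous_intros)

text \<open>One factor of the kernel is \<open>(1 - d|y|^2) - d|x|^2 + 2 d (x.y)\<close>. Its
  \<open>y\<close>-parts are absorbed into \<open>b\<close>, its \<open>x\<close>-parts leave the
  integral as polynomials, and the degree drops by one. Carrying the derivative formula through the
  same induction justifies differentiation under the integral.\<close>

lemma vpoly_landau:
  fixes f :: "real^'n::finite \<Rightarrow> 'b::euclidean_space"
  assumes f: "l2 f" "\<And>x. norm x \<ge> R \<Longrightarrow> f x = 0"
  shows "continuous_on UNIV b \<Longrightarrow> vpoly (landau d n b f) \<and> (\<forall>k x. pd k (landau d n b f) x = landau_pd d n k b f x)"
proof (induction n arbitrary: b)
  case 0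
  have "landau d 0 b f = (\<lambda>x. LINT y|lborel. b y *\<^sub>R f y)"
    by (simp add: fun_eq_iff landau_def landau_kernel_def)
  then show ?case by (simp add: vpoly_const landau_pd_def)
next
  case (Suc n)
  note b = Suc.prems
  define b1 where "b1 y = (1 - d * (norm y)\<^sup>2) * b y" for y
  define b2 where "b2 y = - d * b y" for y
  define b3 where "b3 j y = 2 * d * y $ j * b y" for j y
  have c: "continuous_on UNIV b1" "continuous_on UNIV b2" "continuous_on UNIV (b3 j)" for j
    unfolding b1_def b2_def b3_def by (intro continuous_intros b)+
  note IH = Suc.IH[OF c(1)] Suc.IH[OF c(2)] Suc.IH[OF c(3)]
  have kc: "continuous_on UNIV (\<lambda>y. landau_kernel d m (x - y))" for m and x :: "real^'n"
    by (rule continuous_on_compose2[OF landau_kernel_continuous]) (auto intro!: continuous_intros)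
  have int: "integrable lborel (\<lambda>y. (landau_kernel d n (x - y) * g y) *\<^sub>R f y)" if "continuous_on UNIV g" for x g
    by (rule l2_integrable_scaleR[of f R, OF f], assumption) (intro continuous_intros kc that)
  have intd: "integrable lborel (\<lambda>y. (real n * landau_kernel d (n - 1) (x - y) * (- 2 * d * (x - y) $ k) * g y) *\<^sub>R f y)"
    if "continuous_on UNIV g" for x g k
    by (rule l2_integrable_scaleR[of f R, OF f], assumption) (intro continuous_intros kc that)
  have nrm: "1 - d * (norm (x - y))\<^sup>2 = (1 - d * (norm y)\<^sup>2) - d * (norm x)\<^sup>2 + (\<Sum>j\<in>UNIV. 2 * d * (x $ j * y $ j))" for x y :: "real^'n"
    unfolding sum_distrib_left[symmetric] power2_norm_eq_inner
    by (simp add: inner_simps inner_commute inner_vec_def[of x y] algebra_simps)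
  have eq: "landau d (Suc n) b f x = landau d n b1 f x + (norm x)\<^sup>2 *\<^sub>R landau d n b2 f x
      + (\<Sum>j\<in>UNIV. x $ j *\<^sub>R landau d n (b3 j) f x)" for x
  proof -
    have "landau_kernel d (Suc n) (x - y) * b y = landau_kernel d n (x - y) * b1 y + (norm x)\<^sup>2 * (landau_kernel d n (x - y) * b2 y)
       + (\<Sum>j\<in>UNIV. x $ j * (landau_kernel d n (x - y) * b3 j y))" for y
    proof -
      have *: "landau_kernel d (Suc n) (x - y) = ((1 - d * (norm y)\<^sup>2) - d * (norm x)\<^sup>2
          + (\<Sum>j\<in>UNIV. 2 * d * (x $ j * y $ j))) * landau_kernel d n (x - y)" for y
        unfolding nrm[symmetric] by (simp add: landau_kernel_def)
      show ?thesis
        unfolding *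
        by (simp add: b1_def b2_def b3_def sum_distrib_left sum_distrib_right algebra_simps)
    qed
    then have "landau d (Suc n) b f x = (LINT y|lborel. (landau_kernel d n (x - y) * b1 y) *\<^sub>R f y
       + (norm x)\<^sup>2 *\<^sub>R ((landau_kernel d n (x - y) * b2 y) *\<^sub>R f y)
       + (\<Sum>j\<in>UNIV. x $ j *\<^sub>R ((landau_kernel d n (x - y) * b3 j y) *\<^sub>R f y)))"
      by (simp add: landau_def scaleR_left_distrib scaleR_sum_left)
    also have "\<dots> = landau d n b1 f x + (norm x)\<^sup>2 *\<^sub>R landau d n b2 f x + (\<Sum>j\<in>UNIV. x $ j *\<^sub>R landau d n (b3 j) f x)"
      using int[OF c(1), of x] int[OF c(2), of x] int[OF c(3), of x] by (simp add: landau_def del: scaleR_scaleR)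
    finally show ?thesis .
  qed
  have v: "vpoly (\<lambda>x. (norm x)\<^sup>2 *\<^sub>R landau d n b2 f x)" "vpoly (\<lambda>x. x $ j *\<^sub>R landau d n (b3 j) f x)" 
    "vpoly (\<lambda>x. \<Sum>j\<in>UNIV. x $ j *\<^sub>R landau d n (b3 j) f x)" for j
    using IH by (auto intro!: vpoly_scaleR_norm_sq vpoly_times vpoly_sum)
  have "vpoly (landau d (Suc n) b f)"
    unfolding eq[abs_def] using IH v by (intro vpoly_add) auto
  moreover have "pd k (landau d (Suc n) b f) x = landau_pd d (Suc n) k b f x" for k x
  proof -
    have "pd k (landau d (Suc n) b f) x = landau_pd d n k b1 f x + ((norm x)\<^sup>2 *\<^sub>R landau_pd d n k b2 f x + (2 * x $ k) *\<^sub>R landau d n b2 f x)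
       + ((\<Sum>j\<in>UNIV. x $ j *\<^sub>R landau_pd d n k (b3 j) f x) + landau d n (b3 k) f x)"
      unfolding eq[abs_def] using IH v
      by (simp add: pd_add pd_sum vpoly_differentiable vpoly_add pd_norm_sq_scaleR pd_nth_scaleR sum.distrib)
    also have "\<dots> = (LINT y|lborel. (real n * landau_kernel d (n - 1) (x - y) * (- 2 * d * (x - y) $ k) * b1 y) *\<^sub>R f y
      + ((norm x)\<^sup>2 *\<^sub>R ((real n * landau_kernel d (n - 1) (x - y) * (- 2 * d * (x - y) $ k) * b2 y) *\<^sub>R f y)
        + (2 * x $ k) *\<^sub>R ((landau_kernel d n (x - y) * b2 y) *\<^sub>R f y))
      + ((\<Sum>j\<in>UNIV. x $ j *\<^sub>R ((real n * landau_kernel d (n - 1) (x - y) * (- 2 * d * (x - y) $ k) * b3 j y) *\<^sub>R f y))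
        + (landau_kernel d n (x - y) * b3 k y) *\<^sub>R f y))"
      unfolding landau_def landau_pd_def
      using int[OF c(2), of x] int[OF c(3), of x] intd[OF c(1), of x k] intd[OF c(2), of x k] intd[OF c(3), of x k]
      by (simp del: scaleR_scaleR)
    also have "\<dots> = landau_pd d (Suc n) k b f x"
      unfolding landau_pd_def
    proof (rule Bochner_Integration.integral_cong[OF refl])
      fix y
      define \<kappa> where "\<kappa> = 1 - d * (norm (x - y))\<^sup>2"
      define A where "A = real n * \<kappa> ^ (n - 1) * (- 2 * d * (x - y) $ k)"
      have "A * b1 y + ((norm x)\<^sup>2 * (A * b2 y) + 2 * x $ k * (\<kappa> ^ n * b2 y))
          + ((\<Sum>j\<in>UNIV. x $ j * (A * b3 j y)) + \<kappa> ^ n * b3 k y)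
        = (A * ((1 - d * (norm y)\<^sup>2) - d * (norm x)\<^sup>2 + (\<Sum>j\<in>UNIV. 2 * d * (x $ j * y $ j))) + \<kappa> ^ n * (- 2 * d * (x - y) $ k)) * b y"
        by (simp add: b1_def b2_def b3_def sum_distrib_left sum_distrib_right algebra_simps)
      also have "\<dots> = (A * \<kappa> + \<kappa> ^ n * (- 2 * d * (x - y) $ k)) * b y"
        by (simp only: nrm[symmetric] \<kappa>_def)
      also have "A * \<kappa> = real n * \<kappa> ^ n * (- 2 * d * (x - y) $ k)"
        by (cases n) (simp_all add: A_def)
      finally have e: "A * b1 y + ((norm x)\<^sup>2 * (A * b2 y) + 2 * x $ k * (\<kappa> ^ n * b2 y))
          + ((\<Sum>j\<in>UNIV. x $ j * (A * b3 j y)) + \<kappa> ^ n * b3 k y)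
        = real (Suc n) * \<kappa> ^ n * (- 2 * d * (x - y) $ k) * b y"
        by (simp add: algebra_simps)
      show "(real n * landau_kernel d (n - 1) (x - y) * (- 2 * d * (x - y) $ k) * b1 y) *\<^sub>R f y
      + ((norm x)\<^sup>2 *\<^sub>R ((real n * landau_kernel d (n - 1) (x - y) * (- 2 * d * (x - y) $ k) * b2 y) *\<^sub>R f y)
        + (2 * x $ k) *\<^sub>R ((landau_kernel d n (x - y) * b2 y) *\<^sub>R f y))
      + ((\<Sum>j\<in>UNIV. x $ j *\<^sub>R ((real n * landau_kernel d (n - 1) (x - y) * (- 2 * d * (x - y) $ k) * b3 j y) *\<^sub>R f y))
        + (landau_kernel d n (x - y) * b3 k y) *\<^sub>R f y)
      = (real (Suc n) * landau_kernel d (Suc n - 1) (x - y) * (- 2 * d * (x - y) $ k) * b y) *\<^sub>R f y"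
        using arg_cong[OF e, of "\<lambda>t. t *\<^sub>R f y"]
        unfolding landau_kernel_def \<kappa>_def[symmetric] A_def[symmetric] diff_Suc_1
        by (simp only: scaleR_left_distrib scaleR_sum_left scaleR_scaleR)
    qed
    finally show ?thesis .
  qed
  ultimately show ?case by blast
qed

text \<open>Off the ball of radius \<open>\<delta>\<close> the kernel is at most
  \<open>\<alpha>^n\<close>, while on the ball of half that radius it is at least
  \<open>\<beta>^n\<close> with \<open>\<alpha> < \<beta>\<close>. The share of mass far from 0
  therefore decays geometrically.\<close>

lemma landau_concentration:
  assumes R: "R > 0" and \<delta>: "0 < \<delta>" "\<delta> \<le> R"
  defines "k \<equiv> \<lambda>n (z :: 'a::euclidean_space). indicator (cball 0 R) z * landau_kernel (1 / R\<^sup>2) n z"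
  shows "integrable lborel (k n)" "(LINT z|lborel. k n z) > 0"
    "(\<lambda>n. (LINT z|lborel. indicator (- ball 0 \<delta>) z * k n z) / (LINT z|lborel. k n z)) \<longlonglongrightarrow> 0"
proof -
  let ?d = "1 / R\<^sup>2"
  have int: "integrable lborel (k n)" for n
    unfolding k_def
    using borel_integrable_compact[OF compact_cball continuous_on_subset[OF landau_kernel_continuous subset_UNIV],
      of "0::'a" R ?d n] by simp
  then show "integrable lborel (k n)" .
  have base: "0 \<le> 1 - ?d * (norm z)\<^sup>2" if "norm z \<le> R" for z :: 'a
    using power_mono[OF that, of 2] R by (simp add: field_simps)
  have k0: "k n z \<ge> 0" for n z
    using base[of z] by (auto simp: k_def landau_kernel_def indicator_def)
  define \<alpha> where "\<alpha> = 1 - ?d * \<delta>\<^sup>2"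
  define \<beta> where "\<beta> = 1 - ?d * (\<delta> / 2)\<^sup>2"
  have \<alpha>: "0 \<le> \<alpha>" using power_mono[OF \<delta>(2), of 2] R \<delta>(1) by (simp add: \<alpha>_def field_simps)
  have \<alpha>\<beta>: "\<alpha> < \<beta>" using \<delta> R by (simp add: \<alpha>_def \<beta>_def field_simps)
  define v where "v = measure lborel (cball (0::'a) (\<delta> / 2))"
  define V where "V = measure lborel (cball (0::'a) R)"
  have v: "v > 0" using content_cball_pos[of "\<delta> / 2" "0::'a"] \<delta> by (simp add: v_def)
  have lower: "\<beta> ^ n * v \<le> (LINT z|lborel. k n z)" for n
  proof -
    have "\<beta> ^ n * v = (LINT z|lborel. \<beta> ^ n * indicator (cball (0::'a) (\<delta> / 2)) z)"
      by (simp add: v_def)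
    also have "\<dots> \<le> (LINT z|lborel. k n z)"
    proof (rule integral_mono[OF _ int])
      show "integrable lborel (\<lambda>z. \<beta> ^ n * indicator (cball (0::'a) (\<delta> / 2)) z)"
        using emeasure_compact_finite[OF compact_cball, of "0::'a" "\<delta> / 2"]
        by (intro integrable_mult_right integrable_real_indicator) auto
      fix z :: 'a
      show "\<beta> ^ n * indicator (cball 0 (\<delta> / 2)) z \<le> k n z"
      proof (cases "norm z \<le> \<delta> / 2")
        case True
        have "\<beta> \<le> 1 - ?d * (norm z)\<^sup>2"
          unfolding \<beta>_def using power_mono[OF True, of 2] by (intro diff_left_mono mult_left_mono) auto
        then have "\<beta> ^ n \<le> landau_kernel ?d n z"
          unfolding landau_kernel_def using \<alpha> \<alpha>\<beta> by (intro power_mono) auto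
        then show ?thesis using True \<delta> by (simp add: k_def)
      qed (use k0 in simp)
    qed
    finally show ?thesis .
  qed
  have "\<beta> ^ n * v > 0" for n using \<alpha> \<alpha>\<beta> v by simp
  then show pos: "(LINT z|lborel. k n z) > 0" for n using lower[of n] by (meson less_le_trans)
  have upper: "(LINT z|lborel. indicator (- ball 0 \<delta>) z * k n z) \<le> \<alpha> ^ n * V" for n
  proof -
    have "(LINT z|lborel. indicator (- ball 0 \<delta>) z * k n z) \<le> (LINT z|lborel. \<alpha> ^ n * indicator (cball (0::'a) R) z)"
    proof (rule integral_mono)
      show "integrable lborel (\<lambda>z. indicator (- ball 0 \<delta>) z * k n z)"
        using integrable_mult_indicator[OF _ int, of "- ball 0 \<delta>" n] by simp
      show "integrable lborel (\<lambda>z. \<alpha> ^ n * indicator (cball (0::'a) R) z)"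
        using emeasure_compact_finite[OF compact_cball, of "0::'a" R]
        by (intro integrable_mult_right integrable_real_indicator) auto
      fix z :: 'a
      show "indicator (- ball 0 \<delta>) z * k n z \<le> \<alpha> ^ n * indicator (cball 0 R) z"
      proof (cases "\<delta> \<le> norm z \<and> norm z \<le> R")
        case True
        have "1 - ?d * (norm z)\<^sup>2 \<le> \<alpha>"
          unfolding \<alpha>_def using power_mono[of \<delta> "norm z" 2] True \<delta> by (intro diff_left_mono mult_left_mono) auto
        then have "landau_kernel ?d n z \<le> \<alpha> ^ n"
          unfolding landau_kernel_def using base[of z] True by (intro power_mono) auto
        then show ?thesis using True by (simp add: k_def)
      next
        case False
        then show ?thesis using \<alpha> by (auto simp: k_def indicator_def)
      qed
    qed
    then show ?thesis by (simp add: V_def)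
  qed
  have "(\<lambda>n. (\<alpha> / \<beta>) ^ n * (V / v)) \<longlonglongrightarrow> 0 * (V / v)"
    using \<alpha> \<alpha>\<beta> by (intro tendsto_intros LIMSEQ_realpow_zero) auto
  then have lim: "(\<lambda>n. (\<alpha> / \<beta>) ^ n * (V / v)) \<longlonglongrightarrow> 0" by simp
  show "(\<lambda>n. (LINT z|lborel. indicator (- ball 0 \<delta>) z * k n z) / (LINT z|lborel. k n z)) \<longlonglongrightarrow> 0"
  proof (rule tendsto_sandwich[OF _ _ tendsto_const lim]; rule always_eventually; rule allI)
    fix n
    show "0 \<le> (LINT z|lborel. indicator (- ball 0 \<delta>) z * k n z) / (LINT z|lborel. k n z)"
      using pos[of n] k0 by (intro divide_nonneg_pos integral_nonneg_AE AE_I2) auto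
    have "(LINT z|lborel. indicator (- ball 0 \<delta>) z * k n z) / (LINT z|lborel. k n z) \<le> (\<alpha> ^ n * V) / (\<beta> ^ n * v)"
      using upper[of n] lower[of n] \<alpha> \<alpha>\<beta> v by (intro frac_le) (auto simp: V_def)
    then show "(LINT z|lborel. indicator (- ball 0 \<delta>) z * k n z) / (LINT z|lborel. k n z) \<le> (\<alpha> / \<beta>) ^ n * (V / v)"
      by (simp add: power_divide)
  qed
qed

text \<open>For \<open>x\<close> and \<open>y\<close> in the ball of radius \<open>R\<close> the
  difference stays in that of radius \<open>2 R\<close>, where the kernel is nonnegative. Farther
  out the polynomials grow, hence the indicator in the approximation.\<close>

lemma landau_l2:
  fixes f :: "'a::euclidean_space \<Rightarrow> 'b::euclidean_space"
  assumes f: "l2 f" and supp: "\<And>x. norm x \<ge> R \<Longrightarrow> f x = 0" and R: "R > 0"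
  defines "a \<equiv> \<lambda>n. LINT z|lborel. indicator (cball (0::'a) (2 * R)) z * landau_kernel (1 / (2 * R)\<^sup>2) n z"
  shows "(\<lambda>n. LINT x|lborel. (norm (indicator (cball 0 R) x *\<^sub>R ((1 / a n) *\<^sub>R landau (1 / (2 * R)\<^sup>2) n (\<lambda>y. 1) f x) - f x))\<^sup>2) \<longlonglongrightarrow> 0"
proof -
  let ?d = "1 / (2 * R)\<^sup>2"
  let ?r = "2 * R"
  define k where "k n z = indicator (cball 0 ?r) z * landau_kernel ?d n z / a n" for n and z :: 'a
  have fm [measurable]: "f \<in> borel_measurable borel" by (rule l2_measurable[OF f])
  have r: "?r > 0" using R by simp
  note conc = landau_concentration[OF r, where 'a='a]
  have a: "a n > 0" for n using conc(2)[of R n] R by (simp add: a_def)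
  have k_int: "integrable lborel (k n)" for n
    using conc(1)[of R n] R by (simp add: k_def[abs_def])
  have k_one: "(LINT z|lborel. k n z) = 1" for n
    using a[of n] by (simp add: k_def a_def)
  have k0: "k n z \<ge> 0" for n z
  proof (cases "norm z \<le> ?r")
    case True
    then have "0 \<le> 1 - ?d * (norm z)\<^sup>2" using power_mono[OF True, of 2] R by (simp add: field_simps)
    then show ?thesis using a[of n] True by (simp add: k_def landau_kernel_def)
  qed (simp add: k_def)
  have km [measurable]: "k n \<in> borel_measurable borel" for n
    using borel_measurable_integrable[OF k_int] by simp
  have k_bd: "k n z \<le> 1 / a n" for n z
  proof (cases "norm z \<le> ?r")
    case True
    then have "0 \<le> 1 - ?d * (norm z)\<^sup>2" "1 - ?d * (norm z)\<^sup>2 \<le> 1"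
      using power_mono[OF True, of 2] R by (auto simp: field_simps)
    then show ?thesis using a[of n] True by (simp add: k_def landau_kernel_def divide_right_mono power_le_one)
  qed (use a[of n] in \<open>simp add: k_def\<close>)
  define v where "v n x = indicator (cball 0 R) x *\<^sub>R ((1 / a n) *\<^sub>R landau ?d n (\<lambda>y. 1) f x) - f x" for n x
  \<comment> \<open>Jensen's inequality for the probability density \<open>k n\<close>. Pairing
    \<open>v n x\<close> with its own integral representation and using
    \<open>2 (a.b) <= |a|^2 + |b|^2\<close> lets one copy of \<open>|v n x|^2\<close> be
    absorbed.\<close>
  have jensen: "ennreal ((norm (v n x))\<^sup>2) \<le> (\<integral>\<^sup>+z. ennreal (k n z * (norm (f (x + z) - f x))\<^sup>2) \<partial>lborel)" for n x
  proof (cases "norm x \<le> R")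
    case False
    then show ?thesis using supp[of x] by (simp add: v_def)
  next
    case True
    have i0: "integrable lborel (\<lambda>z. k n z *\<^sub>R f (x + z))"
    proof (rule Bochner_Integration.integrable_bound)
      show "integrable lborel (\<lambda>z. (1 / a n) *\<^sub>R norm (f (z + x)))"
        using l2_integrable_scaleR[of f R "\<lambda>x. 1", OF f supp]
        by (intro integrable_scaleR_right integrable_translate[of "\<lambda>x. norm (f x)"]) auto
      show "AE z in lborel. norm (k n z *\<^sub>R f (x + z)) \<le> norm ((1 / a n) *\<^sub>R norm (f (z + x)))"
        using k0 k_bd a[of n] by (intro AE_I2) (simp add: add.commute mult_right_mono divide_right_mono flip: times_divide_eq_left)
    qed simp
    have i1: "integrable lborel (\<lambda>z. k n z *\<^sub>R f x)" using k_int by simp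
    have "landau ?d n (\<lambda>y. 1) f x = (LINT z|lborel. landau_kernel ?d n (- z) *\<^sub>R f (z + x))"
    proof -
      have "(\<lambda>y. landau_kernel ?d n (x - y) *\<^sub>R f y) \<in> borel_measurable borel"
        by (intro borel_measurable_scaleR fm borel_measurable_continuous_onI
          continuous_on_compose2[OF landau_kernel_continuous]) (auto intro!: continuous_intros)
      from integral_translate[OF this, of x] show ?thesis by (simp add: landau_def)
    qed
    \<comment> \<open>Restricting the kernel to the ball of radius \<open>2 R\<close> changes
      nothing: if \<open>z\<close> lies outside it, then \<open>x + z\<close> lies outside the
      support of \<open>f\<close>.\<close>
    also have "(LINT z|lborel. landau_kernel ?d n (- z) *\<^sub>R f (z + x)) = (LINT z|lborel. a n *\<^sub>R (k n z *\<^sub>R f (x + z)))"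
    proof (rule Bochner_Integration.integral_cong[OF refl])
      fix z
      show "landau_kernel ?d n (- z) *\<^sub>R f (z + x) = a n *\<^sub>R (k n z *\<^sub>R f (x + z))"
      proof (cases "norm z \<le> ?r")
        case True
        then show ?thesis using a[of n] by (simp add: k_def landau_kernel_def add.commute)
      next
        case False
        have "norm z \<le> norm (x + z) + norm x" using norm_triangle_ineq4[of "x + z" x] by simp
        then have "f (x + z) = 0" using False \<open>norm x \<le> R\<close> by (intro supp) auto
        then show ?thesis by (simp add: add.commute)
      qed
    qed
    also have "\<dots> = a n *\<^sub>R (LINT z|lborel. k n z *\<^sub>R f (x + z))"
      by (rule integral_scaleR_right)
    finally have "v n x = (LINT z|lborel. k n z *\<^sub>R f (x + z)) - (LINT z|lborel. k n z *\<^sub>R f x)"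
      using True a[of n] k_int[of n] by (simp add: v_def k_one)
    then have v_eq: "v n x = (LINT z|lborel. k n z *\<^sub>R (f (x + z) - f x))"
      using i0 i1 by (simp add: scaleR_right_diff_distrib)
    have i2: "integrable lborel (\<lambda>z. k n z *\<^sub>R (f (x + z) - f x))"
      using i0 i1 by (simp add: scaleR_right_diff_distrib)
    have i3: "integrable lborel (\<lambda>z. k n z * (norm (f (x + z) - f x))\<^sup>2)"
    proof (rule Bochner_Integration.integrable_bound)
      show "integrable lborel (\<lambda>z. (2 / a n) * (norm (f (z + x)))\<^sup>2 + 2 * (k n z * (norm (f x))\<^sup>2))"
        using integrable_translate[OF l2_integrable[OF f], of x] k_int
        by (intro Bochner_Integration.integrable_add integrable_mult_right) auto
      show "AE z in lborel. norm (k n z * (norm (f (x + z) - f x))\<^sup>2) \<le> norm ((2 / a n) * (norm (f (z + x)))\<^sup>2 + 2 * (k n z * (norm (f x))\<^sup>2))"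
      proof (rule AE_I2)
        fix z
        have "k n z * (norm (f (x + z) - f x))\<^sup>2 \<le> k n z * (2 * (norm (f (x + z)))\<^sup>2 + 2 * (norm (f x))\<^sup>2)"
          by (intro mult_left_mono norm_diff_sq_le k0)
        also have "\<dots> = 2 * (k n z * (norm (f (x + z)))\<^sup>2) + 2 * (k n z * (norm (f x))\<^sup>2)"
          by (simp add: algebra_simps)
        also have "\<dots> \<le> 2 * (1 / a n * (norm (f (x + z)))\<^sup>2) + 2 * (k n z * (norm (f x))\<^sup>2)"
          by (intro add_right_mono mult_left_mono mult_right_mono k_bd) auto
        finally show "norm (k n z * (norm (f (x + z) - f x))\<^sup>2) \<le> norm ((2 / a n) * (norm (f (z + x)))\<^sup>2 + 2 * (k n z * (norm (f x))\<^sup>2))"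
          using k0[of n z] a[of n] by (simp add: add.commute)
      qed
    qed simp
    have "(LINT z|lborel. v n x \<bullet> (k n z *\<^sub>R (f (x + z) - f x))) = v n x \<bullet> (LINT z|lborel. k n z *\<^sub>R (f (x + z) - f x))"
      by (rule integral_inner_right) (rule i2)
    also have "\<dots> = (norm (v n x))\<^sup>2"
      unfolding v_eq[symmetric] power2_norm_eq_inner ..
    finally have "2 * (norm (v n x))\<^sup>2 = (LINT z|lborel. 2 * (v n x \<bullet> (k n z *\<^sub>R (f (x + z) - f x))))"
      by simp
    also have "\<dots> \<le> (LINT z|lborel. k n z * (norm (v n x))\<^sup>2 + k n z * (norm (f (x + z) - f x))\<^sup>2)"
    proof (rule integral_mono)
      show "integrable lborel (\<lambda>z. 2 * (v n x \<bullet> (k n z *\<^sub>R (f (x + z) - f x))))"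
        by (intro integrable_mult_right integrable_inner_right) (use i2 in auto)
      show "integrable lborel (\<lambda>z. k n z * (norm (v n x))\<^sup>2 + k n z * (norm (f (x + z) - f x))\<^sup>2)"
        using k_int i3 by simp
      fix z
      have "2 * (v n x \<bullet> (f (x + z) - f x)) \<le> (norm (v n x))\<^sup>2 + (norm (f (x + z) - f x))\<^sup>2"
        by (rule two_inner_le)
      from mult_left_mono[OF this k0[of n z]]
      show "2 * (v n x \<bullet> (k n z *\<^sub>R (f (x + z) - f x))) \<le> k n z * (norm (v n x))\<^sup>2 + k n z * (norm (f (x + z) - f x))\<^sup>2"
        by (simp add: algebra_simps)
    qed
    also have "\<dots> = (norm (v n x))\<^sup>2 + (LINT z|lborel. k n z * (norm (f (x + z) - f x))\<^sup>2)"
      using k_int i3 by (simp add: k_one)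
    finally have "(norm (v n x))\<^sup>2 \<le> (LINT z|lborel. k n z * (norm (f (x + z) - f x))\<^sup>2)" by simp
    then show ?thesis
      using k0 by (simp add: nn_integral_eq_integral[OF i3])
  qed
  \<comment> \<open>A bound on the translation error for all shifts. It is used for long shifts,
    which carry little kernel mass.\<close>
  define M where "M = 4 * (LINT x|lborel. (norm (f x))\<^sup>2)"
  define \<omega> where "\<omega> z = (LINT x|lborel. (norm (f (x + z) - f x))\<^sup>2)" for z
  have M0: "M \<ge> 0" by (simp add: M_def)
  have \<omega>M: "\<omega> z \<le> M" for z
  proof -
    have "\<omega> z \<le> (LINT x|lborel. 2 * (norm (f (x + z)))\<^sup>2 + 2 * (norm (f x))\<^sup>2)"
      unfolding \<omega>_def
      by (rule integral_mono)
         (use l2_integrable[OF l2_diff[OF l2_translate[OF f] f], of z] l2_integrable[OF l2_translate[OF f], of z] l2_integrable[OF f]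
           norm_diff_sq_le in auto)
    also have "\<dots> = M"
      using l2_integrable[OF l2_translate[OF f], of z] l2_integrable[OF f] integral_translate[of "\<lambda>x. (norm (f x))\<^sup>2" z]
      by (simp add: M_def)
    finally show ?thesis .
  qed
  have total: "(\<integral>\<^sup>+x. ennreal ((norm (v n x))\<^sup>2) \<partial>lborel) \<le> (\<integral>\<^sup>+z. ennreal (k n z * \<omega> z) \<partial>lborel)" for n
  proof -
    have "(\<integral>\<^sup>+x. ennreal ((norm (v n x))\<^sup>2) \<partial>lborel)
        \<le> (\<integral>\<^sup>+x. (\<integral>\<^sup>+z. ennreal (k n z * (norm (f (x + z) - f x))\<^sup>2) \<partial>lborel) \<partial>lborel)"
      by (intro nn_integral_mono jensen)
    also have "\<dots> = (\<integral>\<^sup>+z. (\<integral>\<^sup>+x. ennreal (k n z * (norm (f (x + z) - f x))\<^sup>2) \<partial>lborel) \<partial>lborel)"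
      by (rule lborel_pair.Fubini') measurable
    also have "\<dots> = (\<integral>\<^sup>+z. ennreal (k n z * \<omega> z) \<partial>lborel)"
    proof (rule nn_integral_cong)
      fix z
      have "(\<integral>\<^sup>+x. ennreal (k n z * (norm (f (x + z) - f x))\<^sup>2) \<partial>lborel) = ennreal (LINT x|lborel. k n z * (norm (f (x + z) - f x))\<^sup>2)"
        using l2_integrable[OF l2_diff[OF l2_translate[OF f] f], of z] k0[of n z]
        by (intro nn_integral_eq_integral) auto
      then show "(\<integral>\<^sup>+x. ennreal (k n z * (norm (f (x + z) - f x))\<^sup>2) \<partial>lborel) = ennreal (k n z * \<omega> z)"
        by (simp add: \<omega>_def)
    qed
    finally show ?thesis .
  qed
  show ?thesis
    unfolding v_def[symmetric]
  proof (rule LIMSEQ_I)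
    fix e :: real assume e: "e > 0"
    obtain \<delta>0 where \<delta>0: "\<delta>0 > 0" "\<And>z. norm z < \<delta>0 \<Longrightarrow> \<omega> z < e / 2"
      using l2_translation_continuous[OF f supp, of R "e / 2"] e unfolding \<omega>_def by auto
    \<comment> \<open>The minimum with \<open>R\<close> guarantees
      \<open>\<delta> \<le> 2 * R\<close>, as \<open>landau_concentration\<close> demands.\<close>
    define \<delta> where "\<delta> = min \<delta>0 R"
    have \<delta>: "0 < \<delta>" "\<delta> \<le> ?r" using \<delta>0 R by (auto simp: \<delta>_def)
    define q where "q n = (LINT z|lborel. indicator (- ball 0 \<delta>) z * k n z)" for n
    have "q \<longlonglongrightarrow> 0"
      using conc(3)[OF \<delta>] by (simp add: q_def[abs_def] k_def a_def)
    then have "(\<lambda>n. e / 2 + M * q n) \<longlonglongrightarrow> e / 2 + M * 0" by (intro tendsto_intros)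
    then have "\<forall>\<^sub>F n in sequentially. e / 2 + M * q n < e"
      by (rule order_tendstoD(2)) (use e in simp)
    then obtain N where N: "\<And>n. n \<ge> N \<Longrightarrow> e / 2 + M * q n < e" by (auto simp: eventually_sequentially)
    have "norm ((LINT x|lborel. (norm (v n x))\<^sup>2) - 0) < e" if "n \<ge> N" for n
    proof -
      have qi: "integrable lborel (\<lambda>z. indicator (- ball 0 \<delta>) z * k n z)"
        using integrable_mult_indicator[OF _ k_int, of "- ball 0 \<delta>" n] by simp
      have q0: "q n \<ge> 0" unfolding q_def using k0 by (intro integral_nonneg_AE AE_I2) auto
      have "(\<integral>\<^sup>+x. ennreal ((norm (v n x))\<^sup>2) \<partial>lborel) \<le> (\<integral>\<^sup>+z. ennreal (k n z * \<omega> z) \<partial>lborel)" by (rule total)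
      also have "\<dots> \<le> (\<integral>\<^sup>+z. ennreal (e / 2 * k n z + M * (indicator (- ball 0 \<delta>) z * k n z)) \<partial>lborel)"
      proof (intro nn_integral_mono ennreal_leI)
        fix z
        show "k n z * \<omega> z \<le> e / 2 * k n z + M * (indicator (- ball 0 \<delta>) z * k n z)"
        proof (cases "norm z < \<delta>")
          case True
          then have "\<omega> z \<le> e / 2" using \<delta>0(2)[of z] by (simp add: \<delta>_def)
          from mult_left_mono[OF this k0[of n z]] show ?thesis using True by (simp add: mult.commute)
        next
          case False
          have "k n z * \<omega> z \<le> k n z * M" by (intro mult_left_mono \<omega>M k0)
          moreover have "0 \<le> e / 2 * k n z" using e k0[of n z] by simp
          ultimately show ?thesis using False by (simp add: mult.commute)
        qed
      qed
      also have "\<dots> = ennreal (LINT z|lborel. e / 2 * k n z + M * (indicator (- ball 0 \<delta>) z * k n z))"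
        using k_int qi k0 e M0 by (intro nn_integral_eq_integral) auto
      also have "(LINT z|lborel. e / 2 * k n z + M * (indicator (- ball 0 \<delta>) z * k n z)) = e / 2 + M * q n"
        using k_int qi by (simp add: k_one q_def)
      finally have bd: "(\<integral>\<^sup>+x. ennreal ((norm (v n x))\<^sup>2) \<partial>lborel) \<le> ennreal (e / 2 + M * q n)" .
      have "(LINT x|lborel. (norm (v n x))\<^sup>2) \<le> e / 2 + M * q n"
        using bd q0 M0 e by (intro integral_real_bounded) auto
      then show ?thesis using N[OF that] by simp
    qed
    then show "\<exists>no. \<forall>n\<ge>no. norm ((LINT x|lborel. (norm (v n x))\<^sup>2) - 0) < e" by blast
  qed
qed

subsection \<open>Passage to Sobolev functions\<close>

lemma ex_borel_version:
  fixes f :: "'a::euclidean_space \<Rightarrow> 'b::euclidean_space"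
  assumes "f \<in> borel_measurable lebesgue"
  obtains f' where "f' \<in> borel_measurable borel" "AE x in lborel. f x = f' x"
proof -
  have "\<exists>g. g \<in> borel_measurable lborel \<and> (AE x in lborel. f x \<bullet> i = g x)" for i
  proof -
    have "(\<lambda>x. f x \<bullet> i) \<in> borel_measurable lebesgue" using assms by simp
    from completion_ex_borel_measurable_real[OF this] show ?thesis by blast
  qed
  then obtain g where g: "\<And>i. g i \<in> borel_measurable lborel" "\<And>i. AE x in lborel. f x \<bullet> i = g i x" by metis
  have "AE x in lborel. \<forall>i\<in>Basis. f x \<bullet> i = g i x"
    using g(2) by (intro AE_finite_allI) auto
  then have "AE x in lborel. f x = (\<Sum>i\<in>Basis. g i x *\<^sub>R i)"
  proof eventually_elim
    case (elim x)
    then have "(\<Sum>i\<in>Basis. g i x *\<^sub>R i) = (\<Sum>i\<in>Basis. (f x \<bullet> i) *\<^sub>R i)"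
      by (intro sum.cong) simp_all
    then show ?case by (simp add: euclidean_representation)
  qed
  moreover have "(\<lambda>x. \<Sum>i\<in>Basis. g i x *\<^sub>R i) \<in> borel_measurable borel"
    using g(1) by simp
  ultimately show ?thesis using that by blast
qed

lemma L2_borel_version:
  fixes f :: "real^'n::finite \<Rightarrow> complex^'d::finite"
  assumes "f \<in> L2"
  obtains f' where "l2 f'" "AE x in lborel. f x = f' x"
proof -
  from assms have f: "f \<in> borel_measurable lebesgue" "integrable lebesgue (\<lambda>x. (norm (f x))\<^sup>2)"
    by (auto simp: L2_def)
  obtain f' where f': "f' \<in> borel_measurable borel" "AE x in lborel. f x = f' x"
    using ex_borel_version[OF f(1)] by blast
  have m: "(\<lambda>x. (norm (f' x))\<^sup>2) \<in> borel_measurable lborel" using f'(1) by simp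
  have "integrable lebesgue (\<lambda>x. (norm (f' x))\<^sup>2)"
  proof (rule integrable_cong_AE_imp[OF f(2)])
    show "(\<lambda>x. (norm (f' x))\<^sup>2) \<in> borel_measurable lebesgue"
      using m by (rule measurable_completion)
    show "AE x in lebesgue. (norm (f x))\<^sup>2 = (norm (f' x))\<^sup>2"
      using AE_completion[OF f'(2)] by eventually_elim simp
  qed
  then have "integrable lborel (\<lambda>x. (norm (f' x))\<^sup>2)"
    using integrable_completion[OF m] by simp
  with f' show ?thesis using that by (auto simp: l2_def)
qed

lemma lebesgue_integral_borel_version:
  fixes f :: "real^'n::finite \<Rightarrow> 'b::euclidean_space"
  assumes "continuous_on UNIV a" "f \<in> borel_measurable lebesgue" "f' \<in> borel_measurable borel" "AE x in lborel. f x = f' x"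
  shows "(LINT x|lebesgue. a x *\<^sub>R f x) = (LINT x|lborel. a x *\<^sub>R f' x)"
proof -
  have a: "a \<in> borel_measurable borel" by (rule borel_measurable_continuous_onI[OF assms(1)])
  have m: "(\<lambda>x. a x *\<^sub>R f' x) \<in> borel_measurable lborel" using a assms(3) by simp
  have a': "a \<in> borel_measurable lebesgue" using a by (simp add: measurable_completion)
  have "(LINT x|lebesgue. a x *\<^sub>R f x) = (LINT x|lebesgue. a x *\<^sub>R f' x)"
  proof (rule integral_cong_AE)
    show "(\<lambda>x. a x *\<^sub>R f x) \<in> borel_measurable lebesgue" using a' assms(2) by simp
    show "(\<lambda>x. a x *\<^sub>R f' x) \<in> borel_measurable lebesgue" using m by (rule measurable_completion)
    show "AE x in lebesgue. a x *\<^sub>R f x = a x *\<^sub>R f' x"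
      using AE_completion[OF assms(4)] by eventually_elim simp
  qed
  also have "\<dots> = (LINT x|lborel. a x *\<^sub>R f' x)" by (rule integral_completion[OF m])
  finally show ?thesis .
qed

section \<open>Cutoffs and convolution of weak derivatives\<close>

lemma vpoly_landau_kernel: "vpoly (\<lambda>y::real^'n::finite. landau_kernel d n (x - y))"
proof (induction n)
  case 0
  show ?case by (simp add: landau_kernel_def vpoly_const)
next
  case (Suc n)
  have eq: "1 - d * (norm (x - y))\<^sup>2 = (1 - d * (norm x)\<^sup>2) + ((\<Sum>j\<in>UNIV. y $ j *\<^sub>R (2 * d * x $ j)) - d *\<^sub>R (norm y)\<^sup>2)" for y
    unfolding power2_norm_eq_inner
    by (simp add: inner_simps inner_commute inner_vec_def[of x y] sum_distrib_left algebra_simps)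
  have "vpoly (\<lambda>y. 1 - d * (norm (x - y))\<^sup>2)"
    unfolding eq by (intro vpoly_add vpoly_diff vpoly_const vpoly_sum vpoly_times vpoly_cmul vpoly_norm_sq)
  from vpoly_scaleR[OF this Suc] show ?case by (simp add: landau_kernel_def)
qed

lemma pd_landau_kernel:
  "pd k (\<lambda>y. landau_kernel d n (x - y)) y = - (real n * landau_kernel d (n - 1) (x - y) * (- 2 * d * (x - y) $ k))"
proof -
  have "((\<lambda>y. landau_kernel d n (x - y)) has_derivative
     (\<lambda>h. real n * landau_kernel d (n - 1) (x - y) * (2 * d * ((x - y) \<bullet> h)))) (at y)"
    unfolding landau_kernel_def power2_norm_eq_inner
    by (auto intro!: derivative_eq_intros simp: inner_commute fun_eq_iff algebra_simps)
  from pd_eqI[OF this, of k] show ?thesis by (simp add: inner_axis)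
qed

lemma norm_sg: "norm (sg k u) = norm u"
  by (simp add: norm_eq_sqrt_inner sg_inner)

lemma norm_add3_sq_le:
  "(norm (a + b + c))\<^sup>2 \<le> 4 * ((norm a)\<^sup>2 + (norm b)\<^sup>2 + (norm (c :: 'b::real_inner))\<^sup>2)"
proof -
  have "(norm (a + b + c))\<^sup>2 \<le> 2 * (norm (a + b))\<^sup>2 + 2 * (norm c)\<^sup>2"
    by (rule norm_add_sq_le)
  also have "\<dots> \<le> 2 * (2 * (norm a)\<^sup>2 + 2 * (norm b)\<^sup>2) + 4 * (norm c)\<^sup>2"
    by (intro add_mono mult_left_mono norm_add_sq_le mult_right_mono) auto
  finally show ?thesis by simp
qed

lemma norm_sum_sg: "(norm (\<Sum>k\<in>UNIV. sg k (u k)))\<^sup>2 \<le> 4 * (\<Sum>k\<in>UNIV. (norm (u k))\<^sup>2)"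
  using norm_add3_sq_le[of "sg 1 (u 1)" "sg 2 (u 2)" "sg 3 (u 3)"]
  by (simp only: norm_sg sum_3)

text \<open>The constant is \<open>fact (2 + 2)\<close> from \<open>flat_le\<close>.\<close>

lemma flat_2_le: "t \<le> 1 \<Longrightarrow> flat 2 t \<le> 24"
proof (cases "t > 0")
  case True
  assume "t \<le> 1"
  then have "t\<^sup>2 \<le> 1" using True by (simp add: power_le_one)
  then show ?thesis using flat_le[of 2 t] by (simp add: fact_numeral)
qed (simp add: flat_def)

text \<open>A spinor with its weak gradient \<open>g\<close>, both as Borel representatives. The
  weak formulation is recorded just for the test functions that the convolution argument
  produces.\<close>

locale weak_spinor =
  fixes \<phi> :: "real^3 \<Rightarrow> complex^2" and g :: "3 \<Rightarrow> real^3 \<Rightarrow> complex^2"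
  assumes l2_phi: "l2 \<phi>" and l2_g: "\<And>k. l2 (g k)"
    and weak: "\<And>c \<eta> k. c > 0 \<Longrightarrow> bump_poly c \<eta> \<Longrightarrow>
      (LINT x|lborel. pd k \<eta> x *\<^sub>R \<phi> x) = - (LINT x|lborel. \<eta> x *\<^sub>R g k x)"
begin

text \<open>As \<open>R\<close> grows this tends pointwise to \<open>flat 0 1 = exp (-1)\<close>,
  not to 1; the constant is divided out in \<open>regularized_ineq\<close>.\<close>

definition \<xi> :: "real \<Rightarrow> real^3 \<Rightarrow> real" where
  "\<xi> R x = flat 0 (1 - (1 / R\<^sup>2) * (norm x)\<^sup>2)"

definition \<tau> :: "real \<Rightarrow> real^3 \<Rightarrow> real" where
  "\<tau> R x = (- 2 / R\<^sup>2) * flat 2 (1 - (1 / R\<^sup>2) * (norm x)\<^sup>2)"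

definition dg :: "real^3 \<Rightarrow> complex^2" where
  "dg x = (\<Sum>k\<in>UNIV. sg k (g k x))"

lemma radial_xi: "radial (\<xi> R) (\<tau> R)"
  using radial_flat[of 0 "1 / R\<^sup>2", where 'a="real^3"] by (simp add: \<xi>_def[abs_def] \<tau>_def[abs_def] numeral_2_eq_2)

lemma outside:
  assumes "R > 0" "norm x \<ge> R"
  shows "1 - (1 / R\<^sup>2) * (norm x)\<^sup>2 \<le> 0"
  using power_mono[OF assms(2), of 2] assms(1) by (simp add: field_simps)

lemma radial_weight_xi:
  assumes "R > 0"
  shows "radial_weight R (\<xi> R) (\<tau> R)"
proof -
  have "\<xi> R x = 0" "\<tau> R x = 0" if "norm x \<ge> R" for x
    using outside[OF assms that] unfolding \<xi>_def \<tau>_def flat_def by simp_all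
  then show ?thesis by (simp add: radial_weight_def radial_xi)
qed

lemma xi_bounds: "0 \<le> \<xi> R x" "\<xi> R x \<le> 1"
  by (simp_all add: \<xi>_def flat_nonneg flat_le_1)

text \<open>The left-hand side is the length of the gradient of the cutoff, which decays like
  \<open>1/R\<close>. The constant is 2 times the bound 24 of \<open>flat_2_le\<close>.\<close>

lemma tau_bound:
  assumes "R > 0"
  shows "\<bar>\<tau> R x\<bar> * norm x \<le> 48 / R"
proof (cases "norm x \<ge> R")
  case True
  then show ?thesis using radial_weight_xi[OF assms] assms by (simp add: radial_weight_def)
next
  case False
  have "\<bar>\<tau> R x\<bar> \<le> 2 / R\<^sup>2 * 24"
    using flat_2_le[of "1 - (1 / R\<^sup>2) * (norm x)\<^sup>2"] flat_nonneg[of 2 "1 - (1 / R\<^sup>2) * (norm x)\<^sup>2"]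
    by (simp add: \<tau>_def abs_mult divide_right_mono)
  then have "\<bar>\<tau> R x\<bar> * norm x \<le> 2 / R\<^sup>2 * 24 * R"
    using False by (intro mult_mono) auto
  also have "\<dots> = 48 / R" using assms by (simp add: power2_eq_square)
  finally show ?thesis .
qed

lemma xi_measurable: "\<xi> R \<in> borel_measurable borel" "\<tau> R \<in> borel_measurable borel"
  by (intro borel_measurable_continuous_onI radial_continuous[OF radial_xi])+

definition \<psi> :: "real \<Rightarrow> real^3 \<Rightarrow> complex^2" where
  "\<psi> R x = \<xi> R x *\<^sub>R \<phi> x"

text \<open>The weak partial derivative of \<open>\<psi> R\<close> by the product rule.\<close>

definition G :: "real \<Rightarrow> 3 \<Rightarrow> real^3 \<Rightarrow> complex^2" where
  "G R k x = \<xi> R x *\<^sub>R g k x + (\<tau> R x * x $ k) *\<^sub>R \<phi> x"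

lemma l2_psi: "l2 (\<psi> R)"
  unfolding \<psi>_def by (rule l2_scaleR[OF xi_measurable(1) _ l2_phi, of _ 1]) (use xi_bounds in auto)

lemma l2_tau_phi:
  assumes "R > 0"
  shows "l2 (\<lambda>x. (\<tau> R x * x $ k) *\<^sub>R \<phi> x)"
proof (rule l2_scaleR[OF _ _ l2_phi])
  show "(\<lambda>x. \<tau> R x * x $ k) \<in> borel_measurable borel"
    by (intro borel_measurable_continuous_onI continuous_intros radial_continuous[OF radial_xi])
  show "\<bar>\<tau> R x * x $ k\<bar> \<le> 48 / R" for x
    using mult_left_mono[OF component_le_norm_cart[of x k], of "\<bar>\<tau> R x\<bar>"] tau_bound[OF assms, of x]
    by (simp add: abs_mult)
qed

lemma l2_xi_g: "l2 (\<lambda>x. \<xi> R x *\<^sub>R g k x)"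
  by (rule l2_scaleR[OF xi_measurable(1) _ l2_g, of _ 1]) (use xi_bounds in auto)

lemma l2_G: "R > 0 \<Longrightarrow> l2 (G R k)"
  unfolding G_def by (intro l2_add l2_tau_phi l2_xi_g)

lemma supp:
  assumes "R > 0" "norm x \<ge> R"
  shows "\<xi> R x = 0" "\<tau> R x = 0" "\<psi> R x = 0" "G R k x = 0"
  using radial_weight_xi[OF assms(1)] assms(2) by (auto simp: radial_weight_def \<psi>_def G_def)

text \<open>Convolution commutes with weak derivatives: the derivative of the kernel in
  \<open>x\<close> is minus its derivative in \<open>y\<close>, and the weak formulation moves the
  latter onto the spinor.\<close>

lemma landau_pd_psi:
  assumes R: "R > 0"
  shows "landau_pd d n k (\<lambda>y. 1) (\<psi> R) x = landau d n (\<lambda>y. 1) (G R k) x"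
proof -
  let ?K = "\<lambda>y. landau_kernel d n (x - y)"
  define K' where "K' y = real n * landau_kernel d (n - 1) (x - y) * (- 2 * d * (x - y) $ k)" for y
  \<comment> \<open>The cutoff inside \<open>\<psi> R\<close> is assigned to the kernel, which makes
    the product an admissible test function.\<close>
  define \<eta> where "\<eta> y = ?K y * \<xi> R y" for y
  have \<eta>: "bump_poly (1 / R\<^sup>2) \<eta>"
    unfolding \<eta>_def[abs_def] \<xi>_def by (rule bump_poly_flat[OF vpoly_landau_kernel])
  have pd\<eta>: "pd k \<eta> y = - K' y * \<xi> R y + ?K y * (\<tau> R y * y $ k)" for y
    unfolding \<eta>_def[abs_def] K'_def
    by (simp add: pd_mult[OF vpoly_differentiable[OF vpoly_landau_kernel] radial_differentiable[OF radial_xi]]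
      pd_landau_kernel pd_radial[OF radial_xi])
  have cK: "continuous_on UNIV ?K" by (rule vpoly_continuous[OF vpoly_landau_kernel])
  have cK': "continuous_on UNIV K'"
    unfolding K'_def by (intro continuous_intros vpoly_continuous[OF vpoly_landau_kernel])
  have i1: "integrable lborel (\<lambda>y. K' y *\<^sub>R \<psi> R y)"
    by (rule l2_integrable_scaleR[of _ R, OF l2_psi _ cK']) (rule supp[OF R])
  have i2: "integrable lborel (\<lambda>y. ?K y *\<^sub>R ((\<tau> R y * y $ k) *\<^sub>R \<phi> y))"
    by (rule l2_integrable_scaleR[of _ R, OF l2_tau_phi[OF R] _ cK]) (simp add: supp[OF R])
  have i3: "integrable lborel (\<lambda>y. ?K y *\<^sub>R (\<xi> R y *\<^sub>R g k y))"
    by (rule l2_integrable_scaleR[of _ R, OF l2_xi_g _ cK]) (simp add: supp[OF R])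
  have "(LINT y|lborel. pd k \<eta> y *\<^sub>R \<phi> y) = (LINT y|lborel. ?K y *\<^sub>R ((\<tau> R y * y $ k) *\<^sub>R \<phi> y) - K' y *\<^sub>R \<psi> R y)"
    by (rule Bochner_Integration.integral_cong[OF refl]) (simp add: pd\<eta> \<psi>_def algebra_simps)
  also have "\<dots> = (LINT y|lborel. ?K y *\<^sub>R ((\<tau> R y * y $ k) *\<^sub>R \<phi> y)) - (LINT y|lborel. K' y *\<^sub>R \<psi> R y)"
    by (rule Bochner_Integration.integral_diff[OF i2 i1])
  finally have *: "(LINT y|lborel. pd k \<eta> y *\<^sub>R \<phi> y) = (LINT y|lborel. ?K y *\<^sub>R ((\<tau> R y * y $ k) *\<^sub>R \<phi> y)) - (LINT y|lborel. K' y *\<^sub>R \<psi> R y)" .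
  have "(LINT y|lborel. K' y *\<^sub>R \<psi> R y) = (LINT y|lborel. ?K y *\<^sub>R ((\<tau> R y * y $ k) *\<^sub>R \<phi> y)) + (LINT y|lborel. \<eta> y *\<^sub>R g k y)"
  proof -
    have "(LINT y|lborel. ?K y *\<^sub>R ((\<tau> R y * y $ k) *\<^sub>R \<phi> y)) + (LINT y|lborel. \<eta> y *\<^sub>R g k y)
      = (LINT y|lborel. ?K y *\<^sub>R ((\<tau> R y * y $ k) *\<^sub>R \<phi> y)) - (LINT y|lborel. pd k \<eta> y *\<^sub>R \<phi> y)"
      using weak[OF _ \<eta>, of k] R by simp
    then show ?thesis unfolding * by simp
  qed
  also have "(LINT y|lborel. \<eta> y *\<^sub>R g k y) = (LINT y|lborel. ?K y *\<^sub>R (\<xi> R y *\<^sub>R g k y))"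
    by (simp add: \<eta>_def)
  also have "(LINT y|lborel. ?K y *\<^sub>R ((\<tau> R y * y $ k) *\<^sub>R \<phi> y)) + \<dots>
      = (LINT y|lborel. ?K y *\<^sub>R ((\<tau> R y * y $ k) *\<^sub>R \<phi> y) + ?K y *\<^sub>R (\<xi> R y *\<^sub>R g k y))"
    by (rule Bochner_Integration.integral_add[OF i2 i3, symmetric])
  also have "\<dots> = landau d n (\<lambda>y. 1) (G R k) x"
    unfolding landau_def by (rule Bochner_Integration.integral_cong[OF refl]) (simp add: G_def algebra_simps)
  finally show ?thesis by (simp add: landau_pd_def K'_def)
qed

lemma slash_measurable:
  assumes "f \<in> borel_measurable borel"
  shows "(\<lambda>x. slash x (f x)) \<in> borel_measurable borel"
  unfolding slash_def
proof (intro borel_measurable_sum borel_measurable_scaleR)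
  fix k
  show "(\<lambda>x::real^3. x $ k) \<in> borel_measurable borel"
    by (rule borel_measurable_continuous_onI[OF linear_continuous_on[OF bounded_linear_vec_nth]])
  show "(\<lambda>x. sg k (f x)) \<in> borel_measurable borel"
    using borel_measurable_continuous_onI[OF linear_continuous_on[OF bounded_linear_sg]] assms
    by (rule measurable_compose_rev)
qed

lemma tau_slash_bound:
  assumes "R > 0"
  shows "(norm (\<tau> R x *\<^sub>R slash x u))\<^sup>2 \<le> (48 / R)\<^sup>2 * (norm u)\<^sup>2"
proof -
  have "norm (\<tau> R x *\<^sub>R slash x u) \<le> 48 / R * norm u"
    using mult_right_mono[OF tau_bound[OF assms, of x] norm_ge_zero[of u]] by (simp add: norm_slash mult.assoc)
  from power_mono[OF this, of 2] show ?thesis by (simp add: power_mult_distrib power_divide)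
qed

lemma l2_tau_slash:
  assumes "R > 0" "l2 f"
  shows "l2 (\<lambda>x. \<tau> R x *\<^sub>R slash x (f x))"
proof (rule l2_bound[OF _ _ tau_slash_bound[OF assms(1)]])
  show "integrable lborel (\<lambda>x. (48 / R)\<^sup>2 * (norm (f x))\<^sup>2)" using l2_integrable[OF assms(2)] by simp
  show "(\<lambda>x. \<tau> R x *\<^sub>R slash x (f x)) \<in> borel_measurable borel"
    by (intro borel_measurable_scaleR xi_measurable slash_measurable l2_measurable assms)
qed

lemma l2_xi: "l2 f \<Longrightarrow> l2 (\<lambda>x. \<xi> R x *\<^sub>R f x)"
  by (rule l2_scaleR[OF xi_measurable(1), of _ 1]) (use xi_bounds in auto)

lemma norm_xi_sq: "(norm (\<xi> R x *\<^sub>R u))\<^sup>2 \<le> (norm u)\<^sup>2"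
proof -
  have "norm (\<xi> R x *\<^sub>R u) \<le> norm u"
    using mult_right_mono[OF xi_bounds(2)[of R x] norm_ge_zero[of u]] xi_bounds(1)[of R x] by simp
  from power_mono[OF this, of 2] show ?thesis by simp
qed

section \<open>The three limits: degree of the kernel, radius of the cutoff, regularisation\<close>

lemma weight_bounds:
  assumes eps: "\<epsilon> > 0"
  defines "s \<equiv> \<lambda>x::real^3. 1 / sqrt ((norm x)\<^sup>2 + \<epsilon>\<^sup>2)"
  shows "(\<lambda>x::real^3. norm x / (1 + norm x)) \<in> borel_measurable borel"
    "(\<lambda>x. (norm x)\<^sup>2 * (s x)\<^sup>2) \<in> borel_measurable borel"
    "(\<lambda>x. (norm x)\<^sup>2 * (s x) ^ 3) \<in> borel_measurable borel"
    "\<bar>norm (x::real^3) / (1 + norm x)\<bar> \<le> 1" "\<bar>(norm x)\<^sup>2 * (s x)\<^sup>2\<bar> \<le> 1" "\<bar>(norm x)\<^sup>2 * (s x) ^ 3\<bar> \<le> 1 / \<epsilon>"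
proof -
  show "(\<lambda>x::real^3. norm x / (1 + norm x)) \<in> borel_measurable borel"
    "(\<lambda>x. (norm x)\<^sup>2 * (s x)\<^sup>2) \<in> borel_measurable borel"
    "(\<lambda>x. (norm x)\<^sup>2 * (s x) ^ 3) \<in> borel_measurable borel"
    unfolding s_def by measurable
  show "\<bar>norm x / (1 + norm x)\<bar> \<le> 1"
  proof -
    have "1 + norm x > 0" using norm_ge_zero[of x] by linarith
    then show ?thesis by (simp add: divide_le_eq)
  qed
  have pos: "(norm x)\<^sup>2 + \<epsilon>\<^sup>2 > 0" using eps by (simp add: add_nonneg_pos)
  have "(norm x)\<^sup>2 * (s x)\<^sup>2 = (norm x)\<^sup>2 / ((norm x)\<^sup>2 + \<epsilon>\<^sup>2)"
    using pos by (simp add: s_def power_divide)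
  also have "\<dots> \<le> 1" using pos by (simp add: divide_le_eq)
  finally have 1: "(norm x)\<^sup>2 * (s x)\<^sup>2 \<le> 1" .
  then show "\<bar>(norm x)\<^sup>2 * (s x)\<^sup>2\<bar> \<le> 1" by simp
  have "\<epsilon> \<le> sqrt ((norm x)\<^sup>2 + \<epsilon>\<^sup>2)" using eps by (intro real_le_rsqrt) simp
  then have 2: "s x \<le> 1 / \<epsilon>" using eps by (simp add: s_def frac_le)
  have 3: "s x \<ge> 0" by (simp add: s_def)
  have "(norm x)\<^sup>2 * (s x) ^ 3 = ((norm x)\<^sup>2 * (s x)\<^sup>2) * s x"
    by (simp add: power2_eq_square power3_eq_cube)
  also have "\<dots> \<le> 1 * (1 / \<epsilon>)" by (intro mult_mono 1 2 3) auto
  finally show "\<bar>(norm x)\<^sup>2 * (s x) ^ 3\<bar> \<le> 1 / \<epsilon>" using 3 by simp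
qed

text \<open>The polynomials \<open>p n\<close> approximate \<open>\<xi> \<phi>\<close> on a ball
  only, and \<open>poly_ineq\<close> multiplies them by \<open>\<xi>\<close> once more. Hence the
  squared cutoff and the factor 2 in its derivative.\<close>

lemma truncated_ineq:
  assumes R: "R > 0" and eps: "\<epsilon> > 0"
  defines "s \<equiv> \<lambda>x::real^3. 1 / sqrt ((norm x)\<^sup>2 + \<epsilon>\<^sup>2)"
  shows "(LINT x|lborel. (norm x)\<^sup>2 * (s x) ^ 3 * (norm ((\<xi> R x)\<^sup>2 *\<^sub>R \<phi> x))\<^sup>2)
    \<le> (LINT x|lborel. norm x / (1 + norm x) * (norm ((\<xi> R x)\<^sup>2 *\<^sub>R dg x + (2 * \<xi> R x * \<tau> R x) *\<^sub>R slash x (\<phi> x)))\<^sup>2)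
      + (LINT x|lborel. (norm x)\<^sup>2 * (s x)\<^sup>2 * (norm ((\<xi> R x)\<^sup>2 *\<^sub>R \<phi> x))\<^sup>2)"
proof -
  let ?d = "1 / (2 * R)\<^sup>2"
  let ?I = "\<lambda>x::real^3. indicator (cball 0 R) x :: real"
  define a where "a n = (LINT z|lborel. indicator (cball (0::real^3) (2 * R)) z * landau_kernel ?d n z)" for n
  define p where "p n x = (1 / a n) *\<^sub>R landau ?d n (\<lambda>y. 1) (\<psi> R) x" for n x
  note lp = vpoly_landau[of "\<psi> R" R "\<lambda>y. 1", OF l2_psi supp(3)[OF R] continuous_on_const]
  have vp: "vpoly (p n)" for n
    unfolding p_def using lp by (intro vpoly_cmul) blast
  have pdp: "pd k (p n) x = (1 / a n) *\<^sub>R landau ?d n (\<lambda>y. 1) (G R k) x" for n k x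
    unfolding p_def using lp
    by (simp add: pd_bounded_linear[OF bounded_linear_scaleR_right] vpoly_differentiable landau_pd_psi[OF R])
  define u where "u n x = ?I x *\<^sub>R p n x - \<psi> R x" for n x
  define U where "U n k x = ?I x *\<^sub>R pd k (p n) x - G R k x" for n k x
  have l2u: "l2 (u n)" for n
    unfolding u_def by (intro l2_diff l2_psi l2_continuous_indicator vpoly_continuous vp)
  have l2U: "l2 (U n k)" for n k
    unfolding U_def by (intro l2_diff l2_G R l2_continuous_indicator vpoly_continuous vpoly_pd vp)
  have lim_u: "(\<lambda>n. LINT x|lborel. (norm (u n x))\<^sup>2) \<longlonglongrightarrow> 0"
    using landau_l2[OF l2_psi supp(3)[OF R] R] unfolding u_def p_def a_def .
  have lim_U: "(\<lambda>n. LINT x|lborel. (norm (U n k x))\<^sup>2) \<longlonglongrightarrow> 0" for k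
    using landau_l2[OF l2_G[OF R] supp(4)[OF R] R] unfolding U_def pdp a_def .
  define H where "H n x = \<xi> R x *\<^sub>R p n x" for n x
  define F where "F n x = \<xi> R x *\<^sub>R dirac (p n) x + \<tau> R x *\<^sub>R slash x (p n x)" for n x
  define H0 where "H0 x = \<xi> R x *\<^sub>R \<psi> R x" for x
  define F0 where "F0 x = \<xi> R x *\<^sub>R (\<Sum>k\<in>UNIV. sg k (G R k x)) + \<tau> R x *\<^sub>R slash x (\<psi> R x)" for x
  \<comment> \<open>Outside the ball the cutoff vanishes, so the indicator inside \<open>u\<close>
    costs nothing; the same holds for \<open>F\<close>.\<close>
  have H: "H n x = H0 x + \<xi> R x *\<^sub>R u n x" for n x
    using supp(1)[OF R, of x] by (cases "norm x \<le> R") (simp_all add: H_def H0_def u_def algebra_simps)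
  have F: "F n x = F0 x + (\<xi> R x *\<^sub>R (\<Sum>k\<in>UNIV. sg k (U n k x)) + \<tau> R x *\<^sub>R slash x (u n x))" for n x
    using supp(1,2)[OF R, of x]
    by (cases "norm x \<le> R") (simp_all add: F_def F0_def u_def U_def dirac_def sg_simps slash_simps sum_subtractf algebra_simps)
  have l2H0: "l2 H0" unfolding H0_def by (intro l2_xi l2_psi)
  have l2F0: "l2 F0"
    unfolding F0_def by (intro l2_add l2_xi l2_sum l2_bounded_linear[OF bounded_linear_sg] l2_G[OF R] l2_tau_slash[OF R] l2_psi)
  have l2H: "l2 (H n)" for n
    unfolding H by (intro l2_add l2H0 l2_xi l2u)
  have l2D: "l2 (\<lambda>x. \<xi> R x *\<^sub>R (\<Sum>k\<in>UNIV. sg k (U n k x)) + \<tau> R x *\<^sub>R slash x (u n x))" for n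
    by (intro l2_add l2_xi l2_sum l2_bounded_linear[OF bounded_linear_sg] l2U l2_tau_slash[OF R] l2u)
  have l2F: "l2 (F n)" for n
    unfolding F by (intro l2_add[OF l2F0 l2D])
  have lim_H: "(\<lambda>n. LINT x|lborel. (norm (H n x - H0 x))\<^sup>2) \<longlonglongrightarrow> 0"
  proof (rule tendsto_sandwich[OF _ _ tendsto_const lim_u]; rule always_eventually; rule allI)
    fix n
    show "0 \<le> (LINT x|lborel. (norm (H n x - H0 x))\<^sup>2)" by simp
    show "(LINT x|lborel. (norm (H n x - H0 x))\<^sup>2) \<le> (LINT x|lborel. (norm (u n x))\<^sup>2)"
      unfolding H add_diff_cancel_left'
      by (intro integral_mono l2_integrable l2_xi l2u norm_xi_sq)
  qed
  have lim_F: "(\<lambda>n. LINT x|lborel. (norm (F n x - F0 x))\<^sup>2) \<longlonglongrightarrow> 0"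
  proof -
    let ?B = "\<lambda>n. 8 * (\<Sum>k\<in>UNIV. LINT x|lborel. (norm (U n k x))\<^sup>2) + 2 * ((48 / R)\<^sup>2 * (LINT x|lborel. (norm (u n x))\<^sup>2))"
    have "?B \<longlonglongrightarrow> 8 * (\<Sum>k\<in>(UNIV::3 set). 0) + 2 * ((48 / R)\<^sup>2 * 0)"
      by (intro tendsto_intros lim_u lim_U)
    then have B: "?B \<longlonglongrightarrow> 0" by simp
    show ?thesis
    proof (rule tendsto_sandwich[OF _ _ tendsto_const B]; rule always_eventually; rule allI)
      fix n
      show "0 \<le> (LINT x|lborel. (norm (F n x - F0 x))\<^sup>2)" by simp
      have iu: "integrable lborel (\<lambda>x. (norm (u n x))\<^sup>2)" by (rule l2_integrable[OF l2u])
      have iU: "integrable lborel (\<lambda>x. (norm (U n k x))\<^sup>2)" for k by (rule l2_integrable[OF l2U])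
      have "(LINT x|lborel. (norm (F n x - F0 x))\<^sup>2)
          \<le> (LINT x|lborel. 8 * (\<Sum>k\<in>UNIV. (norm (U n k x))\<^sup>2) + 2 * ((48 / R)\<^sup>2 * (norm (u n x))\<^sup>2))"
      proof (rule integral_mono)
        show "integrable lborel (\<lambda>x. (norm (F n x - F0 x))\<^sup>2)"
          unfolding F add_diff_cancel_left' by (rule l2_integrable[OF l2D])
        show "integrable lborel (\<lambda>x. 8 * (\<Sum>k\<in>UNIV. (norm (U n k x))\<^sup>2) + 2 * ((48 / R)\<^sup>2 * (norm (u n x))\<^sup>2))"
          using iu iU by (intro Bochner_Integration.integrable_add integrable_mult_right Bochner_Integration.integrable_sum)
        fix x
        have "(norm (F n x - F0 x))\<^sup>2 \<le> 2 * (norm (\<xi> R x *\<^sub>R (\<Sum>k\<in>UNIV. sg k (U n k x))))\<^sup>2 + 2 * (norm (\<tau> R x *\<^sub>R slash x (u n x)))\<^sup>2"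
          unfolding F add_diff_cancel_left' by (rule norm_add_sq_le)
        also have "\<dots> \<le> 2 * (4 * (\<Sum>k\<in>UNIV. (norm (U n k x))\<^sup>2)) + 2 * ((48 / R)\<^sup>2 * (norm (u n x))\<^sup>2)"
          by (intro add_mono mult_left_mono order_trans[OF norm_xi_sq norm_sum_sg] tau_slash_bound[OF R]) auto
        finally show "(norm (F n x - F0 x))\<^sup>2 \<le> 8 * (\<Sum>k\<in>UNIV. (norm (U n k x))\<^sup>2) + 2 * ((48 / R)\<^sup>2 * (norm (u n x))\<^sup>2)"
          by simp
      qed
      also have "\<dots> = ?B n" using iu iU by simp
      finally show "(LINT x|lborel. (norm (F n x - F0 x))\<^sup>2) \<le> ?B n" .
    qed
  qed
  note wt = weight_bounds[OF eps]
  have t1: "(\<lambda>n. LINT x|lborel. (norm x)\<^sup>2 * (s x) ^ 3 * (norm (H n x))\<^sup>2) \<longlonglongrightarrow> (LINT x|lborel. (norm x)\<^sup>2 * (s x) ^ 3 * (norm (H0 x))\<^sup>2)"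
    unfolding s_def by (rule l2_tendsto[OF l2H l2H0 lim_H wt(3) wt(6)])
  have t2: "(\<lambda>n. LINT x|lborel. norm x / (1 + norm x) * (norm (F n x))\<^sup>2) \<longlonglongrightarrow> (LINT x|lborel. norm x / (1 + norm x) * (norm (F0 x))\<^sup>2)"
    by (rule l2_tendsto[OF l2F l2F0 lim_F wt(1) wt(4)])
  have t3: "(\<lambda>n. LINT x|lborel. (norm x)\<^sup>2 * (s x)\<^sup>2 * (norm (H n x))\<^sup>2) \<longlonglongrightarrow> (LINT x|lborel. (norm x)\<^sup>2 * (s x)\<^sup>2 * (norm (H0 x))\<^sup>2)"
    unfolding s_def by (rule l2_tendsto[OF l2H l2H0 lim_H wt(2) wt(5)])
  have "(LINT x|lborel. (norm x)\<^sup>2 * (s x) ^ 3 * (norm (H n x))\<^sup>2)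
    \<le> (LINT x|lborel. norm x / (1 + norm x) * (norm (F n x))\<^sup>2) + (LINT x|lborel. (norm x)\<^sup>2 * (s x)\<^sup>2 * (norm (H n x))\<^sup>2)" for n
    unfolding H_def F_def s_def by (rule poly_ineq[OF vp radial_weight_xi[OF R] eps])
  then have "(LINT x|lborel. (norm x)\<^sup>2 * (s x) ^ 3 * (norm (H0 x))\<^sup>2)
    \<le> (LINT x|lborel. norm x / (1 + norm x) * (norm (F0 x))\<^sup>2) + (LINT x|lborel. (norm x)\<^sup>2 * (s x)\<^sup>2 * (norm (H0 x))\<^sup>2)"
    by (intro LIMSEQ_le[OF t1 tendsto_add[OF t2 t3]]) blast
  moreover have "H0 x = (\<xi> R x)\<^sup>2 *\<^sub>R \<phi> x" for x
    by (simp add: H0_def \<psi>_def power2_eq_square)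
  moreover have "F0 x = (\<xi> R x)\<^sup>2 *\<^sub>R dg x + (2 * \<xi> R x * \<tau> R x) *\<^sub>R slash x (\<phi> x)" for x
  proof -
    have "(\<Sum>k\<in>UNIV. sg k (G R k x)) = \<xi> R x *\<^sub>R dg x + \<tau> R x *\<^sub>R slash x (\<phi> x)"
      by (simp add: G_def dg_def slash_def sg_simps sum.distrib scaleR_sum_right)
    then show ?thesis
      by (simp add: F0_def \<psi>_def slash_simps power2_eq_square algebra_simps numeral_mult_vec flip: scaleR_2)
  qed
  ultimately show ?thesis by simp
qed

text \<open>As the radius grows, \<open>\<xi>^2\<close> tends to the constant \<open>b^2\<close> and
  the gradient of the cutoff to 0. All three integrals then carry the factor \<open>b^4 > 0\<close>,
  which cancels.\<close>

lemma regularized_ineq: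
  assumes eps: "\<epsilon> > 0"
  defines "s \<equiv> \<lambda>x::real^3. 1 / sqrt ((norm x)\<^sup>2 + \<epsilon>\<^sup>2)"
  shows "(LINT x|lborel. (norm x)\<^sup>2 * (s x) ^ 3 * (norm (\<phi> x))\<^sup>2)
    \<le> (LINT x|lborel. norm x / (1 + norm x) * (norm (dg x))\<^sup>2) + (LINT x|lborel. (norm x)\<^sup>2 * (s x)\<^sup>2 * (norm (\<phi> x))\<^sup>2)"
proof -
  define R where "R n = real (Suc n)" for n
  have R: "R n > 0" "R n \<ge> 1" for n by (simp_all add: R_def)
  have invR: "(\<lambda>n. 1 / R n) \<longlonglongrightarrow> 0" unfolding R_def by (rule LIMSEQ_Suc[OF lim_1_over_n])
  define b where "b = flat 0 1"
  have b: "b > 0" by (simp add: b_def flat_def)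
  have l2dg: "l2 dg" unfolding dg_def by (intro l2_sum l2_bounded_linear[OF bounded_linear_sg] l2_g)
  have xi_lim: "(\<lambda>n. \<xi> (R n) x) \<longlonglongrightarrow> b" for x
  proof -
    have "(\<lambda>n. 1 - (1 / R n)\<^sup>2 * (norm x)\<^sup>2) \<longlonglongrightarrow> 1 - 0\<^sup>2 * (norm x)\<^sup>2"
      by (intro tendsto_intros invR)
    then have "(\<lambda>n. flat 0 (1 - (1 / R n)\<^sup>2 * (norm x)\<^sup>2)) \<longlonglongrightarrow> flat 0 1"
      using continuous_on_tendsto_compose[OF flat_continuous[of 0], of _ 1] by simp
    then show ?thesis by (simp add: \<xi>_def b_def power_divide)
  qed
  define F where "F n x = (\<xi> (R n) x)\<^sup>2 *\<^sub>R dg x + (2 * \<xi> (R n) x * \<tau> (R n) x) *\<^sub>R slash x (\<phi> x)" for n x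
  define H where "H n x = (\<xi> (R n) x)\<^sup>2 *\<^sub>R \<phi> x" for n x
  have F_eq: "F n x = \<xi> (R n) x *\<^sub>R (\<xi> (R n) x *\<^sub>R dg x + 2 *\<^sub>R (\<tau> (R n) x *\<^sub>R slash x (\<phi> x)))" for n x
    by (simp add: F_def power2_eq_square algebra_simps)
  have H_eq: "H n x = \<xi> (R n) x *\<^sub>R (\<xi> (R n) x *\<^sub>R \<phi> x)" for n x
    by (simp add: H_def power2_eq_square)
  have l2F: "l2 (F n)" for n
    unfolding F_eq by (intro l2_xi l2_add l2dg l2_bounded_linear[OF bounded_linear_scaleR_right] l2_tau_slash R l2_phi)
  have l2H: "l2 (H n)" for n
    unfolding H_eq by (intro l2_xi l2_phi)
  have l2F0: "l2 (\<lambda>x. b\<^sup>2 *\<^sub>R dg x)" "l2 (\<lambda>x. b\<^sup>2 *\<^sub>R \<phi> x)"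
    by (intro l2_bounded_linear[OF bounded_linear_scaleR_right] l2dg l2_phi)+
  have b1: "b\<^sup>2 \<le> 1" using flat_le_1[of 1] b by (simp add: b_def power_le_one)
  have b_le: "(norm (b\<^sup>2 *\<^sub>R v))\<^sup>2 \<le> (norm v)\<^sup>2" for v :: "complex^2"
    using b1 by (intro power_mono) (auto simp: mult_left_le_one_le)
  have lim_F: "(\<lambda>n. LINT x|lborel. (norm (F n x - b\<^sup>2 *\<^sub>R dg x))\<^sup>2) \<longlonglongrightarrow> (LINT x::real^3|lborel. 0)"
  \<comment> \<open>Twice the bound \<open>2 |dg|^2 + 8 * 48^2 |\<phi>|^2\<close> for
    \<open>F n\<close>, plus \<open>2 |dg|^2\<close> for the limit.\<close>
  proof (rule integral_dominated_convergence[where w="\<lambda>x. 6 * (norm (dg x))\<^sup>2 + 16 * (48\<^sup>2 * (norm (\<phi> x))\<^sup>2)"])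
    show "(\<lambda>x. (norm (F n x - b\<^sup>2 *\<^sub>R dg x))\<^sup>2) \<in> borel_measurable lborel" for n
      using l2_measurable[OF l2_diff[OF l2F l2F0(1)], of n] by simp
    show "integrable lborel (\<lambda>x. 6 * (norm (dg x))\<^sup>2 + 16 * (48\<^sup>2 * (norm (\<phi> x))\<^sup>2))"
      using l2_integrable[OF l2dg] l2_integrable[OF l2_phi] by simp
    show "AE x in lborel. (\<lambda>n. (norm (F n x - b\<^sup>2 *\<^sub>R dg x))\<^sup>2) \<longlonglongrightarrow> 0"
    proof (rule AE_I2)
      fix x
      have "(\<lambda>n. \<tau> (R n) x *\<^sub>R slash x (\<phi> x)) \<longlonglongrightarrow> 0"
      proof (rule Lim_null_comparison)
        show "\<forall>\<^sub>F n in sequentially. norm (\<tau> (R n) x *\<^sub>R slash x (\<phi> x)) \<le> (1 / R n) * (48 * norm (\<phi> x))"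
          using mult_right_mono[OF tau_bound[OF R(1), of _ x] norm_ge_zero[of "\<phi> x"]]
          by (intro always_eventually allI) (simp add: norm_slash mult.assoc)
        have "(\<lambda>n. (1 / R n) * (48 * norm (\<phi> x))) \<longlonglongrightarrow> 0 * (48 * norm (\<phi> x))"
          by (intro tendsto_intros invR)
        then show "(\<lambda>n. (1 / R n) * (48 * norm (\<phi> x))) \<longlonglongrightarrow> 0" by simp
      qed
      then have "(\<lambda>n. (norm (F n x - b\<^sup>2 *\<^sub>R dg x))\<^sup>2) \<longlonglongrightarrow> (norm (b *\<^sub>R (b *\<^sub>R dg x + 2 *\<^sub>R 0) - b\<^sup>2 *\<^sub>R dg x))\<^sup>2"
        unfolding F_eq by (intro tendsto_intros xi_lim)
      then show "(\<lambda>n. (norm (F n x - b\<^sup>2 *\<^sub>R dg x))\<^sup>2) \<longlonglongrightarrow> 0"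
        by (simp add: power2_eq_square)
    qed
    show "AE x in lborel. norm ((norm (F n x - b\<^sup>2 *\<^sub>R dg x))\<^sup>2) \<le> 6 * (norm (dg x))\<^sup>2 + 16 * (48\<^sup>2 * (norm (\<phi> x))\<^sup>2)" for n
    proof (rule AE_I2)
      fix x
      let ?y = "\<tau> (R n) x *\<^sub>R slash x (\<phi> x)"
      have "(48 / R n)\<^sup>2 \<le> 48\<^sup>2" using R(2)[of n] by (intro power_mono) (auto simp: divide_le_eq)
      then have y: "(norm ?y)\<^sup>2 \<le> 48\<^sup>2 * (norm (\<phi> x))\<^sup>2"
        by (intro order_trans[OF tau_slash_bound[OF R(1)]] mult_right_mono) auto
      have "(norm (F n x))\<^sup>2 \<le> (norm (\<xi> (R n) x *\<^sub>R dg x + 2 *\<^sub>R ?y))\<^sup>2"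
        unfolding F_eq by (rule norm_xi_sq)
      also have "\<dots> \<le> 2 * (norm (\<xi> (R n) x *\<^sub>R dg x))\<^sup>2 + 2 * (norm (2 *\<^sub>R ?y))\<^sup>2" by (rule norm_add_sq_le)
      also have "\<dots> \<le> 2 * (norm (dg x))\<^sup>2 + 8 * (48\<^sup>2 * (norm (\<phi> x))\<^sup>2)"
      proof -
        have "(norm (2 *\<^sub>R ?y))\<^sup>2 = 4 * (norm ?y)\<^sup>2" by (simp add: power_mult_distrib)
        then show ?thesis using norm_xi_sq[of "R n" x "dg x"] y by linarith
      qed
      finally have Fb: "(norm (F n x))\<^sup>2 \<le> 2 * (norm (dg x))\<^sup>2 + 8 * (48\<^sup>2 * (norm (\<phi> x))\<^sup>2)" .
      have "(norm (F n x - b\<^sup>2 *\<^sub>R dg x))\<^sup>2 \<le> 2 * (norm (F n x))\<^sup>2 + 2 * (norm (b\<^sup>2 *\<^sub>R dg x))\<^sup>2"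
        by (rule norm_diff_sq_le)
      then show "norm ((norm (F n x - b\<^sup>2 *\<^sub>R dg x))\<^sup>2) \<le> 6 * (norm (dg x))\<^sup>2 + 16 * (48\<^sup>2 * (norm (\<phi> x))\<^sup>2)"
        using Fb b_le[of "dg x"] unfolding real_norm_def abs_power2 by linarith
    qed
  qed simp
  have lim_H: "(\<lambda>n. LINT x|lborel. (norm (H n x - b\<^sup>2 *\<^sub>R \<phi> x))\<^sup>2) \<longlonglongrightarrow> (LINT x::real^3|lborel. 0)"
  proof (rule integral_dominated_convergence[where w="\<lambda>x. 4 * (norm (\<phi> x))\<^sup>2"])
    show "(\<lambda>x. (norm (H n x - b\<^sup>2 *\<^sub>R \<phi> x))\<^sup>2) \<in> borel_measurable lborel" for n
      using l2_measurable[OF l2_diff[OF l2H l2F0(2)], of n] by simp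
    show "integrable lborel (\<lambda>x. 4 * (norm (\<phi> x))\<^sup>2)"
      using l2_integrable[OF l2_phi] by simp
    show "AE x in lborel. (\<lambda>n. (norm (H n x - b\<^sup>2 *\<^sub>R \<phi> x))\<^sup>2) \<longlonglongrightarrow> 0"
    proof (rule AE_I2)
      fix x
      have "(\<lambda>n. (norm (H n x - b\<^sup>2 *\<^sub>R \<phi> x))\<^sup>2) \<longlonglongrightarrow> (norm (b *\<^sub>R (b *\<^sub>R \<phi> x) - b\<^sup>2 *\<^sub>R \<phi> x))\<^sup>2"
        unfolding H_eq by (intro tendsto_intros xi_lim)
      then show "(\<lambda>n. (norm (H n x - b\<^sup>2 *\<^sub>R \<phi> x))\<^sup>2) \<longlonglongrightarrow> 0"
        by (simp add: power2_eq_square)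
    qed
    show "AE x in lborel. norm ((norm (H n x - b\<^sup>2 *\<^sub>R \<phi> x))\<^sup>2) \<le> 4 * (norm (\<phi> x))\<^sup>2" for n
    proof (rule AE_I2)
      fix x
      have "(norm (H n x))\<^sup>2 \<le> (norm (\<phi> x))\<^sup>2"
        unfolding H_eq by (rule order_trans[OF norm_xi_sq norm_xi_sq])
      then show "norm ((norm (H n x - b\<^sup>2 *\<^sub>R \<phi> x))\<^sup>2) \<le> 4 * (norm (\<phi> x))\<^sup>2"
        using norm_diff_sq_le[of "H n x" "b\<^sup>2 *\<^sub>R \<phi> x"] b_le[of "\<phi> x"]
        unfolding real_norm_def abs_power2 by linarith
    qed
  qed simp
  note wt = weight_bounds[OF eps]
  note lim_F = lim_F[unfolded Bochner_Integration.integral_zero]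
  note lim_H = lim_H[unfolded Bochner_Integration.integral_zero]
  have t1: "(\<lambda>n. LINT x|lborel. (norm x)\<^sup>2 * (s x) ^ 3 * (norm (H n x))\<^sup>2) \<longlonglongrightarrow> (LINT x|lborel. (norm x)\<^sup>2 * (s x) ^ 3 * (norm (b\<^sup>2 *\<^sub>R \<phi> x))\<^sup>2)"
    unfolding s_def by (rule l2_tendsto[OF l2H l2F0(2) lim_H wt(3) wt(6)])
  have t2: "(\<lambda>n. LINT x|lborel. norm x / (1 + norm x) * (norm (F n x))\<^sup>2) \<longlonglongrightarrow> (LINT x|lborel. norm x / (1 + norm x) * (norm (b\<^sup>2 *\<^sub>R dg x))\<^sup>2)"
    by (rule l2_tendsto[OF l2F l2F0(1) lim_F wt(1) wt(4)])
  have t3: "(\<lambda>n. LINT x|lborel. (norm x)\<^sup>2 * (s x)\<^sup>2 * (norm (H n x))\<^sup>2) \<longlonglongrightarrow> (LINT x|lborel. (norm x)\<^sup>2 * (s x)\<^sup>2 * (norm (b\<^sup>2 *\<^sub>R \<phi> x))\<^sup>2)"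
    unfolding s_def by (rule l2_tendsto[OF l2H l2F0(2) lim_H wt(2) wt(5)])
  have "(LINT x|lborel. (norm x)\<^sup>2 * (s x) ^ 3 * (norm (H n x))\<^sup>2)
    \<le> (LINT x|lborel. norm x / (1 + norm x) * (norm (F n x))\<^sup>2) + (LINT x|lborel. (norm x)\<^sup>2 * (s x)\<^sup>2 * (norm (H n x))\<^sup>2)" for n
    unfolding H_def F_def s_def by (rule truncated_ineq[OF R(1) eps])
  then have lim: "(LINT x|lborel. (norm x)\<^sup>2 * (s x) ^ 3 * (norm (b\<^sup>2 *\<^sub>R \<phi> x))\<^sup>2)
    \<le> (LINT x|lborel. norm x / (1 + norm x) * (norm (b\<^sup>2 *\<^sub>R dg x))\<^sup>2) + (LINT x|lborel. (norm x)\<^sup>2 * (s x)\<^sup>2 * (norm (b\<^sup>2 *\<^sub>R \<phi> x))\<^sup>2)"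
    by (intro LIMSEQ_le[OF t1 tendsto_add[OF t2 t3]]) blast
  have scale: "(LINT x|lborel. w x * (norm (b\<^sup>2 *\<^sub>R f x))\<^sup>2) = b ^ 4 * (LINT x|lborel. w x * (norm (f x))\<^sup>2)"
    for w and f :: "real^3 \<Rightarrow> complex^2"
  proof -
    have "w x * (norm (b\<^sup>2 *\<^sub>R f x))\<^sup>2 = b ^ 4 * (w x * (norm (f x))\<^sup>2)" for x
      by (simp add: power_mult_distrib flip: power_mult)
    then show ?thesis by (simp only: integral_mult_right_zero)
  qed
  have "b ^ 4 > 0" using b by simp
  then show ?thesis
    using lim[unfolded scale] by (metis (no_types, lifting) distrib_left mult_le_cancel_left_pos)
qed

text \<open>Stated with nonnegative integrals, since integrability of
  \<open>|\<phi>|^2 / |x|\<close> is not known beforehand; Fatou's lemma yields it together with the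
  bound.\<close>

lemma nn_ineq:
  "(\<integral>\<^sup>+x. ennreal ((norm (\<phi> x))\<^sup>2 / norm x) \<partial>lborel)
    \<le> (\<integral>\<^sup>+x. ennreal (norm x / (1 + norm x) * (norm (dg x))\<^sup>2 + (norm (\<phi> x))\<^sup>2) \<partial>lborel)"
proof -
  define s where "s n x = 1 / sqrt ((norm x)\<^sup>2 + (1 / real (Suc n))\<^sup>2)" for n and x :: "real^3"
  have eps: "1 / real (Suc n) > 0" for n by simp
  note wt = weight_bounds[OF eps, folded s_def]
  have l2dg: "l2 dg" unfolding dg_def by (intro l2_sum l2_bounded_linear[OF bounded_linear_sg] l2_g)
  have int: "integrable lborel (\<lambda>x. w x * (norm (f x))\<^sup>2)"
    if "l2 f" "w \<in> borel_measurable borel" "\<And>x. \<bar>w x\<bar> \<le> C" for f :: "real^3 \<Rightarrow> complex^2" and w C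
  proof (rule Bochner_Integration.integrable_bound)
    show "integrable lborel (\<lambda>x. C * (norm (f x))\<^sup>2)" using l2_integrable[OF that(1)] by simp
    show "(\<lambda>x. w x * (norm (f x))\<^sup>2) \<in> borel_measurable lborel" using l2_measurable[OF that(1)] that(2) by simp
    show "AE x in lborel. norm (w x * (norm (f x))\<^sup>2) \<le> norm (C * (norm (f x))\<^sup>2)"
    proof (rule AE_I2)
      fix x
      have "\<bar>w x\<bar> \<le> \<bar>C\<bar>" using that(3)[of x] by linarith
      then show "norm (w x * (norm (f x))\<^sup>2) \<le> norm (C * (norm (f x))\<^sup>2)"
        by (simp add: abs_mult mult_right_mono)
    qed
  qed
  let ?L = "LINT x|lborel. norm x / (1 + norm x) * (norm (dg x))\<^sup>2 + (norm (\<phi> x))\<^sup>2"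
  have iw: "integrable lborel (\<lambda>x. norm x / (1 + norm x) * (norm (dg x))\<^sup>2)"
    by (rule int[OF l2dg wt(1) wt(4)])
  have bound: "(\<integral>\<^sup>+x. ennreal ((norm x)\<^sup>2 * (s n x) ^ 3 * (norm (\<phi> x))\<^sup>2) \<partial>lborel) \<le> ennreal ?L" for n
  proof -
    have i3: "integrable lborel (\<lambda>x. (norm x)\<^sup>2 * (s n x) ^ 3 * (norm (\<phi> x))\<^sup>2)"
      by (rule int[OF l2_phi wt(3) wt(6)])
    have i2: "integrable lborel (\<lambda>x. (norm x)\<^sup>2 * (s n x)\<^sup>2 * (norm (\<phi> x))\<^sup>2)"
      by (rule int[OF l2_phi wt(2) wt(5)])
    have "(\<integral>\<^sup>+x. ennreal ((norm x)\<^sup>2 * (s n x) ^ 3 * (norm (\<phi> x))\<^sup>2) \<partial>lborel)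
        = ennreal (LINT x|lborel. (norm x)\<^sup>2 * (s n x) ^ 3 * (norm (\<phi> x))\<^sup>2)"
      by (intro nn_integral_eq_integral i3 AE_I2) (simp add: s_def)
    also have "(LINT x|lborel. (norm x)\<^sup>2 * (s n x) ^ 3 * (norm (\<phi> x))\<^sup>2)
      \<le> (LINT x|lborel. norm x / (1 + norm x) * (norm (dg x))\<^sup>2) + (LINT x|lborel. (norm x)\<^sup>2 * (s n x)\<^sup>2 * (norm (\<phi> x))\<^sup>2)"
      unfolding s_def by (rule regularized_ineq[OF eps])
    also have "(LINT x|lborel. (norm x)\<^sup>2 * (s n x)\<^sup>2 * (norm (\<phi> x))\<^sup>2) \<le> (LINT x|lborel. (norm (\<phi> x))\<^sup>2)"
    proof (rule integral_mono[OF i2 l2_integrable[OF l2_phi]])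
      fix x
      have "(norm x)\<^sup>2 * (s n x)\<^sup>2 \<le> 1" using wt(5)[of x n] by linarith
      then show "(norm x)\<^sup>2 * (s n x)\<^sup>2 * (norm (\<phi> x))\<^sup>2 \<le> (norm (\<phi> x))\<^sup>2"
        using mult_right_mono[of _ 1 "(norm (\<phi> x))\<^sup>2"] by simp
    qed
    finally show ?thesis using iw l2_integrable[OF l2_phi] by (simp add: ennreal_leI)
  qed
  have lim: "(\<lambda>n. ennreal ((norm x)\<^sup>2 * (s n x) ^ 3 * (norm (\<phi> x))\<^sup>2)) \<longlonglongrightarrow> ennreal ((norm (\<phi> x))\<^sup>2 / norm x)" for x
  \<comment> \<open>At the origin both sides are 0, because division by 0 gives 0.\<close>
  proof (cases "x = 0")
    case False
    have "(\<lambda>n. (norm x)\<^sup>2 * (1 / sqrt ((norm x)\<^sup>2 + (1 / real (Suc n))\<^sup>2)) ^ 3 * (norm (\<phi> x))\<^sup>2)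
      \<longlonglongrightarrow> (norm x)\<^sup>2 * (1 / sqrt ((norm x)\<^sup>2 + 0\<^sup>2)) ^ 3 * (norm (\<phi> x))\<^sup>2"
      by (intro tendsto_intros LIMSEQ_Suc[OF lim_1_over_n]) (use False in simp)
    moreover have "(norm x)\<^sup>2 * (1 / sqrt ((norm x)\<^sup>2 + 0\<^sup>2)) ^ 3 * (norm (\<phi> x))\<^sup>2 = (norm (\<phi> x))\<^sup>2 / norm x"
      using False by (simp add: power2_eq_square power3_eq_cube)
    ultimately show ?thesis unfolding s_def by (intro tendsto_ennrealI) simp
  qed simp
  have "(\<integral>\<^sup>+x. ennreal ((norm (\<phi> x))\<^sup>2 / norm x) \<partial>lborel)
      = (\<integral>\<^sup>+x. liminf (\<lambda>n. ennreal ((norm x)\<^sup>2 * (s n x) ^ 3 * (norm (\<phi> x))\<^sup>2)) \<partial>lborel)"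
    by (intro nn_integral_cong lim_imp_Liminf[symmetric] lim) simp
  also have "\<dots> \<le> liminf (\<lambda>n. \<integral>\<^sup>+x. ennreal ((norm x)\<^sup>2 * (s n x) ^ 3 * (norm (\<phi> x))\<^sup>2) \<partial>lborel)"
    using wt(3) l2_measurable[OF l2_phi] by (intro nn_integral_liminf) simp
  also have "\<dots> \<le> liminf (\<lambda>n::nat. ennreal ?L)"
    by (intro Liminf_mono always_eventually allI bound)
  also have "\<dots> = ennreal ?L" by (simp add: Liminf_const)
  also have "\<dots> = (\<integral>\<^sup>+x. ennreal (norm x / (1 + norm x) * (norm (dg x))\<^sup>2 + (norm (\<phi> x))\<^sup>2) \<partial>lborel)"
    by (intro nn_integral_eq_integral[symmetric] Bochner_Integration.integrable_add iw l2_integrable[OF l2_phi] AE_I2) simp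
  finally show ?thesis .
qed

end

section \<open>Transfer to Lebesgue measure and chosen weak derivatives\<close>

theorem theorem1:
  fixes \<phi> :: "real^3 \<Rightarrow> complex^2"
  assumes "\<phi> \<in> H1"
  shows "(\<integral>\<^sup>+ x. ennreal ((norm (sigma_grad \<phi> x))\<^sup>2 / (1 + 1 / norm x) + (norm (\<phi> x))\<^sup>2) \<partial>lebesgue)
         \<ge> (\<integral>\<^sup>+ x. ennreal ((norm (\<phi> x))\<^sup>2 / norm x) \<partial>lebesgue)"
proof -
  have \<phi>: "\<phi> \<in> L2" using assms by (simp add: H1_def)
  have wp: "weak_partial k \<phi> \<in> L2 \<and> has_weak_partial k \<phi> (weak_partial k \<phi>)" for k
    unfolding weak_partial_def using assms by (intro someI_ex[where P="\<lambda>g. g \<in> L2 \<and> has_weak_partial k \<phi> g"]) (auto simp: H1_def)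
  obtain f where f: "l2 f" "AE x in lborel. \<phi> x = f x" using L2_borel_version[OF \<phi>] by blast
  have "\<exists>h. l2 h \<and> (AE x in lborel. weak_partial k \<phi> x = h x)" for k
    using L2_borel_version wp by metis
  then obtain g where g: "\<And>k. l2 (g k)" "\<And>k. AE x in lborel. weak_partial k \<phi> x = g k x" by metis
  have m: "\<phi> \<in> borel_measurable lebesgue" "weak_partial k \<phi> \<in> borel_measurable lebesgue" for k
    using \<phi> wp by (auto simp: L2_def)
  interpret weak_spinor f g
  proof
    fix c :: real and \<eta> :: "real^3 \<Rightarrow> real" and k
    assume c: "c > 0" and \<eta>: "bump_poly c \<eta>"
    have cont: "continuous_on UNIV h" if "bump_poly c h" for h :: "real^3 \<Rightarrow> real"
      using that by (auto intro!: continuous_at_imp_continuous_on differentiable_imp_continuous_within bump_poly_differentiable)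
    have "(LINT x|lebesgue. pd k \<eta> x *\<^sub>R \<phi> x) = - (LINT x|lebesgue. \<eta> x *\<^sub>R weak_partial k \<phi> x)"
      using wp[of k] bump_poly_test_function[OF \<eta> c]
      unfolding has_weak_partial_def partial_deriv_eq_pd by blast
    then show "(LINT x|lborel. pd k \<eta> x *\<^sub>R f x) = - (LINT x|lborel. \<eta> x *\<^sub>R g k x)"
      using lebesgue_integral_borel_version[OF cont[OF bump_poly_pd[OF \<eta>]] m(1) l2_measurable[OF f(1)] f(2)]
        lebesgue_integral_borel_version[OF cont[OF \<eta>] m(2) l2_measurable[OF g(1)] g(2)] by simp
  qed (fact f(1) g(1))+
  have ae: "AE x in lborel. \<phi> x = f x \<and> sigma_grad \<phi> x = dg x"
  proof -
    have "AE x in lborel. \<forall>k\<in>UNIV. weak_partial k \<phi> x = g k x"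
      using g(2) by (intro AE_finite_allI) auto
    with f(2) show ?thesis
      by eventually_elim (simp add: sigma_grad_def dg_def)
  qed
  have "(\<integral>\<^sup>+ x. ennreal ((norm (\<phi> x))\<^sup>2 / norm x) \<partial>lebesgue) = (\<integral>\<^sup>+ x. ennreal ((norm (f x))\<^sup>2 / norm x) \<partial>lborel)"
    unfolding nn_integral_completion using ae by (intro nn_integral_cong_AE) (auto elim: eventually_mono)
  also note nn_ineq
  also have "(\<integral>\<^sup>+x. ennreal (norm x / (1 + norm x) * (norm (dg x))\<^sup>2 + (norm (f x))\<^sup>2) \<partial>lborel)
    \<le> (\<integral>\<^sup>+ x. ennreal ((norm (sigma_grad \<phi> x))\<^sup>2 / (1 + 1 / norm x) + (norm (\<phi> x))\<^sup>2) \<partial>lborel)"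
  proof (rule nn_integral_mono_AE)
    from ae show "AE x in lborel. ennreal (norm x / (1 + norm x) * (norm (dg x))\<^sup>2 + (norm (f x))\<^sup>2)
      \<le> ennreal ((norm (sigma_grad \<phi> x))\<^sup>2 / (1 + 1 / norm x) + (norm (\<phi> x))\<^sup>2)"
    proof eventually_elim
      case (elim x)
      have "norm x / (1 + norm x) * (norm (dg x))\<^sup>2 \<le> (norm (dg x))\<^sup>2 / (1 + 1 / norm x)"
      \<comment> \<open>Only an inequality holds at the origin: \<open>1 / 0 = 0\<close> makes the
        right-hand side \<open>(norm (dg x))\<^sup>2\<close>, while the left-hand side is 0.\<close>
      proof (cases "x = 0")
        case False
        then have "norm x > 0" "1 + norm x > 0" by (auto intro: add_pos_pos)
        then show ?thesis by (simp add: field_simps)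
      qed simp
      with elim show ?case by (intro ennreal_leI) simp
    qed
  qed
  finally show ?thesis by (simp only: nn_integral_completion)
qed

end
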